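(* For each natural number $n$ there exists a polynomial $d_n(t)\in\mathbb Z[t]$ with non-negative coefficients such that, for every prime power $q$, $d_n(q-1)$ is the number of distinct irreducible complex characters of $U=U_n(q)$ which occur with minimal degree in their supercharacters.
   Context: Let $q$ be a power of a prime, $n$ a natural number, $U=U_n(q)$ the group of lower unitriangular $n\times n$ matrices over $\mathbb F_q$, and $V$ the additive group of strictly lower triangular $n\times n$ matrices over $\mathbb F_q$. Put $\Phi^+=\{(i,j): 1\leqslant j<i\leqslant n\}$. Fix a nontrivial character $\theta:(\mathbb F_q,+)\to\mathbb C^*$, and for $A\in V$ let $\chi_A:V\to\mathbb C^*$, $\chi_A(B)=\theta\big(\sum_{i,j}A_{ij}B_{ij}\big)$. For an $n\times n$ matrix $M$ let $\overline M\in V$ be obtained by setting all entries on and above the diagonal to zero; write $u^{-t}=(u^{-1})^t$. Let $\mathcal E=\{[A]: A\in V\}$ and let $\mathbb C\mathcal E$ be the $\mathbb C$-space with basis $\mathcal E$, made into a right $\mathbb C U$-module by $[A]u=\chi_A(1-u^{-1})\,[\overline{Au^{-t}}]$ for $u\in U$ (it is isomorphic to the regular module $\mathbb C U$). Let $\mathcal O_A^r=\{[\overline{Au^{-t}}]:u\in U\}$; its span $\mathbb C\mathcal O_A^r=[A]\mathbb C U$ is a right $\mathbb C U$-module. $[A]\in\mathcal E$ is a verge if $A$ has at most one nonzero entry in each row and in each column; its main conditions are the positions $(i_1,j_1),\ldots,(i_k,j_k)$ of the nonzero entries of $A$. The (André–Yan) supercharacters of $U$ are the characters afforded by the modules $\mathbb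 C\mathcal O_A^r$ with $[A]$ a verge; each irreducible character of $U$ is a constituent of exactly one supercharacter ("its supercharacter"). For $(i,j)\in\Phi^+$ the hook centered at $(i,j)$ is $h_{ij}=\{(i,k):j<k<i\}\cup\{(l,j):j<l<i\}\cup\{(i,j)\}$. A hook intersection of a verge is a position in $h_{ij}\cap h_{rs}$ for two distinct main conditions $(i,j),(r,s)$; it occurs exactly when (up to exchanging the two) $j<s<i<r$, and then $h_{ij}\cap h_{rs}=\{(i,s)\}$. For a verge $[A]$ let $a=\sum_{\nu=1}^k(i_\nu-j_\nu-1)$ (so $|\mathcal O_A^r|=q^a$) and let $b$ be the number of hook intersections. Then $q^{a-b}$ is a lower bound for the degrees of irreducible constituents of the supercharacter afforded by $\mathbb C\mathcal O_A^r$; an irreducible constituent of this supercharacter occurs with minimal degree in its supercharacter if its degree equals $q^{a-b}$. *)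

theory Defs
  imports
    "HOL-Library.Function_Algebras"
    "HOL-Library.Indicator_Function"
    "HOL-Computational_Algebra.Polynomial"
    "HOL-Number_Theory.Prime_Powers"
    "Jordan_Normal_Form.Matrix"
begin

section \<open>Complex modules and characters of finite groups\<close>

text \<open>All complex vector spaces are subspaces of a space of functions \<open>'x \<Rightarrow> complex\<close>;
  the function \<open>indicator {x}\<close> plays the role of the basis vector \<open>[x]\<close>.\<close>

definition cscale :: "complex \<Rightarrow> ('x \<Rightarrow> complex) \<Rightarrow> 'x \<Rightarrow> complex" where
  "cscale c f = (\<lambda>x. c * f x)"

global_interpretation cfun: vector_space cscale
  by standard (auto simp: cscale_def fun_eq_iff algebra_simps)

definition right_module ::
  "('g, 'm) monoid_scheme \<Rightarrow> ('x \<Rightarrow> complex) set \<Rightarrow> (('x \<Rightarrow> complex) \<Rightarrow> 'g \<Rightarrow> ('x \<Rightarrow> complex)) \<Rightarrow> bool"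
  where
  "right_module G W act \<longleftrightarrow>
     (\<exists>B. finite B \<and> cfun.span B = W) \<and>
     (\<forall>g\<in>carrier G. \<forall>v\<in>W. act v g \<in> W) \<and>
     (\<forall>g\<in>carrier G. \<forall>v\<in>W. \<forall>w\<in>W. act (v + w) g = act v g + act w g) \<and>
     (\<forall>g\<in>carrier G. \<forall>c. \<forall>v\<in>W. act (cscale c v) g = cscale c (act v g)) \<and>
     (\<forall>v\<in>W. act v \<one>\<^bsub>G\<^esub> = v) \<and>
     (\<forall>g\<in>carrier G. \<forall>h\<in>carrier G. \<forall>v\<in>W. act v (g \<otimes>\<^bsub>G\<^esub> h) = act (act v g) h)"

definition irreducible_module ::
  "('g, 'm) monoid_scheme \<Rightarrow> ('x \<Rightarrow> complex) set \<Rightarrow> (('x \<Rightarrow> complex) \<Rightarrow> 'g \<Rightarrow> ('x \<Rightarrow> complex)) \<Rightarrow> bool"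
  where
  "irreducible_module G W act \<longleftrightarrow>
     right_module G W act \<and> W \<noteq> {0} \<and>
     (\<forall>W'. W' \<subseteq> W \<and> right_module G W' act \<longrightarrow> W' = {0} \<or> W' = W)"

text \<open>For a linear map \<open>T\<close> of a finite-dimensional space \<open>W\<close> into itself the trace does not depend
  on the chosen basis.\<close>

definition trace_on :: "('x \<Rightarrow> complex) set \<Rightarrow> (('x \<Rightarrow> complex) \<Rightarrow> ('x \<Rightarrow> complex)) \<Rightarrow> complex" where
  "trace_on W T =
     (let B = (SOME B. cfun.independent B \<and> cfun.span B = W)
      in \<Sum>b\<in>B. cfun.representation B (T b) b)"

text \<open>Characters are restricted to the carrier, so that equality of characters as HOL functions is
  equality on the group.\<close>

definition module_character ::
  "('g, 'm) monoid_scheme \<Rightarrow> ('x \<Rightarrow> complex) set \<Rightarrow> (('x \<Rightarrow> complex) \<Rightarrow> 'g \<Rightarrow> ('x \<Rightarrow> complex)) \<Rightarrow> 'g \<Rightarrow> complex"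
  where
  "module_character G W act = (\<lambda>g\<in>carrier G. trace_on W (\<lambda>v. act v g))"

text \<open>Every finite-dimensional complex space is isomorphic to a subspace of \<open>nat \<Rightarrow> complex\<close>.\<close>

definition irreducible_characters :: "('g, 'm) monoid_scheme \<Rightarrow> ('g \<Rightarrow> complex) set" where
  "irreducible_characters G =
     {module_character G W act | (W :: (nat \<Rightarrow> complex) set) act. irreducible_module G W act}"

definition char_inner :: "('g, 'm) monoid_scheme \<Rightarrow> ('g \<Rightarrow> complex) \<Rightarrow> ('g \<Rightarrow> complex) \<Rightarrow> complex" where
  "char_inner G \<phi> \<psi> = (\<Sum>g\<in>carrier G. \<phi> g * cnj (\<psi> g)) / of_nat (card (carrier G))"

definition irreducible_constituent ::
  "('g, 'm) monoid_scheme \<Rightarrow> ('g \<Rightarrow> complex) \<Rightarrow> ('g \<Rightarrow> complex) \<Rightarrow> bool" where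
  "irreducible_constituent G \<chi> \<psi> \<longleftrightarrow> \<chi> \<in> irreducible_characters G \<and> char_inner G \<psi> \<chi> \<noteq> 0"


section \<open>Matrices over a ring given by a record\<close>

text \<open>The matrix type serves only as a container here: its entries lie in the carrier of \<open>R\<close>, and
  the arithmetic is that of \<open>R\<close>. Rows and columns are numbered \<open>0, \<dots>, n - 1\<close>.\<close>

definition mats :: "('a, 'm) ring_scheme \<Rightarrow> nat \<Rightarrow> 'a mat set" where
  "mats R n = {A \<in> carrier_mat n n. \<forall>i<n. \<forall>j<n. A $$ (i, j) \<in> carrier R}"

definition mmult :: "('a, 'm) ring_scheme \<Rightarrow> nat \<Rightarrow> 'a mat \<Rightarrow> 'a mat \<Rightarrow> 'a mat" where
  "mmult R n A B = mat n n (\<lambda>(i, j). \<Oplus>\<^bsub>R\<^esub>k\<in>{..<n}. A $$ (i, k) \<otimes>\<^bsub>R\<^esub> B $$ (k, j))"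

definition mone :: "('a, 'm) ring_scheme \<Rightarrow> nat \<Rightarrow> 'a mat" where
  "mone R n = mat n n (\<lambda>(i, j). if i = j then \<one>\<^bsub>R\<^esub> else \<zero>\<^bsub>R\<^esub>)"

definition mminus :: "('a, 'm) ring_scheme \<Rightarrow> nat \<Rightarrow> 'a mat \<Rightarrow> 'a mat \<Rightarrow> 'a mat" where
  "mminus R n A B = mat n n (\<lambda>(i, j). A $$ (i, j) \<ominus>\<^bsub>R\<^esub> B $$ (i, j))"

definition strict_lower_part :: "('a, 'm) ring_scheme \<Rightarrow> nat \<Rightarrow> 'a mat \<Rightarrow> 'a mat" where
  "strict_lower_part R n A = mat n n (\<lambda>(i, j). if j < i then A $$ (i, j) else \<zero>\<^bsub>R\<^esub>)"

definition unitriangular :: "('a, 'm) ring_scheme \<Rightarrow> nat \<Rightarrow> 'a mat monoid" where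
  "unitriangular R n =
     \<lparr>carrier = {A \<in> mats R n. (\<forall>i<n. A $$ (i, i) = \<one>\<^bsub>R\<^esub>) \<and> (\<forall>i<n. \<forall>j<n. i < j \<longrightarrow> A $$ (i, j) = \<zero>\<^bsub>R\<^esub>)},
      mult = mmult R n,
      one = mone R n\<rparr>"

definition strict_lower :: "('a, 'm) ring_scheme \<Rightarrow> nat \<Rightarrow> 'a mat set" where
  "strict_lower R n = {A \<in> mats R n. \<forall>i<n. \<forall>j<n. i \<le> j \<longrightarrow> A $$ (i, j) = \<zero>\<^bsub>R\<^esub>}"


section \<open>The monomial module and the supercharacters\<close>

definition nontrivial_additive_character :: "('a, 'm) ring_scheme \<Rightarrow> ('a \<Rightarrow> complex) \<Rightarrow> bool" where
  "nontrivial_additive_character R \<theta> \<longleftrightarrow>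
     (\<forall>x\<in>carrier R. \<theta> x \<noteq> 0) \<and>
     (\<forall>x\<in>carrier R. \<forall>y\<in>carrier R. \<theta> (x \<oplus>\<^bsub>R\<^esub> y) = \<theta> x * \<theta> y) \<and>
     (\<exists>x\<in>carrier R. \<theta> x \<noteq> 1)"

definition chi :: "('a, 'm) ring_scheme \<Rightarrow> nat \<Rightarrow> ('a \<Rightarrow> complex) \<Rightarrow> 'a mat \<Rightarrow> 'a mat \<Rightarrow> complex" where
  "chi R n \<theta> A B = \<theta> (\<Oplus>\<^bsub>R\<^esub>i\<in>{..<n}. \<Oplus>\<^bsub>R\<^esub>j\<in>{..<n}. A $$ (i, j) \<otimes>\<^bsub>R\<^esub> B $$ (i, j))"

text \<open>The matrix obtained from \<open>A u\<^sup>-\<^sup>t\<close> by deleting the entries on and above the diagonal.\<close>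

definition dot_act :: "('a, 'm) ring_scheme \<Rightarrow> nat \<Rightarrow> 'a mat \<Rightarrow> 'a mat \<Rightarrow> 'a mat" where
  "dot_act R n A u =
     strict_lower_part R n (mmult R n A (transpose_mat (inv\<^bsub>unitriangular R n\<^esub> u)))"

text \<open>The linear extension of \<open>[A] u = \<chi>\<^sub>A(1 - u\<^sup>-\<^sup>1) [A.u]\<close>.\<close>

definition monomial_act ::
  "('a, 'm) ring_scheme \<Rightarrow> nat \<Rightarrow> ('a \<Rightarrow> complex) \<Rightarrow> ('a mat \<Rightarrow> complex) \<Rightarrow> 'a mat \<Rightarrow> ('a mat \<Rightarrow> complex)"
  where
  "monomial_act R n \<theta> f u =
     (\<Sum>A\<in>strict_lower R n.
        cscale (f A * chi R n \<theta> A (mminus R n (mone R n) (inv\<^bsub>unitriangular R n\<^esub> u)))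
          (indicator {dot_act R n A u}))"

definition right_orbit :: "('a, 'm) ring_scheme \<Rightarrow> nat \<Rightarrow> 'a mat \<Rightarrow> 'a mat set" where
  "right_orbit R n A = dot_act R n A ` carrier (unitriangular R n)"

definition orbit_module :: "('a, 'm) ring_scheme \<Rightarrow> nat \<Rightarrow> 'a mat \<Rightarrow> ('a mat \<Rightarrow> complex) set" where
  "orbit_module R n A = cfun.span ((\<lambda>B. indicator {B}) ` right_orbit R n A)"

definition orbit_character ::
  "('a, 'm) ring_scheme \<Rightarrow> nat \<Rightarrow> ('a \<Rightarrow> complex) \<Rightarrow> 'a mat \<Rightarrow> 'a mat \<Rightarrow> complex" where
  "orbit_character R n \<theta> A =
     module_character (unitriangular R n) (orbit_module R n A) (monomial_act R n \<theta>)"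

definition main_conditions :: "('a, 'm) ring_scheme \<Rightarrow> nat \<Rightarrow> 'a mat \<Rightarrow> (nat \<times> nat) set" where
  "main_conditions R n A = {(i, j). i < n \<and> j < n \<and> A $$ (i, j) \<noteq> \<zero>\<^bsub>R\<^esub>}"

definition verge :: "('a, 'm) ring_scheme \<Rightarrow> nat \<Rightarrow> 'a mat \<Rightarrow> bool" where
  "verge R n A \<longleftrightarrow>
     A \<in> strict_lower R n \<and>
     (\<forall>i j k. (i, j) \<in> main_conditions R n A \<and> (i, k) \<in> main_conditions R n A \<longrightarrow> j = k) \<and>
     (\<forall>i k j. (i, j) \<in> main_conditions R n A \<and> (k, j) \<in> main_conditions R n A \<longrightarrow> i = k)"

definition hook :: "nat \<times> nat \<Rightarrow> (nat \<times> nat) set" where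
  "hook = (\<lambda>(i, j). {(i, k) | k. j < k \<and> k < i} \<union> {(l, j) | l. j < l \<and> l < i} \<union> {(i, j)})"

definition hook_intersections :: "('a, 'm) ring_scheme \<Rightarrow> nat \<Rightarrow> 'a mat \<Rightarrow> (nat \<times> nat) set" where
  "hook_intersections R n A =
     {p. \<exists>c\<in>main_conditions R n A. \<exists>d\<in>main_conditions R n A. c \<noteq> d \<and> p \<in> hook c \<inter> hook d}"

text \<open>The subtractions on natural numbers below never truncate for a verge: main conditions
  \<open>(i, j)\<close> satisfy \<open>j < i\<close>, and there are at most \<open>i - j - 1\<close> hook intersections in row \<open>i\<close>.\<close>

definition verge_a :: "('a, 'm) ring_scheme \<Rightarrow> nat \<Rightarrow> 'a mat \<Rightarrow> nat" where
  "verge_a R n A = (\<Sum>(i, j)\<in>main_conditions R n A. i - j - 1)"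

definition verge_b :: "('a, 'm) ring_scheme \<Rightarrow> nat \<Rightarrow> 'a mat \<Rightarrow> nat" where
  "verge_b R n A = card (hook_intersections R n A)"

text \<open>The irreducible characters occurring with minimal degree in their supercharacter. The
  supercharacter of an irreducible character is unique, so it may be introduced existentially.\<close>

definition minimal_degree_characters ::
  "('a, 'm) ring_scheme \<Rightarrow> nat \<Rightarrow> ('a \<Rightarrow> complex) \<Rightarrow> ('a mat \<Rightarrow> complex) set" where
  "minimal_degree_characters R n \<theta> =
     {\<chi>. \<exists>A. verge R n A \<and>
          irreducible_constituent (unitriangular R n) \<chi> (orbit_character R n \<theta> A) \<and>
          \<chi> \<one>\<^bsub>unitriangular R n\<^esub> = of_nat (card (carrier R) ^ (verge_a R n A - verge_b R n A))}"

end

(*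
  Write \<nu> for the linear character by which the stabilizer H of a verge [A] acts on the line spanned
  by [A], and K for the normalizer of (H, \<nu>), a pattern subgroup of index q^(a-b). If e is the idempotent
  of \<nu>, then e g e = 0 for every g outside K. Hence an irreducible module W on which e does not vanish
  is the direct sum of the translates of W e along the cosets of K, so dim W = q^(a-b) dim (W e); no Schur
  lemma or orthogonality is needed, as every trace in question is the trace of a sum of operators
  v \<mapsto> l(v) z. Minimal degree means that W e is a line, and then W is induced from an extension of \<nu>
  to K.

  Distinct verges share no constituent, and the extensions of \<nu> to K can be counted because commutators
  in a pattern group kill exactly the decomposable positions: there is no extension if a main condition is
  decomposable in K, and otherwise there are q^c of them, c being the number of indecomposable crossings.
  Both alternatives and c depend only on the set D of main conditions, and there are (q-1)^|D| verges with
  main conditions D. So d_n(t) is the sum of t^|D| (1+t)^c over the sets D without such an obstruction.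
*)
theory Submission
  imports Defs
begin

section \<open>Traces\<close>

text \<open>Irreducible characters are given only as functions, and an equality between two of them
  yields no isomorphism of modules. What passes from one module to another is the sum
  \<open>character_pairing H \<nu> \<chi>\<close>: up to the factor \<open>card H\<close> it is the
  trace of e, that is the dimension of W e, and it depends on \<chi> alone. It decides whether
  \<chi> is a constituent of an orbit module, because that module is induced from the stabilizer,
  and whether two verges can share a constituent. One statement about matrices,
  \<open>compatible_imp_eq\<close>, feeds both uses: if the stabilizer characters of two verges A
  and B, compared after conjugation by g, agree wherever both are defined, then A = B and g lies in
  K. For A = B it gives e g e = 0 outside K; in general it separates verges. The shape of K has this
  origin: an entry of u at a leg (k,j) of a main condition (i,j) creates, when A is moved, an entry
  at (i,k). It is harmless when column k has a main condition below row i, for then (i,k) is a leg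
  too and all elements of the stabilizer vanish there. Such legs are the crossings.\<close>

definition linear_functional_on :: "('x \<Rightarrow> complex) set \<Rightarrow> (('x \<Rightarrow> complex) \<Rightarrow> complex) \<Rightarrow> bool" where
  "linear_functional_on W l \<longleftrightarrow>
     (\<forall>v\<in>W. \<forall>w\<in>W. l (v + w) = l v + l w) \<and> (\<forall>c. \<forall>v\<in>W. l (cscale c v) = c * l v)"

definition linear_endo_on ::
  "('x \<Rightarrow> complex) set \<Rightarrow> (('x \<Rightarrow> complex) \<Rightarrow> ('x \<Rightarrow> complex)) \<Rightarrow> bool" where
  "linear_endo_on W T \<longleftrightarrow>
     (\<forall>v\<in>W. T v \<in> W) \<and> (\<forall>v\<in>W. \<forall>w\<in>W. T (v + w) = T v + T w) \<and>
     (\<forall>c. \<forall>v\<in>W. T (cscale c v) = cscale c (T v))"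

lemma finite_basis_exists:
  assumes "finite S" "V \<subseteq> cfun.span S" "cfun.subspace V"
  obtains B where "finite B" "cfun.independent B" "cfun.span B = V"
proof -
  obtain B where B: "B \<subseteq> V" "cfun.independent B" "V \<subseteq> cfun.span B"
    by (rule cfun.basis_exists)
  have "finite B" using cfun.independent_span_bound[OF assms(1) B(2)] B(1) assms(2) by blast
  moreover have "cfun.span B = V" using B cfun.span_minimal[OF B(1) assms(3)] by blast
  ultimately show ?thesis using that B(2) by blast
qed

text \<open>The basis picked by \<open>SOME\<close> depends on \<open>W\<close> only, so one choice
  serves all \<open>T\<close> at once. Nothing but its existence enters later trace
  computations.\<close>

lemma trace_on_basis:
  assumes "finite S" "cfun.span S = W"
  obtains B where "finite B" "cfun.independent B" "cfun.span B = W"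
    "\<And>T. trace_on W T = (\<Sum>b\<in>B. cfun.representation B (T b) b)"
proof -
  define B where "B = (SOME B. cfun.independent B \<and> cfun.span B = W)"
  have "\<exists>B. cfun.independent B \<and> cfun.span B = W"
    using finite_basis_exists[OF assms(1), of W] assms(2) by (metis cfun.subspace_span order_refl)
  hence B: "cfun.independent B" "cfun.span B = W"
    unfolding B_def by (rule someI2_ex, blast)+
  have "finite B"
    using cfun.independent_span_bound[OF assms(1) B(1)] B(2) assms(2) cfun.span_superset by blast
  thus ?thesis using that B by (simp add: trace_on_def B_def Let_def)
qed

lemma linear_functional_on_sum:
  assumes "linear_functional_on W l" "cfun.subspace W" "\<And>i. i \<in> I \<Longrightarrow> f i \<in> W"
  shows "l (sum f I) = (\<Sum>i\<in>I. l (f i))"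
proof -
  have "l (cscale 0 0) = 0 * l 0"
    using assms(1,2) unfolding linear_functional_on_def cfun.subspace_def by blast
  hence l0: "l 0 = 0" by (simp add: cscale_def zero_fun_def)
  show ?thesis using assms(3)
  proof (induction I rule: infinite_finite_induct)
    case (insert x F)
    hence "sum f F \<in> W" "f x \<in> W" by (auto intro: cfun.subspace_sum[OF assms(2)])
    hence *: "l (f x + sum f F) = l (f x) + l (sum f F)"
      using assms(1) unfolding linear_functional_on_def by blast
    have "l (sum f (insert x F)) = l (f x + sum f F)"
      by (rule arg_cong[where f = l], rule sum.insert, fact, fact)
    also have "\<dots> = l (f x) + (\<Sum>i\<in>F. l (f i))"
      using * insert(3)[OF insert(4)[OF insertI2]] by (rule trans[OF _ arg_cong])
    also have "\<dots> = (\<Sum>i\<in>insert x F. l (f i))"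
      by (rule sum.insert[OF insert(1,2), symmetric])
    finally show ?case .
  qed (use l0 in auto)
qed

lemma linear_functional_on_scale:
  "linear_functional_on W l \<Longrightarrow> v \<in> W \<Longrightarrow> l (cscale c v) = c * l v"
  by (simp add: linear_functional_on_def)

lemma linear_functional_on_representation:
  assumes "cfun.independent B"
  shows "linear_functional_on (cfun.span B) (\<lambda>v. cfun.representation B v b)"
  unfolding linear_functional_on_def
  using assms by (simp add: cfun.representation_add cfun.representation_scale)

lemma linear_endo_on_sum:
  assumes "linear_endo_on W T" "cfun.subspace W" "\<And>i. i \<in> I \<Longrightarrow> f i \<in> W"
  shows "T (sum f I) = (\<Sum>i\<in>I. T (f i))"
proof -
  have "T (cscale 0 0) = cscale 0 (T 0)"
    using assms(1,2) unfolding linear_endo_on_def cfun.subspace_def by blast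
  hence l0: "T 0 = 0" by (simp add: cscale_def zero_fun_def)
  show ?thesis using assms(3)
  proof (induction I rule: infinite_finite_induct)
    case (insert x F)
    hence "sum f F \<in> W" "f x \<in> W" by (auto intro: cfun.subspace_sum[OF assms(2)])
    hence *: "T (f x + sum f F) = T (f x) + T (sum f F)"
      using assms(1) unfolding linear_endo_on_def by blast
    have "T (sum f (insert x F)) = T (f x + sum f F)"
      by (rule arg_cong[where f = T], rule sum.insert, fact, fact)
    also have "\<dots> = T (f x) + (\<Sum>i\<in>F. T (f i))"
      using * insert(3)[OF insert(4)[OF insertI2]] by (rule trans[OF _ arg_cong])
    also have "\<dots> = (\<Sum>i\<in>insert x F. T (f i))"
      by (rule sum.insert[OF insert(1,2), symmetric])
    finally show ?case .
  qed (use l0 in auto)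
qed

lemma linear_functional_on_compose:
  assumes "linear_functional_on W l" "linear_endo_on W T"
  shows "linear_functional_on W (\<lambda>v. l (T v))"
  using assms unfolding linear_functional_on_def linear_endo_on_def by simp

text \<open>Expanding each \<open>z i\<close> in the hidden basis and interchanging the sums
  reassembles \<open>l i (z i)\<close>, so the basis disappears. This one formula replaces both
  basis independence of the trace and the rule for the trace of a product.\<close>

lemma trace_on_finite_rank:
  assumes S: "finite S" "cfun.span S = W" and I: "finite I"
    and l: "\<And>i. i \<in> I \<Longrightarrow> linear_functional_on W (l i)"
    and z: "\<And>i. i \<in> I \<Longrightarrow> z i \<in> W"
    and T: "\<And>v. v \<in> W \<Longrightarrow> T v = (\<Sum>i\<in>I. cscale (l i v) (z i))"
  shows "trace_on W T = (\<Sum>i\<in>I. l i (z i))"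
proof -
  obtain B where B: "finite B" "cfun.independent B" "cfun.span B = W"
    and tr: "\<And>T. trace_on W T = (\<Sum>b\<in>B. cfun.representation B (T b) b)"
    using trace_on_basis[OF S] by blast
  let ?r = "cfun.representation B"
  have W: "cfun.subspace W" using S(2) cfun.subspace_span by blast
  have BW: "b \<in> W" if "b \<in> B" for b using B(3) that cfun.span_superset by blast
  have "trace_on W T = (\<Sum>b\<in>B. ?r (T b) b)" by (rule tr)
  also have "\<dots> = (\<Sum>b\<in>B. \<Sum>i\<in>I. l i b * ?r (z i) b)"
  proof (rule sum.cong[OF refl])
    fix b assume b: "b \<in> B"
    have "?r (T b) = (\<lambda>c. \<Sum>i\<in>I. ?r (cscale (l i b) (z i)) c)"
      unfolding T[OF BW[OF b]]
      by (rule cfun.representation_sum[OF B(2)]) (use z B(3) W in \<open>auto intro: cfun.subspace_scale\<close>)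
    thus "?r (T b) b = (\<Sum>i\<in>I. l i b * ?r (z i) b)"
      using z B by (simp add: cfun.representation_scale)
  qed
  also have "\<dots> = (\<Sum>i\<in>I. \<Sum>b\<in>B. l i b * ?r (z i) b)" by (rule sum.swap)
  also have "\<dots> = (\<Sum>i\<in>I. l i (z i))"
  proof (rule sum.cong[OF refl])
    fix i assume i: "i \<in> I"
    have "l i (z i) = l i (\<Sum>b\<in>B. cscale (?r (z i) b) b)"
      using cfun.sum_representation_eq[OF B(2) _ B(1) order_refl, of "z i"] z[OF i] B(3) by simp
    also have "\<dots> = (\<Sum>b\<in>B. l i (cscale (?r (z i) b) b))"
      by (rule linear_functional_on_sum[OF l[OF i] W]) (use BW W in \<open>auto intro: cfun.subspace_scale\<close>)
    also have "\<dots> = (\<Sum>b\<in>B. l i b * ?r (z i) b)"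
      by (rule sum.cong) (use linear_functional_on_scale[OF l[OF i]] BW in auto)
    finally show "(\<Sum>b\<in>B. l i b * ?r (z i) b) = l i (z i)" by simp
  qed
  finally show ?thesis .
qed

lemma trace_on_linear:
  assumes S: "finite S" "cfun.span S = W" and T: "\<And>i v. i \<in> I \<Longrightarrow> v \<in> W \<Longrightarrow> T i v \<in> W"
  shows "trace_on W (\<lambda>v. \<Sum>i\<in>I. cscale (c i) (T i v)) = (\<Sum>i\<in>I. c i * trace_on W (T i))"
proof -
  obtain B where B: "finite B" "cfun.independent B" "cfun.span B = W"
    and tr: "\<And>T. trace_on W T = (\<Sum>b\<in>B. cfun.representation B (T b) b)"
    using trace_on_basis[OF S] by blast
  let ?r = "cfun.representation B"
  have W: "cfun.subspace W" using S(2) cfun.subspace_span by blast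
  have BW: "b \<in> W" if "b \<in> B" for b using B(3) that cfun.span_superset by blast
  have "?r (\<Sum>i\<in>I. cscale (c i) (T i b)) b = (\<Sum>i\<in>I. c i * ?r (T i b) b)" if "b \<in> B" for b
  proof -
    have "?r (\<Sum>i\<in>I. cscale (c i) (T i b)) = (\<lambda>d. \<Sum>i\<in>I. ?r (cscale (c i) (T i b)) d)"
      by (rule cfun.representation_sum[OF B(2)])
        (use T BW[OF that] B(3) W in \<open>auto intro: cfun.subspace_scale\<close>)
    thus ?thesis using T BW[OF that] B by (simp add: cfun.representation_scale)
  qed
  hence "trace_on W (\<lambda>v. \<Sum>i\<in>I. cscale (c i) (T i v)) = (\<Sum>b\<in>B. \<Sum>i\<in>I. c i * ?r (T i b) b)"
    by (simp add: tr)
  also have "\<dots> = (\<Sum>i\<in>I. c i * trace_on W (T i))"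
    by (subst sum.swap) (simp add: tr sum_distrib_left)
  finally show ?thesis .
qed

section \<open>Linear characters of subgroups, their eigenspaces and idempotents\<close>

definition linear_char :: "('g, 'm) monoid_scheme \<Rightarrow> 'g set \<Rightarrow> ('g \<Rightarrow> complex) \<Rightarrow> bool" where
  "linear_char G H \<psi> \<longleftrightarrow>
     (\<forall>h\<in>H. \<psi> h \<noteq> 0) \<and> (\<forall>h\<in>H. \<forall>k\<in>H. \<psi> (h \<otimes>\<^bsub>G\<^esub> k) = \<psi> h * \<psi> k)"

lemma (in group) linear_char_one:
  assumes "subgroup H G" "linear_char G H \<psi>" shows "\<psi> \<one> = 1"
proof -
  have "\<one> \<in> H" using assms(1) subgroup.one_closed by blast
  hence eq: "\<psi> (\<one> \<otimes> \<one>) = \<psi> \<one> * \<psi> \<one>" and nz: "\<psi> \<one> \<noteq> 0"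
    using assms(2) unfolding linear_char_def by blast+
  have "\<psi> \<one> * \<psi> \<one> = \<psi> \<one> * 1"
    using eq unfolding r_one[OF one_closed] mult_1_right by (rule sym)
  thus ?thesis by (rule mult_left_cancel[OF nz, THEN iffD1])
qed

lemma (in group) linear_char_inv:
  assumes "subgroup H G" "linear_char G H \<psi>" "h \<in> H" shows "\<psi> (inv h) = inverse (\<psi> h)"
proof -
  have "inv h \<in> H" "h \<in> carrier G"
    using subgroup.m_inv_closed[OF assms(1,3)] subgroup.mem_carrier[OF assms(1,3)] .
  hence "\<psi> h * \<psi> (inv h) = 1"
    using linear_char_one[OF assms(1,2)] assms(2,3) r_inv[of h] unfolding linear_char_def by metis
  thus ?thesis by (rule inverse_unique[symmetric])
qed

lemma (in group) bij_betw_mult_right: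
  assumes "subgroup H G" "k \<in> H" shows "bij_betw (\<lambda>h. h \<otimes> k) H H"
proof (rule bij_betw_byWitness[where f' = "\<lambda>h. h \<otimes> inv k"])
  have "inv k \<in> H" and sub: "H \<subseteq> carrier G"
    using subgroup.m_inv_closed[OF assms] subgroup.subset[OF assms(1)] .
  thus "(\<lambda>h. h \<otimes> k) ` H \<subseteq> H" "(\<lambda>h. h \<otimes> inv k) ` H \<subseteq> H"
    using assms subgroup.m_closed[OF assms(1)] by blast+
  show "\<forall>a\<in>H. a \<otimes> k \<otimes> inv k = a" "\<forall>a\<in>H. a \<otimes> inv k \<otimes> k = a"
    using assms sub by (auto simp: m_assoc subsetD[OF sub])
qed

lemma (in group) bij_betw_mult_left:
  assumes "subgroup H G" "k \<in> H" shows "bij_betw (\<lambda>h. k \<otimes> h) H H"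
proof (rule bij_betw_byWitness[where f' = "\<lambda>h. inv k \<otimes> h"])
  have "inv k \<in> H" and sub: "H \<subseteq> carrier G"
    using subgroup.m_inv_closed[OF assms] subgroup.subset[OF assms(1)] .
  thus "(\<lambda>h. k \<otimes> h) ` H \<subseteq> H" "(\<lambda>h. inv k \<otimes> h) ` H \<subseteq> H"
    using assms subgroup.m_closed[OF assms(1)] by blast+
  show "\<forall>a\<in>H. inv k \<otimes> (k \<otimes> a) = a" "\<forall>a\<in>H. k \<otimes> (inv k \<otimes> a) = a"
    using assms sub by (auto simp: m_assoc[symmetric] subsetD[OF sub])
qed

locale finite_module = group G for G (structure) +
  fixes W :: "('x \<Rightarrow> complex) set" and act :: "('x \<Rightarrow> complex) \<Rightarrow> 'a \<Rightarrow> ('x \<Rightarrow> complex)"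
  assumes fin: "finite (carrier G)" and right_module: "right_module G W act"
begin

lemma spanning: obtains S where "finite S" "cfun.span S = W"
  using right_module unfolding right_module_def by blast

lemma subspace: "cfun.subspace W"
  by (rule spanning) (use cfun.subspace_span in blast)

lemmas W_zero [simp] = cfun.subspace_0[OF subspace]
  and W_add = cfun.subspace_add[OF subspace]
  and W_scale = cfun.subspace_scale[OF subspace]
  and W_sum = cfun.subspace_sum[OF subspace]

lemma act_closed [simp]: "g \<in> carrier G \<Longrightarrow> v \<in> W \<Longrightarrow> act v g \<in> W"
  and act_add: "g \<in> carrier G \<Longrightarrow> v \<in> W \<Longrightarrow> w \<in> W \<Longrightarrow> act (v + w) g = act v g + act w g"
  and act_scale: "g \<in> carrier G \<Longrightarrow> v \<in> W \<Longrightarrow> act (cscale c v) g = cscale c (act v g)"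
  and act_one [simp]: "v \<in> W \<Longrightarrow> act v \<one> = v"
  and act_mult: "g \<in> carrier G \<Longrightarrow> h \<in> carrier G \<Longrightarrow> v \<in> W \<Longrightarrow> act v (g \<otimes> h) = act (act v g) h"
  using right_module by (simp_all add: right_module_def)

lemma act_linear: "g \<in> carrier G \<Longrightarrow> linear_endo_on W (\<lambda>v. act v g)"
  by (simp add: linear_endo_on_def act_add act_scale)

lemma act_sum:
  assumes "g \<in> carrier G" "\<And>i. i \<in> I \<Longrightarrow> f i \<in> W"
  shows "act (sum f I) g = (\<Sum>i\<in>I. act (f i) g)"
  using linear_endo_on_sum[OF act_linear[OF assms(1)] subspace, of I f] assms(2) by blast

lemma act_zero [simp]: "g \<in> carrier G \<Longrightarrow> act 0 g = 0"
  using act_scale[of g 0 0] by simp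

definition eigenspace :: "'a set \<Rightarrow> ('a \<Rightarrow> complex) \<Rightarrow> ('x \<Rightarrow> complex) set" where
  "eigenspace H \<psi> = {w \<in> W. \<forall>h\<in>H. act w h = cscale (\<psi> h) w}"

text \<open>This is the action of the idempotent e attached to \<open>\<psi>\<close>. Writing
  \<open>inverse\<close> rather than a complex conjugate makes it idempotent directly from
  multiplicativity of \<open>\<psi>\<close>; absolute values enter only when
  \<open>char_inner\<close> does.\<close>

definition proj :: "'a set \<Rightarrow> ('a \<Rightarrow> complex) \<Rightarrow> ('x \<Rightarrow> complex) \<Rightarrow> ('x \<Rightarrow> complex)" where
  "proj H \<psi> v = (\<Sum>h\<in>H. cscale (inverse (\<psi> h) / of_nat (card H)) (act v h))"

lemma eigenspace_subspace: "H \<subseteq> carrier G \<Longrightarrow> cfun.subspace (eigenspace H \<psi>)"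
  unfolding cfun.subspace_def eigenspace_def
  by (auto simp: act_add act_scale subsetD cfun.scale_right_distrib mult.commute
      intro: W_add W_scale)

context
  fixes H \<psi> assumes H: "subgroup H G" and psi: "linear_char G H \<psi>"
begin

lemma H_carrier: "h \<in> H \<Longrightarrow> h \<in> carrier G"
  by (rule subgroup.mem_carrier[OF H])

lemma H_finite: "finite H"
  by (rule finite_subset[OF subgroup.subset[OF H] fin])

lemma card_H: "card H \<noteq> 0"
  using H_finite subgroup.one_closed[OF H] by auto

lemma psi_mult: "h \<in> H \<Longrightarrow> k \<in> H \<Longrightarrow> \<psi> (h \<otimes> k) = \<psi> h * \<psi> k"
  and psi_nonzero: "h \<in> H \<Longrightarrow> \<psi> h \<noteq> 0"
  using psi by (auto simp: linear_char_def)

lemma proj_W [simp]: "v \<in> W \<Longrightarrow> proj H \<psi> v \<in> W"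
  unfolding proj_def by (intro W_sum W_scale act_closed H_carrier)

lemma proj_linear: "linear_endo_on W (proj H \<psi>)"
proof -
  have "proj H \<psi> (cscale c v) = cscale c (proj H \<psi> v)" if "v \<in> W" for c v
    using that H_carrier
    by (simp add: proj_def act_scale cfun.scale_sum_right mult.commute)
  moreover have "proj H \<psi> (v + w) = proj H \<psi> v + proj H \<psi> w" if "v \<in> W" "w \<in> W" for v w
    using that H_carrier
    by (simp add: proj_def act_add cfun.scale_right_distrib sum.distrib)
  ultimately show ?thesis by (simp add: linear_endo_on_def)
qed

lemma act_proj:
  assumes "v \<in> W" "k \<in> H" shows "act (proj H \<psi> v) k = cscale (\<psi> k) (proj H \<psi> v)"
proof -
  let ?c = "\<lambda>h. inverse (\<psi> h) / of_nat (card H)"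
  have "act (proj H \<psi> v) k = (\<Sum>h\<in>H. cscale (?c h) (act v (h \<otimes> k)))"
    unfolding proj_def using assms H_carrier W_scale
    by (subst act_sum) (auto simp: act_scale act_mult)
  also have "\<dots> = (\<Sum>h\<in>H. cscale (\<psi> k) (cscale (?c (h \<otimes> k)) (act v (h \<otimes> k))))"
    using assms by (intro sum.cong refl) (auto simp: psi_mult psi_nonzero field_simps)
  also have "\<dots> = (\<Sum>h\<in>H. cscale (\<psi> k) (cscale (?c h) (act v h)))"
    by (rule sum.reindex_bij_betw[OF bij_betw_mult_right[OF H assms(2)]])
  finally show ?thesis by (simp add: proj_def cfun.scale_sum_right)
qed

lemma proj_eigenspace: "v \<in> W \<Longrightarrow> proj H \<psi> v \<in> eigenspace H \<psi>"
  by (simp add: eigenspace_def act_proj)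

lemma proj_act:
  assumes "v \<in> W" "k \<in> H" shows "proj H \<psi> (act v k) = cscale (\<psi> k) (proj H \<psi> v)"
proof -
  let ?c = "\<lambda>h. inverse (\<psi> h) / of_nat (card H)"
  have "proj H \<psi> (act v k) = (\<Sum>h\<in>H. cscale (?c h) (act v (k \<otimes> h)))"
    unfolding proj_def using assms H_carrier by (intro sum.cong refl) (simp add: act_mult)
  also have "\<dots> = (\<Sum>h\<in>H. cscale (\<psi> k) (cscale (?c (k \<otimes> h)) (act v (k \<otimes> h))))"
    using assms by (intro sum.cong refl) (auto simp: psi_mult psi_nonzero field_simps)
  also have "\<dots> = (\<Sum>h\<in>H. cscale (\<psi> k) (cscale (?c h) (act v h)))"
    by (rule sum.reindex_bij_betw[OF bij_betw_mult_left[OF H assms(2)]])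
  finally show ?thesis by (simp add: proj_def cfun.scale_sum_right)
qed

lemma proj_id: "w \<in> eigenspace H \<psi> \<Longrightarrow> proj H \<psi> w = w"
proof -
  assume w: "w \<in> eigenspace H \<psi>"
  hence "proj H \<psi> w = (\<Sum>h\<in>H. cscale (1 / of_nat (card H)) w)"
    unfolding proj_def by (intro sum.cong refl) (simp add: eigenspace_def psi_nonzero)
  also have "\<dots> = cscale (\<Sum>h\<in>H. 1 / of_nat (card H)) w" by (simp only: cfun.scale_sum_left)
  finally show ?thesis using card_H by simp
qed

lemma eigenspace_basis:
  obtains B where "finite B" "cfun.independent B" "cfun.span B = eigenspace H \<psi>"
proof -
  obtain S where "finite S" "cfun.span S = W" by (rule spanning)
  moreover have "eigenspace H \<psi> \<subseteq> W" by (auto simp: eigenspace_def)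
  ultimately show ?thesis
    using finite_basis_exists[of S "eigenspace H \<psi>"] eigenspace_subspace H_carrier that by blast
qed

lemma proj_coordinates:
  assumes B: "finite B" "cfun.independent B" "cfun.span B = eigenspace H \<psi>"
  shows "linear_functional_on W (\<lambda>v. cfun.representation B (proj H \<psi> v) b)"
    and "v \<in> W \<Longrightarrow> proj H \<psi> v = (\<Sum>b\<in>B. cscale (cfun.representation B (proj H \<psi> v) b) b)"
    and "b \<in> B \<Longrightarrow> cfun.representation B (proj H \<psi> b) b = 1"
proof -
  show "linear_functional_on W (\<lambda>v. cfun.representation B (proj H \<psi> v) b)"
    using linear_functional_on_representation[OF B(2)] proj_linear proj_eigenspace B(3)
    unfolding linear_functional_on_def linear_endo_on_def by simp
  show "v \<in> W \<Longrightarrow> proj H \<psi> v = (\<Sum>b\<in>B. cscale (cfun.representation B (proj H \<psi> v) b) b)"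
    using cfun.sum_representation_eq[OF B(2) _ B(1) order_refl] B(3) proj_eigenspace by simp
  show "b \<in> B \<Longrightarrow> cfun.representation B (proj H \<psi> b) b = 1"
    using B cfun.span_superset[of B]
    by (subst proj_id) (auto simp: cfun.representation_basis)
qed

text \<open>In coordinates of the eigenspace the projection is a sum of rank one operators, and each
  basis vector has coordinate 1 along itself because \<open>proj\<close> fixes it.\<close>

lemma trace_proj:
  assumes B: "finite B" "cfun.independent B" "cfun.span B = eigenspace H \<psi>"
  shows "trace_on W (proj H \<psi>) = of_nat (card B)"
proof -
  obtain S where S: "finite S" "cfun.span S = W" by (rule spanning)
  have "trace_on W (proj H \<psi>) = (\<Sum>b\<in>B. cfun.representation B (proj H \<psi> b) b)"
    using proj_coordinates[OF B] B(3) cfun.span_superset[of B]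
    by (intro trace_on_finite_rank[OF S B(1)]) (auto simp: eigenspace_def)
  thus ?thesis using proj_coordinates(3)[OF B] by simp
qed

lemma trace_proj_character:
  "trace_on W (proj H \<psi>) =
     (\<Sum>h\<in>H. inverse (\<psi> h) * module_character G W act h) / of_nat (card H)"
proof -
  obtain S where S: "finite S" "cfun.span S = W" by (rule spanning)
  have "trace_on W (proj H \<psi>) =
      (\<Sum>h\<in>H. inverse (\<psi> h) / of_nat (card H) * trace_on W (\<lambda>v. act v h))"
    unfolding proj_def[abs_def] using H_carrier by (intro trace_on_linear[OF S]) simp
  thus ?thesis
    using H_carrier by (simp add: module_character_def sum_divide_distrib)
qed

lemma trace_proj_nonzero_iff:
  "trace_on W (proj H \<psi>) \<noteq> 0 \<longleftrightarrow> eigenspace H \<psi> \<noteq> {0}"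
proof -
  obtain B where B: "finite B" "cfun.independent B" "cfun.span B = eigenspace H \<psi>"
    by (rule eigenspace_basis)
  have "B = {} \<longleftrightarrow> cfun.span B = {0}"
  proof
    assume "cfun.span B = {0}"
    hence "B \<subseteq> {0}" using cfun.span_superset[of B] by simp
    moreover have "0 \<notin> B" using B(2) cfun.dependent_zero by blast
    ultimately show "B = {}" by blast
  qed simp
  thus ?thesis using B by (simp add: trace_proj[OF B])
qed

end

text \<open>The element \<open>inv g \<otimes> h \<otimes> g\<close> acts on \<open>act w g\<close>
  by the scalar \<open>\<nu> h\<close>, whereas \<open>proj H' \<mu>\<close> turns its action into
  the scalar \<open>\<mu> (inv g \<otimes> h \<otimes> g)\<close>. Two different scalars on one
  vector force it to be zero. The case H' = H gives the decomposition along K, the general case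
  compares two verges.\<close>

lemma proj_translate_eq_0:
  assumes H: "subgroup H G" "w \<in> eigenspace H \<nu>" and H': "subgroup H' G" "linear_char G H' \<mu>"
    and g: "g \<in> carrier G"
    and h: "h \<in> H" "inv g \<otimes> h \<otimes> g \<in> H'" "\<nu> h \<noteq> \<mu> (inv g \<otimes> h \<otimes> g)"
  shows "proj H' \<mu> (act w g) = 0"
proof -
  have w: "w \<in> W" "act w h = cscale (\<nu> h) w" using H h by (auto simp: eigenspace_def)
  have hc: "h \<in> carrier G" "inv g \<otimes> h \<otimes> g \<in> carrier G" 
    using subgroup.mem_carrier[OF H(1) h(1)] subgroup.mem_carrier[OF H'(1) h(2)] .
  let ?p = "proj H' \<mu> (act w g)"
  have "g \<otimes> (inv g \<otimes> h \<otimes> g) = h \<otimes> g" using hc(1) g by (simp add: m_assoc[symmetric])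
  hence "act (act w g) (inv g \<otimes> h \<otimes> g) = cscale (\<nu> h) (act w g)"
    using w g hc act_mult[OF g hc(2) w(1)] act_mult[OF hc(1) g w(1)] by (simp add: act_scale)
  hence "cscale (\<mu> (inv g \<otimes> h \<otimes> g)) ?p = cscale (\<nu> h) ?p"
    using proj_act[OF H', of "act w g" "inv g \<otimes> h \<otimes> g"] proj_linear[OF H'] w g h(2)
    by (auto simp: linear_endo_on_def)
  thus ?thesis using h(3) cfun.scale_cancel_right by auto
qed

text \<open>Expanding \<open>act v (inv g \<otimes> x)\<close> in a basis before applying
  \<open>g\<close> presents the operator as a sum of rank one operators with vectors
  \<open>act b g\<close>. Evaluating the functionals on these vectors cancels \<open>g\<close>
  against \<open>inv g\<close>, leaving the trace of \<open>x\<close>.\<close>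

lemma character_conj:
  assumes "x \<in> carrier G" "g \<in> carrier G"
  shows "module_character G W act (inv g \<otimes> x \<otimes> g) = module_character G W act x"
proof -
  obtain S where "finite S" "cfun.span S = W" by (rule spanning)
  then obtain B where B: "finite B" "cfun.independent B" "cfun.span B = W"
    and tr: "\<And>T. trace_on W T = (\<Sum>b\<in>B. cfun.representation B (T b) b)"
    using trace_on_basis by blast
  let ?r = "cfun.representation B"
  have BW: "b \<in> W" if "b \<in> B" for b using B(3) that cfun.span_superset by blast
  have lin: "linear_functional_on W (\<lambda>v. ?r (act v (inv g \<otimes> x)) b)" for b
    using linear_functional_on_compose[OF _ act_linear] linear_functional_on_representation[OF B(2)]
      B(3) assms m_closed inv_closed by blast
  have "act v (inv g \<otimes> x \<otimes> g) = (\<Sum>b\<in>B. cscale (?r (act v (inv g \<otimes> x)) b) (act b g))"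
    if v: "v \<in> W" for v
  proof -
    have "act v (inv g \<otimes> x \<otimes> g) = act (act v (inv g \<otimes> x)) g" using v assms by (simp add: act_mult)
    also have "act v (inv g \<otimes> x) = (\<Sum>b\<in>B. cscale (?r (act v (inv g \<otimes> x)) b) b)"
      using cfun.sum_representation_eq[OF B(2) _ B(1) order_refl] B(3) assms v by simp
    also have "act \<dots> g = (\<Sum>b\<in>B. act (cscale (?r (act v (inv g \<otimes> x)) b) b) g)"
      by (rule act_sum[OF assms(2)]) (use BW W_scale in blast)
    finally show ?thesis using BW assms(2) by (simp add: act_scale)
  qed
  hence "trace_on W (\<lambda>v. act v (inv g \<otimes> x \<otimes> g)) = (\<Sum>b\<in>B. ?r (act (act b g) (inv g \<otimes> x)) b)"
    using lin BW assms
    by (intro trace_on_finite_rank[OF B(1,3,1), where z = "\<lambda>b. act b g"]) auto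
  also have "\<dots> = (\<Sum>b\<in>B. ?r (act b x) b)"
    using BW assms
    by (intro sum.cong refl) (simp add: act_mult[symmetric], simp add: m_assoc[symmetric])
  finally show ?thesis using assms by (simp add: module_character_def tr)
qed

lemma submodule_generated:
  assumes "w \<in> W"
  shows "right_module G (cfun.span (act w ` carrier G)) act" (is "right_module G ?V act")
    and "cfun.span (act w ` carrier G) \<subseteq> W" and "w \<in> cfun.span (act w ` carrier G)"
proof -
  show sub: "?V \<subseteq> W" using assms by (intro cfun.span_minimal subspace) auto
  have "v \<in> W \<and> act v g \<in> ?V" if "v \<in> ?V" "g \<in> carrier G" for v g
  proof (rule cfun.span_induct[OF that(1)])
    show "cfun.subspace {v. v \<in> W \<and> act v g \<in> ?V}"
      unfolding cfun.subspace_def using \<open>g \<in> carrier G\<close>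
      by (auto simp: act_add act_scale cfun.span_add cfun.span_scale cfun.span_zero
          intro: W_add W_scale)
  next
    fix x assume "x \<in> act w ` carrier G"
    then obtain h where h: "h \<in> carrier G" "x = act w h" by blast
    have "act x g = act w (h \<otimes> g)" using h assms that(2) by (simp add: act_mult)
    moreover have "act w (h \<otimes> g) \<in> ?V" using h that(2) by (intro cfun.span_base) simp
    ultimately show "x \<in> W \<and> act x g \<in> ?V" using h assms by simp
  qed
  moreover have "\<exists>B. finite B \<and> cfun.span B = ?V" using fin by blast
  ultimately show "right_module G ?V act"
    using sub unfolding right_module_def by (simp add: subset_iff act_add act_scale act_mult)
  show "w \<in> ?V" using assms by (intro cfun.span_base) (auto intro!: image_eqI[of _ _ \<one>])
qed

lemma irreducible_generated:
  assumes "irreducible_module G W act" "w \<in> W" "w \<noteq> 0"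
  shows "W = cfun.span (act w ` carrier G)"
  using submodule_generated[OF assms(2)] assms unfolding irreducible_module_def by blast

end


section \<open>Clifford theory for a linear character\<close>

text \<open>Condition \<open>separated\<close> asks more than that \<open>g\<close> fails to
  normalize the pair: the two characters must differ at a point where both are defined, that is on
  the intersection of \<open>H\<close> with a conjugate. This is the form in which
  \<open>proj_translate_eq_0\<close> gives e g e = 0.\<close>

locale clifford_pair = group G for G (structure) +
  fixes H K :: "'a set" and \<nu> :: "'a \<Rightarrow> complex"
  assumes finG: "finite (carrier G)" and subH: "subgroup H G" and subK: "subgroup K G"
    and HK: "H \<subseteq> K" and nu: "linear_char G H \<nu>"
    and invariant: "\<And>k h. k \<in> K \<Longrightarrow> h \<in> H \<Longrightarrow>
      k \<otimes> h \<otimes> inv k \<in> H \<and> \<nu> (k \<otimes> h \<otimes> inv k) = \<nu> h"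
    and separated: "\<And>g. g \<in> carrier G \<Longrightarrow> g \<notin> K \<Longrightarrow>
      \<exists>h\<in>H. inv g \<otimes> h \<otimes> g \<in> H \<and> \<nu> h \<noteq> \<nu> (inv g \<otimes> h \<otimes> g)"
begin

text \<open>Frobenius' formula for the character induced from \<open>K\<close>. The sum runs over
  all of \<open>G\<close> instead of coset representatives, whence the division by
  \<open>card K\<close>.\<close>

definition induced :: "('a \<Rightarrow> complex) \<Rightarrow> 'a \<Rightarrow> complex" where
  "induced \<psi> = (\<lambda>x\<in>carrier G. (\<Sum>g\<in>carrier G.
     if g \<otimes> x \<otimes> inv g \<in> K then \<psi> (g \<otimes> x \<otimes> inv g) else 0) / of_nat (card K))"

end

text \<open>Generation by the eigenspace is assumed instead of irreducibility, because the module
  built from an extension has to be analysed before it is known to be irreducible.\<close>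

locale clifford_module = clifford_pair G H K \<nu> + finite_module G W act
  for G (structure) and H K :: "'a set" and \<nu> :: "'a \<Rightarrow> complex"
    and W :: "('x \<Rightarrow> complex) set" and act +
  assumes generated: "W = cfun.span (\<Union>w\<in>eigenspace H \<nu>. act w ` carrier G)"
begin

lemma K_carrier: "k \<in> K \<Longrightarrow> k \<in> carrier G"
  by (rule subgroup.mem_carrier[OF subK])

lemma card_K: "card K \<noteq> 0"
  using finite_subset[OF subgroup.subset[OF subK] finG] subgroup.one_closed[OF subK] by auto

lemma eigenspace_stable:
  assumes w: "w \<in> eigenspace H \<nu>" and k: "k \<in> K" shows "act w k \<in> eigenspace H \<nu>"
proof -
  have kc: "k \<in> carrier G" using k by (rule K_carrier)
  have wW: "w \<in> W" using w by (simp add: eigenspace_def)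
  have "act (act w k) h = cscale (\<nu> h) (act w k)" if h: "h \<in> H" for h
  proof -
    have hc: "h \<in> carrier G" using subgroup.mem_carrier[OF subH h] .
    have "act (act w k) h = act w ((k \<otimes> h \<otimes> inv k) \<otimes> k)"
      using kc hc wW by (simp add: act_mult[symmetric] m_assoc)
    also have "\<dots> = act (act w (k \<otimes> h \<otimes> inv k)) k"
      using kc hc wW by (intro act_mult) auto
    also have "act w (k \<otimes> h \<otimes> inv k) = cscale (\<nu> h) w"
      using w invariant[OF k h] by (simp add: eigenspace_def)
    finally show ?thesis using kc wW by (simp add: act_scale)
  qed
  thus ?thesis using wW kc by (simp add: eigenspace_def)
qed

lemma proj_translate:
  assumes w: "w \<in> eigenspace H \<nu>" and g: "g \<in> carrier G"
  shows "proj H \<nu> (act w g) = (if g \<in> K then act w g else 0)"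
proof (cases "g \<in> K")
  case True
  thus ?thesis using proj_id[OF subH nu eigenspace_stable[OF w]] by simp
next
  case False
  thus ?thesis using separated[OF g False] proj_translate_eq_0[OF subH w subH nu g] by auto
qed

text \<open>This is the decomposition of \<open>W\<close> into the translates of the eigenspace
  along the cosets of \<open>K\<close>, as an identity of operators. On a generator
  \<open>act w g'\<close> the summand of \<open>g\<close> is zero unless
  \<open>g' \<otimes> inv g\<close> lies in \<open>K\<close>, and then it returns the generator;
  this happens for \<open>card K\<close> elements \<open>g\<close>.\<close>

lemma resolution:
  assumes "v \<in> W"
  shows "(\<Sum>g\<in>carrier G. act (proj H \<nu> (act v (inv g))) g) = cscale (of_nat (card K)) v"
proof -
  let ?F = "\<lambda>v. \<Sum>g\<in>carrier G. act (proj H \<nu> (act v (inv g))) g"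
  have pl: "proj H \<nu> (v + w) = proj H \<nu> v + proj H \<nu> w"
    "proj H \<nu> (cscale c v) = cscale c (proj H \<nu> v)" "proj H \<nu> v \<in> W"
    if "v \<in> W" "w \<in> W" for v w c
    using proj_linear[OF subH nu] that by (auto simp: linear_endo_on_def)
  have p0: "proj H \<nu> 0 = 0" using pl(2)[of 0 0 0] by simp
  have "v \<in> W \<and> ?F v = cscale (of_nat (card K)) v"
  proof (rule cfun.span_induct[where x = v and P = "\<lambda>v. v \<in> W \<and> ?F v = cscale (of_nat (card K)) v"])
    show "v \<in> cfun.span (\<Union>w\<in>eigenspace H \<nu>. act w ` carrier G)" using assms generated by simp
    have "?F (v + w) = ?F v + ?F w" if "v \<in> W" "w \<in> W" for v w
      using that by (simp add: act_add pl sum.distrib)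
    moreover have "?F (cscale c v) = cscale c (?F v)" if "v \<in> W" for v c
      using that by (simp add: act_scale pl cfun.scale_sum_right)
    ultimately show "cfun.subspace {v. v \<in> W \<and> ?F v = cscale (of_nat (card K)) v}"
      unfolding cfun.subspace_def
      by (auto simp: p0 cfun.scale_right_distrib mult.commute intro: W_add W_scale)
  next
    fix x assume "x \<in> (\<Union>w\<in>eigenspace H \<nu>. act w ` carrier G)"
    then obtain w g' where w: "w \<in> eigenspace H \<nu>" and g': "g' \<in> carrier G" "x = act w g'"
      by blast
    have wW: "w \<in> W" using w by (simp add: eigenspace_def)
    have "act (proj H \<nu> (act x (inv g))) g = (if g' \<otimes> inv g \<in> K then x else 0)"
      if g: "g \<in> carrier G" for g
    proof -
      have "act x (inv g) = act w (g' \<otimes> inv g)" using g g' wW by (simp add: act_mult)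
      hence "proj H \<nu> (act x (inv g)) = (if g' \<otimes> inv g \<in> K then act w (g' \<otimes> inv g) else 0)"
        using proj_translate[OF w, of "g' \<otimes> inv g"] g g' by simp
      moreover have "act (act w (g' \<otimes> inv g)) g = x"
        using g g' wW act_mult[of "g' \<otimes> inv g" g w] by (simp add: m_assoc)
      ultimately show ?thesis using g by simp
    qed
    hence "?F x = (\<Sum>g\<in>carrier G. if g' \<otimes> inv g \<in> K then x else 0)" by (intro sum.cong) auto
    also have "\<dots> = (\<Sum>g\<in>{g \<in> carrier G. g' \<otimes> inv g \<in> K}. x)"
      by (rule sum.inter_filter[symmetric, OF finG])
    also have "\<dots> = (\<Sum>k\<in>K. x)"
    proof (rule sum.reindex_bij_witness[where i = "\<lambda>k. inv k \<otimes> g'" and j = "\<lambda>g. g' \<otimes> inv g"])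
      fix g assume g: "g \<in> {g \<in> carrier G. g' \<otimes> inv g \<in> K}"
      thus "inv (g' \<otimes> inv g) \<otimes> g' = g" using g' by (simp add: inv_mult_group m_assoc)
    next
      fix k assume k: "k \<in> K"
      thus "g' \<otimes> inv (inv k \<otimes> g') = k" "inv k \<otimes> g' \<in> {g \<in> carrier G. g' \<otimes> inv g \<in> K}"
        using g' K_carrier[OF k] by (simp_all add: inv_mult_group m_assoc[symmetric])
    qed auto
    also have "\<dots> = (\<Sum>k\<in>K. cscale 1 x)" by simp
    also have "\<dots> = cscale (of_nat (card K)) x" by (simp only: cfun.scale_sum_left[symmetric]) simp
    finally show "x \<in> W \<and> ?F x = cscale (of_nat (card K)) x" using g' wW by simp
  qed
  thus ?thesis by blast
qed

text \<open>Applying \<open>x\<close> to \<open>resolution\<close> writes \<open>card K\<close>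
  times the action of \<open>x\<close> as a sum of rank one operators: the functional takes the
  coordinate at \<open>b\<close> of \<open>proj H \<nu> (act v (inv g))\<close>, the vector is
  \<open>act b (g \<otimes> x)\<close>. Evaluating one on the other produces the conjugate
  \<open>g \<otimes> x \<otimes> inv g\<close>.\<close>

lemma trace_formula:
  assumes B: "finite B" "cfun.independent B" "cfun.span B = eigenspace H \<nu>" and x: "x \<in> carrier G"
  shows "of_nat (card K) * module_character G W act x =
    (\<Sum>g\<in>carrier G. \<Sum>b\<in>B.
       cfun.representation B (proj H \<nu> (act b (g \<otimes> x \<otimes> inv g))) b)"
proof -
  obtain S where S: "finite S" "cfun.span S = W" by (rule spanning)
  let ?r = "\<lambda>v b. cfun.representation B (proj H \<nu> v) b"
  let ?l = "\<lambda>(g, b) v. ?r (act v (inv g)) b / of_nat (card K)"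
  let ?z = "\<lambda>(g, b). act b (g \<otimes> x)"
  have BW: "b \<in> W" if "b \<in> B" for b
    using that B(3) cfun.span_superset[of B] by (auto simp: eigenspace_def)
  have "trace_on W (\<lambda>v. act v x) = (\<Sum>i\<in>carrier G \<times> B. ?l i (?z i))"
  proof (rule trace_on_finite_rank[OF S, where l = ?l and z = ?z])
    show "linear_functional_on W (?l i)" if i: "i \<in> carrier G \<times> B" for i
    proof -
      obtain g b where gb: "i = (g, b)" "g \<in> carrier G" using i by blast
      have "linear_functional_on W (\<lambda>v. ?r (act v (inv g)) b)"
        using linear_functional_on_compose[OF proj_coordinates(1)[OF subH nu B] act_linear] gb(2)
          inv_closed by blast
      thus ?thesis using gb(1) by (simp add: linear_functional_on_def add_divide_distrib)
    qed
    show "?z i \<in> W" if "i \<in> carrier G \<times> B" for i using that BW x by auto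
    fix v assume v: "v \<in> W"
    have "act (proj H \<nu> (act v (inv g))) g = (\<Sum>b\<in>B. cscale (?r (act v (inv g)) b) (act b g))"
      if g: "g \<in> carrier G" for g
    proof -
      have "act (proj H \<nu> (act v (inv g))) g =
          act (\<Sum>b\<in>B. cscale (?r (act v (inv g)) b) b) g"
        using proj_coordinates(2)[OF subH nu B, of "act v (inv g)"] v g by simp
      also have "\<dots> = (\<Sum>b\<in>B. act (cscale (?r (act v (inv g)) b) b) g)"
        by (rule act_sum[OF g]) (use BW W_scale in blast)
      finally show ?thesis using BW g by (simp add: act_scale)
    qed
    hence eq: "cscale (of_nat (card K)) v =
        (\<Sum>g\<in>carrier G. \<Sum>b\<in>B. cscale (?r (act v (inv g)) b) (act b g))"
      unfolding resolution[OF v, symmetric] by (rule sum.cong[OF refl])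
    have "v = cscale (1 / of_nat (card K)) (cscale (of_nat (card K)) v)" using card_K by simp
    also have "\<dots> = (\<Sum>g\<in>carrier G. \<Sum>b\<in>B. cscale (?l (g, b) v) (act b g))"
      unfolding eq by (simp add: cfun.scale_sum_right)
    also have "\<dots> = (\<Sum>i\<in>carrier G \<times> B. cscale (?l i v) (act (snd i) (fst i)))"
      by (subst sum.cartesian_product) (simp add: case_prod_beta)
    finally have "act v x = act (\<Sum>i\<in>carrier G \<times> B. cscale (?l i v) (act (snd i) (fst i))) x"
      by simp
    also have "\<dots> = (\<Sum>i\<in>carrier G \<times> B. act (cscale (?l i v) (act (snd i) (fst i))) x)"
      by (rule act_sum[OF x]) (use BW W_scale in auto)
    also have "\<dots> = (\<Sum>i\<in>carrier G \<times> B. cscale (?l i v) (?z i))"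
      by (rule sum.cong[OF refl]) (use BW x in \<open>auto simp: act_scale act_mult\<close>)
    finally show "act v x = (\<Sum>i\<in>carrier G \<times> B. cscale (?l i v) (?z i))" .
  qed (use finG B(1) in simp)
  also have "\<dots> = (\<Sum>i\<in>carrier G \<times> B.
      ?r (act (snd i) (fst i \<otimes> x \<otimes> inv (fst i))) (snd i) / of_nat (card K))"
    by (rule sum.cong[OF refl]) (use BW x in \<open>auto simp: act_mult[symmetric]\<close>)
  also have "\<dots> = (\<Sum>g\<in>carrier G. \<Sum>b\<in>B. ?r (act b (g \<otimes> x \<otimes> inv g)) b / of_nat (card K))"
    by (subst sum.cartesian_product) (simp add: case_prod_beta)
  finally show ?thesis
    using x card_K by (simp add: module_character_def sum_divide_distrib[symmetric])
qed

lemma degree_formula: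
  assumes B: "finite B" "cfun.independent B" "cfun.span B = eigenspace H \<nu>"
  shows "of_nat (card K) * module_character G W act \<one> = of_nat (card (carrier G) * card B)"
proof -
  have "act b (g \<otimes> \<one> \<otimes> inv g) = b" if "b \<in> B" "g \<in> carrier G" for b g
    using that B(3) cfun.span_superset[of B] by (auto simp: eigenspace_def)
  thus ?thesis using trace_formula[OF B one_closed] proj_coordinates(3)[OF subH nu B] by simp
qed

context
  fixes w \<psi>
  assumes w: "w \<in> W" "w \<noteq> 0" "\<And>k. k \<in> K \<Longrightarrow> act w k = cscale (\<psi> k) w"
    and psi_nu: "\<And>h. h \<in> H \<Longrightarrow> \<psi> h = \<nu> h"
    and gen: "W = cfun.span (act w ` carrier G)"
begin

lemma generator_eigenspace: "w \<in> eigenspace H \<nu>"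
  using w HK psi_nu by (auto simp: eigenspace_def)

lemma proj_generator:
  "g \<in> carrier G \<Longrightarrow> proj H \<nu> (act w g) = cscale (if g \<in> K then \<psi> g else 0) w"
  by (simp add: proj_translate[OF generator_eigenspace] w)

text \<open>\<open>proj\<close> fixes the eigenspace pointwise, but by \<open>proj_generator\<close>
  it sends every translate of \<open>w\<close> into the line of \<open>w\<close>, and these
  translates span \<open>W\<close>.\<close>

lemma eigenspace_eq_span: "eigenspace H \<nu> = cfun.span {w}"
proof
  show "cfun.span {w} \<subseteq> eigenspace H \<nu>"
    by (intro cfun.span_minimal eigenspace_subspace subgroup.subset[OF subH])
      (simp add: generator_eigenspace)
  show "eigenspace H \<nu> \<subseteq> cfun.span {w}"
  proof
    fix v assume v: "v \<in> eigenspace H \<nu>"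
    have "v \<in> W \<and> proj H \<nu> v \<in> cfun.span {w}"
    proof (rule cfun.span_induct[where x = v and P = "\<lambda>v. v \<in> W \<and> proj H \<nu> v \<in> cfun.span {w}"])
      have "v \<in> W" using v by (simp add: eigenspace_def)
      thus "v \<in> cfun.span (act w ` carrier G)" unfolding gen[symmetric] .
      have "proj H \<nu> 0 = 0"
        using proj_linear[OF subH nu] W_zero unfolding linear_endo_on_def
        by (metis cfun.scale_zero_left)
      thus "cfun.subspace {v. v \<in> W \<and> proj H \<nu> v \<in> cfun.span {w}}"
        unfolding cfun.subspace_def using proj_linear[OF subH nu]
        by (auto simp: linear_endo_on_def cfun.span_add cfun.span_scale cfun.span_zero
            intro: W_add W_scale)
      fix x assume "x \<in> act w ` carrier G"
      then obtain g where g: "g \<in> carrier G" "x = act w g" by blast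
      show "x \<in> W \<and> proj H \<nu> x \<in> cfun.span {w}"
        unfolding g(2) proj_generator[OF g(1)] using g(1) w(1)
        by (intro conjI cfun.span_scale) (auto intro: cfun.span_base)
    qed
    thus "v \<in> cfun.span {w}" using proj_id[OF subH nu v] by simp
  qed
qed

lemma character_eq_induced: "module_character G W act = induced \<psi>"
proof
  fix x
  have ind: "cfun.independent {w}" using w(2) by simp
  have rep: "cfun.representation {w} (cscale c w) w = c" for c
    using cfun.representation_scale[OF ind, of w c] cfun.representation_basis[OF ind, of w]
      cfun.span_base[of w "{w}"] by simp
  show "module_character G W act x = induced \<psi> x"
  proof (cases "x \<in> carrier G")
    case True
    have "of_nat (card K) * module_character G W act x =
      (\<Sum>g\<in>carrier G. if g \<otimes> x \<otimes> inv g \<in> K then \<psi> (g \<otimes> x \<otimes> inv g) else 0)"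
      using trace_formula[OF _ ind eigenspace_eq_span[symmetric] True] True
      by (simp add: proj_generator rep)
    thus ?thesis using True card_K by (simp add: induced_def field_simps)
  next
    case False
    thus ?thesis by (simp add: module_character_def induced_def)
  qed
qed

lemma degree_generator: "of_nat (card K) * module_character G W act \<one> = of_nat (card (carrier G))"
  using degree_formula[of "{w}"] eigenspace_eq_span w(2) by simp

end

end

section \<open>From modules to characters: extensions of \<nu> to K and the characters they
  induce\<close>

lemma linear_endo_on_vanishes_on_span:
  assumes "\<And>w. w \<in> S \<Longrightarrow> T w = 0" "linear_endo_on W T" "S \<subseteq> W" "cfun.subspace W"
    and v: "v \<in> cfun.span S"
  shows "T v = 0"
proof -
  have "v \<in> W \<and> T v = 0"
  proof (rule cfun.span_induct[OF v])
    have "T 0 = 0"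
      using assms(2) cfun.subspace_0[OF assms(4)] unfolding linear_endo_on_def
      by (metis cfun.scale_zero_left)
    thus "cfun.subspace {v. v \<in> W \<and> T v = 0}"
      using assms(2,4) unfolding cfun.subspace_def linear_endo_on_def by simp
  qed (use assms in auto)
  thus ?thesis by blast
qed

context group
begin

definition character_pairing :: "'a set \<Rightarrow> ('a \<Rightarrow> complex) \<Rightarrow> ('a \<Rightarrow> complex) \<Rightarrow> complex" where
  "character_pairing H \<nu> \<chi> = (\<Sum>h\<in>H. inverse (\<nu> h) * \<chi> h)"

lemma character_pairing_nonzero_iff:
  assumes "finite_module G W act" "subgroup H G" "linear_char G H \<nu>"
  shows "character_pairing H \<nu> (module_character G W act) \<noteq> 0 \<longleftrightarrow>
    finite_module.eigenspace W act H \<nu> \<noteq> {0}"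
proof -
  interpret finite_module G W act by fact
  show ?thesis
    using trace_proj_nonzero_iff[OF assms(2,3)] trace_proj_character[OF assms(2,3)]
      card_H[OF assms(2,3)]
    by (simp add: character_pairing_def)
qed

end

text \<open>The regular module has to live inside \<open>nat \<Rightarrow> complex\<close>, so \<open>e\<close> numbers the group elements.\<close>

definition regular_act ::
  "('g, 'm) monoid_scheme \<Rightarrow> ('g \<Rightarrow> nat) \<Rightarrow> (nat \<Rightarrow> complex) \<Rightarrow> 'g \<Rightarrow> nat \<Rightarrow> complex" where
  "regular_act G e f g = (\<lambda>m. if m \<in> e ` carrier G
     then f (e (the_inv_into (carrier G) e m \<otimes>\<^bsub>G\<^esub> inv\<^bsub>G\<^esub> g)) else 0)"

lemma (in group) regular_module:
  assumes fin: "finite (carrier G)" and e: "inj_on e (carrier G)"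
  shows "finite_module G {f. \<forall>m. m \<notin> e ` carrier G \<longrightarrow> f m = 0} (regular_act G e)"
    (is "finite_module G ?V ?act")
proof
  have act: "?act f g (e x) = f (e (x \<otimes> inv g))" if "x \<in> carrier G" for f g x
    using that by (simp add: regular_act_def the_inv_into_f_f[OF e])
  have ext: "f = f'" if "f \<in> ?V" "f' \<in> ?V" "\<And>x. x \<in> carrier G \<Longrightarrow> f (e x) = f' (e x)" for f f'
  proof
    fix m show "f m = f' m" using that by (cases "m \<in> e ` carrier G") auto
  qed
  have V: "?act f g \<in> ?V" for f g by (simp add: regular_act_def)
  let ?B = "(\<lambda>x. indicator {e x}) ` carrier G :: (nat \<Rightarrow> complex) set"
  have sub: "cfun.subspace ?V" by (simp add: cfun.subspace_def cscale_def)
  have "cfun.span ?B = ?V"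
  proof
    show "cfun.span ?B \<subseteq> ?V" by (intro cfun.span_minimal sub) (auto simp: indicator_def)
    show "?V \<subseteq> cfun.span ?B"
    proof
      fix f assume f: "f \<in> ?V"
      have "f = (\<Sum>x\<in>carrier G. cscale (f (e x)) (indicator {e x}))"
      proof (rule ext[OF f])
        show "(\<Sum>x\<in>carrier G. cscale (f (e x)) (indicator {e x})) \<in> ?V"
          by (intro cfun.subspace_sum sub) (auto simp: cscale_def indicator_def)
        fix y assume y: "y \<in> carrier G"
        have "(\<Sum>x\<in>carrier G. cscale (f (e x)) (indicator {e x})) (e y) =
            (\<Sum>x\<in>carrier G. cscale (f (e x)) (indicator {e x}) (e y))"
          using fin by (induction rule: finite_induct) auto
        also have "\<dots> = (\<Sum>x\<in>carrier G. if x = y then f (e x) else 0)"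
          by (intro sum.cong) (use y e in \<open>auto simp: cscale_def indicator_def inj_on_eq_iff\<close>)
        finally show "f (e y) = (\<Sum>x\<in>carrier G. cscale (f (e x)) (indicator {e x})) (e y)"
          using y fin by simp
      qed
      thus "f \<in> cfun.span ?B"
        by (metis (no_types, lifting) cfun.span_base cfun.span_scale cfun.span_sum imageI)
    qed
  qed
  hence "\<exists>B. finite B \<and> cfun.span B = ?V" using fin by blast
  moreover have "?act (v + w) g = ?act v g + ?act w g" "?act (cscale c v) g = cscale c (?act v g)"
    for v w c g
    by (auto simp: regular_act_def cscale_def fun_eq_iff)
  moreover have "?act v \<one> = v" if "v \<in> ?V" for v
    by (rule ext[OF V that]) (simp add: act)
  moreover have "?act v (g \<otimes> h) = ?act (?act v g) h" if "g \<in> carrier G" "h \<in> carrier G" for v g h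
    by (rule ext[OF V V]) (use that in \<open>simp add: act inv_mult_group m_assoc\<close>)
  ultimately show "right_module G ?V ?act"
    unfolding right_module_def using V by blast
qed (fact fin)

context clifford_pair
begin

text \<open>Membership in \<open>extensional K\<close> makes equality of HOL functions the same as
  equality on \<open>K\<close>, so that this set can be counted.\<close>

definition extensions :: "('a \<Rightarrow> complex) set" where
  "extensions = {\<psi> \<in> extensional K. linear_char G K \<psi> \<and> (\<forall>h\<in>H. \<psi> h = \<nu> h)}"

lemma clifford_moduleI:
  assumes "finite_module G W act"
    and "w \<in> finite_module.eigenspace W act H \<nu>" "W = cfun.span (act w ` carrier G)"
  shows "clifford_module G H K \<nu> W act"
proof -
  interpret finite_module G W act by fact
  have "W \<subseteq> cfun.span (\<Union>w\<in>eigenspace H \<nu>. act w ` carrier G)"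
    using assms(2) by (subst assms(3)) (intro cfun.span_mono, blast)
  moreover have "cfun.span (\<Union>w\<in>eigenspace H \<nu>. act w ` carrier G) \<subseteq> W"
    by (intro cfun.span_minimal subspace) (auto simp: eigenspace_def)
  ultimately show ?thesis by unfold_locales blast
qed

lemma irreducible_clifford_module:
  assumes "irreducible_module G W act" "w \<in> finite_module.eigenspace W act H \<nu>" "w \<noteq> 0"
  shows "clifford_module G H K \<nu> W act"
proof -
  interpret finite_module G W act
    using assms(1) finG by unfold_locales (auto simp: irreducible_module_def)
  have "w \<in> W" using assms(2) by (simp add: eigenspace_def)
  thus ?thesis
    using irreducible_generated[OF assms(1)] assms(2,3) finite_module_axioms
    by (intro clifford_moduleI) auto
qed

text \<open>The module is the submodule of the regular module generated by one vector on which
  \<open>K\<close> acts through \<open>\<psi>\<close>, a copy of the induced module.\<close>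

lemma extension_module:
  assumes psi: "\<psi> \<in> extensions"
  obtains W :: "(nat \<Rightarrow> complex) set" and act w where "irreducible_module G W act"
    "w \<in> W" "w \<noteq> 0" "\<And>k. k \<in> K \<Longrightarrow> act w k = cscale (\<psi> k) w"
proof -
  have lin: "linear_char G K \<psi>" and ext: "\<And>h. h \<in> H \<Longrightarrow> \<psi> h = \<nu> h"
    using psi by (auto simp: extensions_def)
  obtain e :: "'a \<Rightarrow> nat" where e: "inj_on e (carrier G)"
    using finite_imp_inj_to_nat_seg[OF finG] by blast
  define V where "V = {f :: nat \<Rightarrow> complex. \<forall>m. m \<notin> e ` carrier G \<longrightarrow> f m = 0}"
  let ?act = "regular_act G e"
  have modV: "finite_module G V ?act" unfolding V_def by (rule regular_module[OF finG e])
  have Kc: "k \<in> carrier G" if "k \<in> K" for k by (rule subgroup.mem_carrier[OF subK that])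
  \<comment> \<open>\<open>regular_act\<close> translates the argument by \<open>inv g\<close>, so a
    function on which \<open>K\<close> acts by \<open>\<psi>\<close> must be proportional to the
    inverse of \<open>\<psi>\<close> on \<open>K\<close>; outside \<open>K\<close> it is set to
    zero.\<close>
  define w where
    "w = (\<lambda>m. if m \<in> e ` K then inverse (\<psi> (the_inv_into (carrier G) e m)) else 0)"
  have w_e: "w (e x) = (if x \<in> K then inverse (\<psi> x) else 0)" if "x \<in> carrier G" for x
    using that inj_on_image_mem_iff[OF e that, of K] subgroup.subset[OF subK]
    by (simp add: w_def the_inv_into_f_f[OF e])
  have wV: "w \<in> V" using subgroup.subset[OF subK] by (auto simp: w_def V_def)
  have "w (e \<one>) \<noteq> 0"
    using lin subgroup.one_closed[OF subK] by (simp add: w_e linear_char_def)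
  hence w0: "w \<noteq> 0" by auto
  have wk: "?act w k = cscale (\<psi> k) w" if k: "k \<in> K" for k
  proof
    fix m
    show "?act w k m = cscale (\<psi> k) w m"
    proof (cases "m \<in> e ` carrier G")
      case True
      then obtain x where x: "x \<in> carrier G" "m = e x" by blast
      have act: "?act w k (e x) = w (e (x \<otimes> inv k))"
        using x by (simp add: regular_act_def the_inv_into_f_f[OF e])
      have kc: "k \<in> carrier G" "inv k \<in> K" using k Kc subgroup.m_inv_closed[OF subK] by auto
      have iff: "x \<otimes> inv k \<in> K \<longleftrightarrow> x \<in> K"
      proof
        assume "x \<otimes> inv k \<in> K"
        hence "x \<otimes> inv k \<otimes> k \<in> K" using k by (rule subgroup.m_closed[OF subK])
        thus "x \<in> K" using x kc by (simp add: m_assoc)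
      qed (use kc in \<open>simp add: subgroup.m_closed[OF subK]\<close>)
      have "inverse (\<psi> (x \<otimes> inv k)) = \<psi> k * inverse (\<psi> x)" if "x \<in> K"
        using that kc lin linear_char_inv[OF subK lin k] by (simp add: linear_char_def)
      thus ?thesis using x kc by (simp add: act w_e iff cscale_def)
    next
      case False
      thus ?thesis using wV by (simp add: regular_act_def cscale_def V_def)
    qed
  qed
  interpret V: finite_module G V ?act by (rule modV)
  let ?W = "cfun.span (?act w ` carrier G)"
  have W: "right_module G ?W ?act" "?W \<subseteq> V" "w \<in> ?W" using V.submodule_generated[OF wV] by auto
  interpret W: finite_module G ?W ?act by unfold_locales (fact finG, fact W(1))
  have we: "w \<in> W.eigenspace H \<nu>" using W(3) wk HK ext by (auto simp: W.eigenspace_def)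
  interpret W: clifford_module G H K \<nu> ?W ?act
    by (rule clifford_moduleI[OF W.finite_module_axioms we refl])
  have "irreducible_module G ?W ?act"
    unfolding irreducible_module_def
  proof (intro conjI allI impI)
    show "?W \<noteq> {0}" using W(3) w0 by blast
    fix W' assume W': "W' \<subseteq> ?W \<and> right_module G W' ?act"
    interpret W': finite_module G W' ?act by unfold_locales (use W' finG in auto)
    show "W' = {0} \<or> W' = ?W"
    proof (rule disjCI)
      assume "W' \<noteq> ?W"
      show "W' = {0}"
      proof (rule ccontr)
        assume "W' \<noteq> {0}"
        then obtain v where v: "v \<in> W'" "v \<noteq> 0" using W'.W_zero by blast
        \<comment> \<open>Irreducibility: by \<open>resolution\<close> some translate of
          \<open>v\<close> has a nonzero projection to the eigenspace. That projection stays in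
          \<open>W'\<close>, and the eigenspace is the line of \<open>w\<close>, so
          \<open>W'\<close> contains the generator.\<close>
        have "(\<Sum>g\<in>carrier G. ?act (W.proj H \<nu> (?act v (inv g))) g) \<noteq> 0"
          using W.resolution[of v] v W' W.card_K by auto
        then obtain g where g: "g \<in> carrier G" "?act (W.proj H \<nu> (?act v (inv g))) g \<noteq> 0"
          by (meson sum.neutral)
        let ?u = "W.proj H \<nu> (?act v (inv g))"
        have vi: "?act v (inv g) \<in> W'" using v g(1) by simp
        have u0: "?u \<noteq> 0" using g W.act_zero by metis
        have "W.proj H \<nu> = W'.proj H \<nu>" by (simp add: W.proj_def[abs_def] W'.proj_def[abs_def])
        hence uW': "?u \<in> W'" using W'.proj_W[OF subH nu vi] by simp
        have "?u \<in> W.eigenspace H \<nu>" using W.proj_eigenspace[OF subH nu] vi W' by blast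
        hence "?u \<in> cfun.span {w}"
          using W.eigenspace_eq_span[OF W(3) w0 wk ext refl] by simp
        then obtain c where c: "?u = cscale c w" unfolding cfun.span_singleton by blast
        hence "c \<noteq> 0" using u0 by auto
        hence "w = cscale (1 / c) ?u" using c by simp
        hence "w \<in> W'" using W'.W_scale[OF uW', of "1 / c"] by metis
        hence "?W \<subseteq> W'" by (intro cfun.span_minimal W'.subspace) auto
        thus False using W' \<open>W' \<noteq> ?W\<close> by blast
      qed
    qed
  qed (fact W(1))
  thus ?thesis using that W(3) w0 wk by blast
qed

lemma extension_character:
  assumes psi: "\<psi> \<in> extensions" and irr: "irreducible_module G W act"
    and w: "w \<in> W" "w \<noteq> 0" "\<And>k. k \<in> K \<Longrightarrow> act w k = cscale (\<psi> k) w"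
  shows "module_character G W act = induced \<psi>"
    and "character_pairing H \<nu> (module_character G W act) \<noteq> 0"
    and "of_nat (card K) * module_character G W act \<one> = of_nat (card (carrier G))"
proof -
  have ext: "\<And>h. h \<in> H \<Longrightarrow> \<psi> h = \<nu> h" using psi by (auto simp: extensions_def)
  interpret finite_module G W act
    using irr finG by unfold_locales (auto simp: irreducible_module_def)
  have we: "w \<in> eigenspace H \<nu>" using w HK ext by (auto simp: eigenspace_def)
  interpret clifford_module G H K \<nu> W act
    by (rule irreducible_clifford_module[OF irr we w(2)])
  note gen = irreducible_generated[OF irr w(1,2)]
  show "module_character G W act = induced \<psi>" by (rule character_eq_induced[OF w ext gen])
  show "of_nat (card K) * module_character G W act \<one> = of_nat (card (carrier G))"
    by (rule degree_generator[OF w ext gen])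
  show "character_pairing H \<nu> (module_character G W act) \<noteq> 0"
    using character_pairing_nonzero_iff[OF finite_module_axioms subH nu] we w(2) by blast
qed

text \<open>From left to right, \<open>degree_formula\<close> forces the eigenspace to be a line;
  \<open>K\<close> preserves it, and the scalars by which \<open>K\<close> acts form the extension.
  From right to left, the module of \<open>extension_module\<close> realizes the induced
  character.\<close>

lemma minimal_degree_iff:
  "\<chi> \<in> irreducible_characters G \<and> character_pairing H \<nu> \<chi> \<noteq> 0 \<and>
     of_nat (card K) * \<chi> \<one> = of_nat (card (carrier G)) \<longleftrightarrow> \<chi> \<in> induced ` extensions"
  (is "?L \<longleftrightarrow> ?R")
proof
  assume ?R
  then obtain \<psi> where psi: "\<psi> \<in> extensions" "\<chi> = induced \<psi>" by blast
  obtain W :: "(nat \<Rightarrow> complex) set" and act w where irr: "irreducible_module G W act"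
    and w: "w \<in> W" "w \<noteq> 0" "\<And>k. k \<in> K \<Longrightarrow> act w k = cscale (\<psi> k) w"
    using extension_module[OF psi(1)] by metis
  have "module_character G W act \<in> irreducible_characters G"
    using irr unfolding irreducible_characters_def by blast
  thus ?L using extension_character[OF psi(1) irr w] psi(2) by simp
next
  assume L: ?L
  then obtain W :: "(nat \<Rightarrow> complex) set" and act where irr: "irreducible_module G W act"
    and chi: "\<chi> = module_character G W act" unfolding irreducible_characters_def by blast
  interpret finite_module G W act
    using irr finG by unfold_locales (auto simp: irreducible_module_def)
  have "eigenspace H \<nu> \<noteq> {0}"
    using character_pairing_nonzero_iff[OF finite_module_axioms subH nu] L chi by blast
  then obtain w0 where "w0 \<in> eigenspace H \<nu>" "w0 \<noteq> 0"
    using cfun.subspace_0[OF eigenspace_subspace[OF subgroup.subset[OF subH]], of \<nu>] by blast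
  then interpret clifford_module G H K \<nu> W act by (rule irreducible_clifford_module[OF irr])
  obtain B where B: "finite B" "cfun.independent B" "cfun.span B = eigenspace H \<nu>"
    by (rule eigenspace_basis[OF subH nu])
  have "of_nat (card (carrier G) * card B) = (of_nat (card (carrier G)) :: complex)"
    using degree_formula[OF B] L chi by simp
  hence "card (carrier G) * card B = card (carrier G)" by (simp only: of_nat_eq_iff)
  moreover have "card (carrier G) \<noteq> 0" using finG one_closed by auto
  ultimately have "card B = 1" by simp
  then obtain w where Bw: "B = {w}" by (rule card_1_singletonE)
  have w0: "w \<noteq> 0" using B(2) Bw by auto
  have we: "w \<in> eigenspace H \<nu>" using B(3) Bw cfun.span_base[of w B] by simp
  hence wW: "w \<in> W" by (simp add: eigenspace_def)
  have "\<exists>c. act w k = cscale c w" if "k \<in> K" for k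
    using eigenspace_stable[OF we that]
    unfolding B(3)[symmetric] Bw cfun.span_singleton by blast
  then obtain \<psi>' where psi': "\<And>k. k \<in> K \<Longrightarrow> act w k = cscale (\<psi>' k) w" by metis
  define \<psi> where "\<psi> = restrict \<psi>' K"
  have wk: "act w k = cscale (\<psi> k) w" if "k \<in> K" for k using psi'[OF that] that by (simp add: \<psi>_def)
  have mult: "\<psi> (k \<otimes> l) = \<psi> k * \<psi> l" if kl: "k \<in> K" "l \<in> K" for k l
  proof -
    have "cscale (\<psi> (k \<otimes> l)) w = act (act w k) l"
      using wk[OF subgroup.m_closed[OF subK kl]] act_mult[of k l w] kl K_carrier wW by simp
    also have "\<dots> = cscale (\<psi> k * \<psi> l) w"
      using kl wk K_carrier wW by (simp add: act_scale)
    finally show ?thesis using w0 by simp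
  qed
  have one: "\<psi> \<one> = 1"
  proof -
    have "cscale (\<psi> \<one>) w = cscale 1 w" using wk[OF subgroup.one_closed[OF subK]] wW by simp
    thus ?thesis using w0 by (simp only: cfun.scale_cancel_right) simp
  qed
  have "\<psi> k \<noteq> 0" if "k \<in> K" for k
    using mult[OF that subgroup.m_inv_closed[OF subK that]] one r_inv[OF K_carrier[OF that]] by auto
  hence lin: "linear_char G K \<psi>" using mult by (simp add: linear_char_def)
  have "\<psi> h = \<nu> h" if h: "h \<in> H" for h
  proof -
    have "cscale (\<psi> h) w = cscale (\<nu> h) w"
      using wk[of h] h HK we by (auto simp: eigenspace_def)
    thus ?thesis using w0 by simp
  qed
  hence "\<psi> \<in> extensions" using lin by (simp add: extensions_def \<psi>_def)
  thus ?R using extension_character(1)[OF _ irr wW w0 wk] chi by blast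
qed

end

text \<open>If every \<open>g\<close> met a conflict, \<open>proj H' \<nu>'\<close> would kill all
  translates of \<open>w\<close> and hence all of \<open>W\<close>. But the common character has
  nonzero pairing with \<open>\<nu>'\<close>, so \<open>W\<close> contains a nonzero eigenvector of
  \<open>H'\<close>, which the projection fixes.\<close>

lemma (in group) induced_eq_imp_compatible:
  assumes cp: "clifford_pair G H K \<nu>" and cp': "clifford_pair G H' K' \<nu>'"
    and psi: "\<psi> \<in> clifford_pair.extensions G H K \<nu>"
    and psi': "\<psi>' \<in> clifford_pair.extensions G H' K' \<nu>'"
    and eq: "clifford_pair.induced G K \<psi> = clifford_pair.induced G K' \<psi>'"
  obtains g where "g \<in> carrier G"
    "\<And>h. h \<in> H \<Longrightarrow> inv g \<otimes> h \<otimes> g \<in> H' \<Longrightarrow> \<nu> h = \<nu>' (inv g \<otimes> h \<otimes> g)"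
proof (rule ccontr)
  note found = that
  assume contra: "\<not> thesis"
  interpret C: clifford_pair G H K \<nu> by fact
  interpret C': clifford_pair G H' K' \<nu>' by fact
  obtain W :: "(nat \<Rightarrow> complex) set" and act w where irr: "irreducible_module G W act"
    and w: "w \<in> W" "w \<noteq> 0" "\<And>k. k \<in> K \<Longrightarrow> act w k = cscale (\<psi> k) w"
    using C.extension_module[OF psi] by metis
  obtain W' :: "(nat \<Rightarrow> complex) set" and act' w' where irr': "irreducible_module G W' act'"
    and w': "w' \<in> W'" "w' \<noteq> 0" "\<And>k. k \<in> K' \<Longrightarrow> act' w' k = cscale (\<psi>' k) w'"
    using C'.extension_module[OF psi'] by metis
  interpret finite_module G W act
    using irr C.finG by unfold_locales (auto simp: irreducible_module_def)
  have "character_pairing H' \<nu>' (module_character G W act) \<noteq> 0"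
    using C.extension_character(1)[OF psi irr w] C'.extension_character(1,2)[OF psi' irr' w'] eq
    by simp
  hence "eigenspace H' \<nu>' \<noteq> {0}"
    using character_pairing_nonzero_iff[OF finite_module_axioms C'.subH C'.nu] by blast
  then obtain v where v: "v \<in> eigenspace H' \<nu>'" "v \<noteq> 0"
    using cfun.subspace_0[OF eigenspace_subspace[OF subgroup.subset[OF C'.subH]], of \<nu>'] by blast
  have we: "w \<in> eigenspace H \<nu>"
    using w C.HK psi by (auto simp: eigenspace_def C.extensions_def)
  have "proj H' \<nu>' x = 0" if "x \<in> act w ` carrier G" for x
  proof -
    obtain g where g: "g \<in> carrier G" "x = act w g" using \<open>x \<in> act w ` carrier G\<close> by blast
    obtain h where "h \<in> H" "inv g \<otimes> h \<otimes> g \<in> H'" "\<nu> h \<noteq> \<nu>' (inv g \<otimes> h \<otimes> g)"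
      using contra found[OF g(1)] by blast
    thus ?thesis using proj_translate_eq_0[OF C.subH we C'.subH C'.nu g(1)] g(2) by blast
  qed
  moreover have "v \<in> cfun.span (act w ` carrier G)"
    using v(1) unfolding irreducible_generated[OF irr w(1,2), symmetric] by (simp add: eigenspace_def)
  moreover have "act w ` carrier G \<subseteq> W" using w(1) by auto
  ultimately have "proj H' \<nu>' v = 0"
    using linear_endo_on_vanishes_on_span[OF _ proj_linear[OF C'.subH C'.nu] _ subspace] by blast
  thus False using proj_id[OF C'.subH C'.nu v(1)] v(2) by simp
qed

text \<open>Each extension makes \<open>K\<close> with itself a pair of the same kind, since a
  linear character of \<open>K\<close> is invariant under conjugation by \<open>K\<close> and the
  separating elements of \<open>H\<close> lie in \<open>K\<close>. A compatible \<open>g\<close>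
  cannot lie outside \<open>K\<close>, as both extensions restrict to \<open>\<nu>\<close> on
  \<open>H\<close>; and conjugation inside \<open>K\<close> changes nothing.\<close>

lemma (in clifford_pair) inj_on_induced: "inj_on induced extensions"
proof
  fix \<psi> \<psi>' assume psi: "\<psi> \<in> extensions" "\<psi>' \<in> extensions" and eq: "induced \<psi> = induced \<psi>'"
  have cp: "clifford_pair G K K \<phi>" if phi: "\<phi> \<in> extensions" for \<phi>
  proof (intro clifford_pair.intro clifford_pair_axioms.intro)
    show "linear_char G K \<phi>" using phi by (simp add: extensions_def)
    fix k h assume kh: "k \<in> K" "h \<in> K"
    have ki: "inv k \<in> K" using subgroup.m_inv_closed[OF subK kh(1)] .
    have "\<phi> (k \<otimes> h \<otimes> inv k) = \<phi> k * \<phi> h * \<phi> (inv k)"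
      using phi kh ki subgroup.m_closed[OF subK] by (simp add: extensions_def linear_char_def)
    also have "\<dots> = \<phi> h"
      using phi kh linear_char_inv[OF subK _ kh(1), of \<phi>] by (simp add: extensions_def linear_char_def)
    finally show "k \<otimes> h \<otimes> inv k \<in> K \<and> \<phi> (k \<otimes> h \<otimes> inv k) = \<phi> h"
      using kh ki subgroup.m_closed[OF subK] by simp
  next
    fix g assume "g \<in> carrier G" "g \<notin> K"
    then obtain h where "h \<in> H" "inv g \<otimes> h \<otimes> g \<in> H" "\<nu> h \<noteq> \<nu> (inv g \<otimes> h \<otimes> g)"
      using separated by blast
    thus "\<exists>h\<in>K. inv g \<otimes> h \<otimes> g \<in> K \<and> \<phi> h \<noteq> \<phi> (inv g \<otimes> h \<otimes> g)"
      using phi HK by (auto simp: extensions_def subset_iff)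
  qed (use finG subK in \<open>auto intro: is_group\<close>)
  have ext: "\<phi> \<in> clifford_pair.extensions G K K \<phi>" if "\<phi> \<in> extensions" for \<phi>
    using that clifford_pair.extensions_def[OF cp[OF that]] by (simp add: extensions_def)
  obtain g where g: "g \<in> carrier G"
    "\<And>h. h \<in> K \<Longrightarrow> inv g \<otimes> h \<otimes> g \<in> K \<Longrightarrow> \<psi> h = \<psi>' (inv g \<otimes> h \<otimes> g)"
    using induced_eq_imp_compatible[OF cp[OF psi(1)] cp[OF psi(2)] ext[OF psi(1)] ext[OF psi(2)] eq]
    by blast
  have gK: "g \<in> K"
  proof (rule ccontr)
    assume "g \<notin> K"
    then obtain h where "h \<in> H" "inv g \<otimes> h \<otimes> g \<in> H" "\<nu> h \<noteq> \<nu> (inv g \<otimes> h \<otimes> g)"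
      using separated[OF g(1)] by blast
    thus False using g(2)[of h] psi HK by (auto simp: extensions_def subset_iff)
  qed
  show "\<psi> = \<psi>'"
  proof (rule extensionalityI[of _ K])
    fix k assume k: "k \<in> K"
    have gi: "inv g \<in> K" using subgroup.m_inv_closed[OF subK gK] .
    have lin: "linear_char G K \<psi>'" using psi by (simp add: extensions_def)
    have "\<psi> k = \<psi>' (inv g \<otimes> k \<otimes> g)"
      using k gK gi subgroup.m_closed[OF subK] by (intro g(2)) auto
    also have "\<dots> = \<psi>' (inv g) * \<psi>' k * \<psi>' g"
      using k gK gi lin subgroup.m_closed[OF subK] by (simp add: linear_char_def)
    also have "\<dots> = \<psi>' k"
      using linear_char_inv[OF subK lin gK] lin gK by (simp add: linear_char_def)
    finally show "\<psi> k = \<psi>' k" .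
  qed (use psi in \<open>auto simp: extensions_def\<close>)
qed

section \<open>Finite sums in a commutative monoid\<close>

lemma (in abelian_monoid) finsum_swap:
  assumes "finite A" "finite B" "\<And>i j. i \<in> A \<Longrightarrow> j \<in> B \<Longrightarrow> f i j \<in> carrier G"
  shows "(\<Oplus>i\<in>A. \<Oplus>j\<in>B. f i j) = (\<Oplus>j\<in>B. \<Oplus>i\<in>A. f i j)"
  using assms(1,3)
proof (induction A rule: finite_induct)
  case empty
  thus ?case by simp
next
  case (insert x A)
  have "(\<Oplus>i\<in>insert x A. \<Oplus>j\<in>B. f i j) = (\<Oplus>j\<in>B. f x j) \<oplus> (\<Oplus>i\<in>A. \<Oplus>j\<in>B. f i j)"
    using insert by (intro finsum_insert) (auto intro!: finsum_closed)
  also have "\<dots> = (\<Oplus>j\<in>B. f x j) \<oplus> (\<Oplus>j\<in>B. \<Oplus>i\<in>A. f i j)" using insert by simp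
  also have "\<dots> = (\<Oplus>j\<in>B. f x j \<oplus> (\<Oplus>i\<in>A. f i j))"
    using insert by (intro finsum_addf[symmetric]) (auto intro!: finsum_closed)
  also have "\<dots> = (\<Oplus>j\<in>B. \<Oplus>i\<in>insert x A. f i j)"
    using insert by (intro finsum_cong' refl finsum_insert[symmetric]) (auto intro!: finsum_closed)
  finally show ?case .
qed

lemma (in abelian_monoid) finsum_single:
  assumes "finite A" "a \<in> A" "f a \<in> carrier G" "\<And>k. k \<in> A \<Longrightarrow> k \<noteq> a \<Longrightarrow> f k = \<zero>"
  shows "(\<Oplus>k\<in>A. f k) = f a"
proof -
  have "(\<Oplus>k\<in>A. f k) = (\<Oplus>k\<in>A. if a = k then f a else \<zero>)"
    using assms by (intro finsum_cong') auto
  also have "\<dots> = f a" by (rule finsum_singleton) (use assms in auto)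
  finally show ?thesis .
qed

section \<open>Unitriangular matrices\<close>

locale unitriangular_group = field F for F (structure) +
  fixes n :: nat
begin

abbreviation U where "U \<equiv> unitriangular F n"
abbreviation V where "V \<equiv> strict_lower F n"

lemma matsI:
  assumes "dim_row A = n" "dim_col A = n"
    "\<And>i j. i < n \<Longrightarrow> j < n \<Longrightarrow> A $$ (i, j) \<in> carrier F"
  shows "A \<in> mats F n"
  unfolding mats_def carrier_mat_def using assms by simp

lemma mats_dim: "A \<in> mats F n \<Longrightarrow> dim_row A = n \<and> dim_col A = n"
  unfolding mats_def carrier_mat_def by simp

lemma mats_entry [simp, intro]: "A \<in> mats F n \<Longrightarrow> i < n \<Longrightarrow> j < n \<Longrightarrow> A $$ (i, j) \<in> carrier F"
  unfolding mats_def by blast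

lemma mats_eqI:
  assumes "A \<in> mats F n" "B \<in> mats F n"
    "\<And>i j. i < n \<Longrightarrow> j < n \<Longrightarrow> A $$ (i, j) = B $$ (i, j)"
  shows "A = B"
  by (rule eq_matI) (simp_all only: mats_dim[OF assms(1)] mats_dim[OF assms(2)] assms(3))

lemma mmult_entry:
  "i < n \<Longrightarrow> j < n \<Longrightarrow> mmult F n A B $$ (i, j) = (\<Oplus>k\<in>{..<n}. A $$ (i, k) \<otimes> B $$ (k, j))"
  by (simp add: mmult_def)

lemma mmult_mats [simp, intro]:
  "A \<in> mats F n \<Longrightarrow> B \<in> mats F n \<Longrightarrow> mmult F n A B \<in> mats F n"
proof (rule matsI)
  fix i j assume AB: "A \<in> mats F n" "B \<in> mats F n" and ij: "i < n" "j < n"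
  have "(\<lambda>k. A $$ (i, k) \<otimes> B $$ (k, j)) \<in> {..<n} \<rightarrow> carrier F"
    using AB ij by (simp add: Pi_def)
  thus "mmult F n A B $$ (i, j) \<in> carrier F" unfolding mmult_entry[OF ij] by (rule finsum_closed)
qed (simp_all add: mmult_def)

lemma mone_entry: "i < n \<Longrightarrow> j < n \<Longrightarrow> mone F n $$ (i, j) = (if i = j then \<one> else \<zero>)"
  by (simp add: mone_def)

lemma mone_mats [simp, intro]: "mone F n \<in> mats F n"
  by (rule matsI) (auto simp: mone_def)

lemma mmult_assoc:
  assumes "A \<in> mats F n" "B \<in> mats F n" "C \<in> mats F n"
  shows "mmult F n (mmult F n A B) C = mmult F n A (mmult F n B C)"
proof (rule mats_eqI)
  fix i j assume ij: "i < n" "j < n"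
  have "mmult F n (mmult F n A B) C $$ (i, j) =
      (\<Oplus>k\<in>{..<n}. (\<Oplus>l\<in>{..<n}. A $$ (i, l) \<otimes> B $$ (l, k)) \<otimes> C $$ (k, j))"
    unfolding mmult_entry[OF ij]
    by (intro finsum_cong') (use assms ij in \<open>auto simp: mmult_entry intro!: finsum_closed\<close>)
  also have "\<dots> = (\<Oplus>k\<in>{..<n}. \<Oplus>l\<in>{..<n}. A $$ (i, l) \<otimes> B $$ (l, k) \<otimes> C $$ (k, j))"
    by (intro finsum_cong' finsum_ldistr) (use assms ij in \<open>auto intro!: finsum_closed\<close>)
  also have "\<dots> = (\<Oplus>l\<in>{..<n}. \<Oplus>k\<in>{..<n}. A $$ (i, l) \<otimes> B $$ (l, k) \<otimes> C $$ (k, j))"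
    by (intro finsum_swap) (use assms ij in auto)
  also have "\<dots> = (\<Oplus>l\<in>{..<n}. \<Oplus>k\<in>{..<n}. A $$ (i, l) \<otimes> (B $$ (l, k) \<otimes> C $$ (k, j)))"
    by (intro finsum_cong') (use assms ij in \<open>auto simp: m_assoc intro!: finsum_closed\<close>)
  also have "\<dots> = (\<Oplus>l\<in>{..<n}. A $$ (i, l) \<otimes> (\<Oplus>k\<in>{..<n}. B $$ (l, k) \<otimes> C $$ (k, j)))"
    by (intro finsum_cong' finsum_rdistr[symmetric]) (use assms ij in \<open>auto intro!: finsum_closed\<close>)
  also have "\<dots> = mmult F n A (mmult F n B C) $$ (i, j)"
    unfolding mmult_entry[OF ij]
    by (intro finsum_cong') (use assms ij in \<open>auto simp: mmult_entry intro!: finsum_closed\<close>)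
  finally show "mmult F n (mmult F n A B) C $$ (i, j) = mmult F n A (mmult F n B C) $$ (i, j)" .
qed (use assms in auto)

lemma mone_left [simp]: "A \<in> mats F n \<Longrightarrow> mmult F n (mone F n) A = A"
proof (rule mats_eqI)
  fix i j assume A: "A \<in> mats F n" and ij: "i < n" "j < n"
  show "mmult F n (mone F n) A $$ (i, j) = A $$ (i, j)"
    unfolding mmult_entry[OF ij]
    by (subst finsum_single[where a = i]) (use A ij in \<open>auto simp: mone_entry\<close>)
qed auto

lemma mone_right [simp]: "A \<in> mats F n \<Longrightarrow> mmult F n A (mone F n) = A"
proof (rule mats_eqI)
  fix i j assume A: "A \<in> mats F n" and ij: "i < n" "j < n"
  show "mmult F n A (mone F n) $$ (i, j) = A $$ (i, j)"
    unfolding mmult_entry[OF ij]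
    by (subst finsum_single[where a = j]) (use A ij in \<open>auto simp: mone_entry\<close>)
qed auto

lemma U_carrier: "u \<in> carrier U \<longleftrightarrow> u \<in> mats F n \<and> (\<forall>i<n. u $$ (i, i) = \<one>) \<and>
    (\<forall>i<n. \<forall>j<n. i < j \<longrightarrow> u $$ (i, j) = \<zero>)"
  by (simp add: unitriangular_def)

lemma U_I:
  assumes "u \<in> mats F n" "\<And>i. i < n \<Longrightarrow> u $$ (i, i) = \<one>"
    "\<And>i j. i < j \<Longrightarrow> j < n \<Longrightarrow> u $$ (i, j) = \<zero>"
  shows "u \<in> carrier U"
  using assms unfolding U_carrier by simp

lemma U_mult [simp]: "u \<otimes>\<^bsub>U\<^esub> v = mmult F n u v" and U_one [simp]: "\<one>\<^bsub>U\<^esub> = mone F n"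
  by (simp_all add: unitriangular_def)

lemma U_mats [simp]: "u \<in> carrier U \<Longrightarrow> u \<in> mats F n"
  and U_diag [simp]: "u \<in> carrier U \<Longrightarrow> i < n \<Longrightarrow> u $$ (i, i) = \<one>"
  and U_upper [simp]: "u \<in> carrier U \<Longrightarrow> i < j \<Longrightarrow> j < n \<Longrightarrow> u $$ (i, j) = \<zero>"
  unfolding U_carrier by simp_all

lemma U_entry_le:
  assumes "u \<in> carrier U" "v \<in> carrier U" "k < n" "i < n" "j < n" "i \<le> j" "k \<noteq> i"
  shows "u $$ (i, k) \<otimes> v $$ (k, j) = \<zero>"
proof (cases "i < k")
  case True
  thus ?thesis using assms by (simp add: mats_entry)
next
  case False
  thus ?thesis using assms by (simp add: mats_entry)
qed

lemma U_closed:
  assumes "u \<in> carrier U" "v \<in> carrier U" shows "mmult F n u v \<in> carrier U"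
proof -
  have "mmult F n u v $$ (i, j) = u $$ (i, i) \<otimes> v $$ (i, j)" if "i < n" "j < n" "i \<le> j" for i j
    unfolding mmult_entry[OF that(1,2)] using assms that U_entry_le[OF assms]
    by (intro finsum_single) auto
  thus ?thesis using assms by (intro U_I) simp_all
qed

lemma mone_U: "mone F n \<in> carrier U"
  by (rule U_I) (simp_all add: mone_entry mone_mats)

section \<open>Root elements and pattern subgroups\<close>

definition root :: "nat \<Rightarrow> nat \<Rightarrow> 'a \<Rightarrow> 'a mat" where
  "root k l t = mat n n (\<lambda>(i, j). if i = j then \<one> else if i = k \<and> j = l then t else \<zero>)"

lemma root_entry:
  "i < n \<Longrightarrow> j < n \<Longrightarrow>
    root k l t $$ (i, j) = (if i = j then \<one> else if i = k \<and> j = l then t else \<zero>)"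
  by (simp add: root_def)

lemma root_U: "l < k \<Longrightarrow> k < n \<Longrightarrow> t \<in> carrier F \<Longrightarrow> root k l t \<in> carrier U"
  by (rule U_I, rule matsI) (auto simp: root_entry, simp_all add: root_def)

text \<open>Since \<open>root k l t\<close> is the identity plus \<open>t\<close> at (k,l), right
  multiplication by it is the column operation adding \<open>t\<close> times column k to column
  l.\<close>

lemma mmult_root_entry:
  assumes "u \<in> mats F n" "l < k" "k < n" "t \<in> carrier F" "i < n" "j < n"
  shows "mmult F n u (root k l t) $$ (i, j) =
    (if j = l then u $$ (i, l) \<oplus> u $$ (i, k) \<otimes> t else u $$ (i, j))"
proof (cases "j = l")
  case False
  have "mmult F n u (root k l t) $$ (i, j) = u $$ (i, j) \<otimes> root k l t $$ (j, j)"
    unfolding mmult_entry[OF assms(5,6)]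
    by (rule finsum_single) (use assms False in \<open>auto simp: root_entry\<close>)
  thus ?thesis using assms False by (simp add: root_entry)
next
  case True
  have "mmult F n u (root k l t) $$ (i, j) =
      (\<Oplus>m\<in>{..<n}. (if m = l then u $$ (i, l) else \<zero>) \<oplus> (if m = k then u $$ (i, k) \<otimes> t else \<zero>))"
    unfolding mmult_entry[OF assms(5,6)]
    by (rule finsum_cong') (use assms True in \<open>auto simp: root_entry\<close>)
  also have "\<dots> = (\<Oplus>m\<in>{..<n}. if m = l then u $$ (i, l) else \<zero>) \<oplus>
      (\<Oplus>m\<in>{..<n}. if m = k then u $$ (i, k) \<otimes> t else \<zero>)"
    by (rule finsum_addf) (use assms in auto)
  also have "(\<Oplus>m\<in>{..<n}. if m = l then u $$ (i, l) else \<zero>) = u $$ (i, l)"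
    by (subst finsum_single[where a = l]) (use assms in auto)
  also have "(\<Oplus>m\<in>{..<n}. if m = k then u $$ (i, k) \<otimes> t else \<zero>) = u $$ (i, k) \<otimes> t"
    by (subst finsum_single[where a = k]) (use assms in auto)
  finally show ?thesis using True by simp
qed

definition positions :: "(nat \<times> nat) set" where
  "positions = {(i, j). j < i \<and> i < n}"

definition pattern :: "(nat \<times> nat) set \<Rightarrow> 'a mat set" where
  "pattern P = {u \<in> carrier U. \<forall>i j. j < i \<longrightarrow> i < n \<longrightarrow> (i, j) \<notin> P \<longrightarrow> u $$ (i, j) = \<zero>}"

definition closed_pattern :: "(nat \<times> nat) set \<Rightarrow> bool" where
  "closed_pattern P \<longleftrightarrow> P \<subseteq> positions \<and> (\<forall>i j k. (i, j) \<in> P \<longrightarrow> (j, k) \<in> P \<longrightarrow> (i, k) \<in> P)"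

lemma pattern_U: "u \<in> pattern P \<Longrightarrow> u \<in> carrier U"
  by (simp add: pattern_def)

lemma pattern_positions: "pattern positions = carrier U"
  by (auto simp: pattern_def positions_def)

lemma closed_positions: "closed_pattern positions"
  by (auto simp: closed_pattern_def positions_def)

lemma pattern_one: "mone F n \<in> pattern P"
  using mone_U by (auto simp: pattern_def mone_entry)

lemma pattern_root:
  assumes "closed_pattern P" "(k, l) \<in> P" "t \<in> carrier F" shows "root k l t \<in> pattern P"
proof -
  have "l < k" "k < n" using assms by (auto simp: closed_pattern_def positions_def)
  thus ?thesis using assms root_U by (auto simp: pattern_def root_entry)
qed

text \<open>Without a factorization of (i,j) inside \<open>P\<close>, only the intermediate indices
  j and i survive in the entry sum. The lemma serves twice: at positions outside \<open>P\<close> it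
  gives closure under products, and at indecomposable positions of \<open>P\<close> it makes the
  entry an additive homomorphism, the source of linear characters.\<close>

lemma pattern_mult_entry:
  assumes P: "closed_pattern P" and u: "u \<in> pattern P" and v: "v \<in> pattern P"
    and ij: "j < i" "i < n" and np: "\<And>k. (i, k) \<in> P \<Longrightarrow> (k, j) \<in> P \<Longrightarrow> False"
  shows "mmult F n u v $$ (i, j) = u $$ (i, j) \<oplus> v $$ (i, j)"
proof -
  have uv: "u \<in> carrier U" "v \<in> carrier U" using u v by (auto simp: pattern_U)
  have jn: "j < n" using ij by simp
  have "mmult F n u v $$ (i, j) =
      (\<Oplus>m\<in>{..<n}. (if m = j then u $$ (i, j) else \<zero>) \<oplus> (if m = i then v $$ (i, j) else \<zero>))"
    unfolding mmult_entry[OF ij(2) jn]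
  proof (rule finsum_cong')
    fix m assume "m \<in> {..<n}"
    hence m: "m < n" by simp
    consider "m < j" | "m = j" | "j < m" "m < i" | "m = i" | "i < m" by linarith
    thus "u $$ (i, m) \<otimes> v $$ (m, j) =
      (if m = j then u $$ (i, j) else \<zero>) \<oplus> (if m = i then v $$ (i, j) else \<zero>)"
    proof cases
      case 3
      have "u $$ (i, m) = \<zero> \<or> v $$ (m, j) = \<zero>"
        using np[of m] u v 3 ij m unfolding pattern_def by blast
      thus ?thesis using 3 uv ij jn m by auto
    qed (use uv ij jn m in auto)
  qed (use uv ij jn in auto)
  also have "\<dots> = (\<Oplus>m\<in>{..<n}. if m = j then u $$ (i, j) else \<zero>) \<oplus>
      (\<Oplus>m\<in>{..<n}. if m = i then v $$ (i, j) else \<zero>)"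
    by (rule finsum_addf) (use uv ij jn in auto)
  also have "(\<Oplus>m\<in>{..<n}. if m = j then u $$ (i, j) else \<zero>) = u $$ (i, j)"
    by (subst finsum_single[where a = j]) (use uv ij jn in auto)
  also have "(\<Oplus>m\<in>{..<n}. if m = i then v $$ (i, j) else \<zero>) = v $$ (i, j)"
    by (subst finsum_single[where a = i]) (use uv ij jn in auto)
  finally show ?thesis .
qed

lemma pattern_closed:
  assumes P: "closed_pattern P" and u: "u \<in> pattern P" and v: "v \<in> pattern P"
  shows "mmult F n u v \<in> pattern P"
proof -
  have "mmult F n u v $$ (i, j) = \<zero>" if "j < i" "i < n" "(i, j) \<notin> P" for i j
  proof -
    have "mmult F n u v $$ (i, j) = u $$ (i, j) \<oplus> v $$ (i, j)"
      using P that unfolding closed_pattern_def by (intro pattern_mult_entry[OF P u v]) blast+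
    thus ?thesis using u v that by (simp add: pattern_def)
  qed
  thus ?thesis using u v U_closed by (simp add: pattern_def)
qed

text \<open>Column operations clear the entries below the diagonal row by row from the top, in each row
  from left to right; clearing one entry does not disturb the entries cleared before.\<close>

lemma pattern_induct:
  assumes P: "closed_pattern P" and g: "g \<in> pattern P" and one: "Q (mone F n)"
    and step: "\<And>g k l t. g \<in> pattern P \<Longrightarrow> (k, l) \<in> P \<Longrightarrow> t \<in> carrier F \<Longrightarrow>
      Q (mmult F n g (root k l t)) \<Longrightarrow> Q g"
  shows "Q g"
proof -
  \<comment> \<open>\<open>i * n + j\<close> numbers the positions row by row; \<open>Z g m\<close>
    says that the positions below the diagonal with number less than \<open>m\<close> are cleared.
    The induction runs on the number \<open>d\<close> of positions still to be visited.\<close>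
  define Z where "Z = (\<lambda>(g :: 'a mat) m. \<forall>i j. j < i \<longrightarrow> i < n \<longrightarrow> i * n + j < m \<longrightarrow> g $$ (i, j) = \<zero>)"
  have "Q g" if "m + d = n * n" "g \<in> pattern P" "Z g m" for d m g
    using that
  proof (induction d arbitrary: m g)
    case 0
    have gU: "g \<in> carrier U" using 0 by (simp add: pattern_U)
    have "g = mone F n"
    proof (rule mats_eqI)
      fix i j assume ij: "i < n" "j < n"
      have "i * n + j < Suc i * n" using ij by simp
      also have "\<dots> \<le> n * n" using ij by (intro mult_le_mono1) simp
      finally have "i * n + j < m" using 0 by simp
      thus "g $$ (i, j) = mone F n $$ (i, j)"
        using 0 ij gU unfolding Z_def by (cases i j rule: linorder_cases) (auto simp: mone_entry)
    qed (use gU in auto)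
    thus ?case using one by simp
  next
    case (Suc d)
    have gU: "g \<in> carrier U" using Suc by (simp add: pattern_U)
    define k where "k = m div n"
    define l where "l = m mod n"
    have n0: "n > 0" using Suc.prems(1) by (cases n) auto
    have "m < n * n" using Suc.prems(1) by simp
    hence kl: "k < n" "l < n" "m = k * n + l"
      using n0 by (auto simp: k_def l_def less_mult_imp_div_less)
    have eq_m: "i = k \<and> j = l" if "i * n + j = m" "j < n" for i j
      using that n0 unfolding k_def l_def by auto
    show ?case
    proof (cases "l < k \<and> g $$ (k, l) \<noteq> \<zero>")
      case False
      have "Z g (Suc m)"
        unfolding Z_def
      proof (intro allI impI)
        fix i j assume ij: "j < i" "i < n" "i * n + j < Suc m"
        show "g $$ (i, j) = \<zero>"
        proof (cases "i * n + j = m")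
          case True
          thus ?thesis using eq_m[of i j] ij False by auto
        next
          case False
          thus ?thesis using ij Suc.prems(3) unfolding Z_def by auto
        qed
      qed
      thus ?thesis using Suc.IH[of "Suc m" g] Suc.prems by simp
    next
      case True
      define t where "t = \<ominus> (g $$ (k, l))"
      have t: "t \<in> carrier F" "g $$ (k, l) \<oplus> t = \<zero>"
        using gU kl by (auto simp: t_def r_neg)
      have klP: "(k, l) \<in> P" using True kl Suc.prems(2) by (auto simp: pattern_def)
      let ?g = "mmult F n g (root k l t)"
      have g': "?g \<in> pattern P"
        using pattern_closed[OF P Suc.prems(2) pattern_root[OF P klP t(1)]] .
      have "Z ?g (Suc m)"
        unfolding Z_def
      proof (intro allI impI)
        fix i j assume ij: "j < i" "i < n" "i * n + j < Suc m"
        have zero: "g $$ (i, j) = \<zero>" if "i * n + j \<noteq> m"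
          using that ij Suc.prems(3) unfolding Z_def by auto
        have entry: "?g $$ (i, j) =
            (if j = l then g $$ (i, l) \<oplus> g $$ (i, k) \<otimes> t else g $$ (i, j))"
          using mmult_root_entry[of g l k t i j] gU True kl t ij by simp
        show "?g $$ (i, j) = \<zero>"
        proof (cases "j = l")
          case False
          hence "i * n + j \<noteq> m" using eq_m[of i j] ij by auto
          thus ?thesis using entry False zero by simp
        next
          case jl: True
          have "i * n \<le> k * n" using ij(3) jl kl(3) by linarith
          hence "i \<le> k" using n0 by (metis mult_le_cancel2)
          show ?thesis
          proof (cases "i = k")
            case True
            thus ?thesis using entry jl t kl gU by simp
          next
            case False
            hence "i < k" using \<open>i \<le> k\<close> by simp
            moreover have "i * n + j \<noteq> m" using False eq_m[of i j] ij by auto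
            ultimately show ?thesis using entry jl zero t kl gU by simp
          qed
        qed
      qed
      hence "Q ?g" using Suc.IH[of "Suc m" ?g] Suc.prems g' by simp
      thus ?thesis using step[OF Suc.prems(2) klP t(1)] by simp
    qed
  qed
  moreover have "Z g 0" by (simp add: Z_def)
  ultimately show ?thesis using g by (metis add_0)
qed

text \<open>The principle \<open>pattern_induct\<close> uses no inverses, so it can produce them: a
  right inverse h of g r, with r a root element, yields the right inverse r h of g.\<close>

lemma U_right_inverse:
  assumes "g \<in> carrier U" shows "\<exists>h\<in>carrier U. mmult F n g h = mone F n"
proof (rule pattern_induct[OF closed_positions, of g])
  show "\<exists>h\<in>carrier U. mmult F n (mone F n) h = mone F n"
    using mone_U by (intro bexI[of _ "mone F n"]) auto
  fix g k l t
  assume g: "g \<in> pattern positions" "(k, l) \<in> positions" "t \<in> carrier F"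
    and "\<exists>h\<in>carrier U. mmult F n (mmult F n g (root k l t)) h = mone F n"
  then obtain h where h: "h \<in> carrier U" "mmult F n (mmult F n g (root k l t)) h = mone F n"
    by blast
  have r: "root k l t \<in> carrier U" using g root_U by (auto simp: positions_def)
  thus "\<exists>h\<in>carrier U. mmult F n g h = mone F n"
    using h g(1) U_closed[OF r h(1)] mmult_assoc[of g "root k l t" h] by (auto simp: pattern_positions)
qed (use assms pattern_positions in auto)

lemma U_group: "group U"
proof (rule groupI)
  fix x assume x: "x \<in> carrier U"
  obtain y where y: "y \<in> carrier U" "mmult F n x y = mone F n" using U_right_inverse[OF x] by blast
  obtain z where z: "z \<in> carrier U" "mmult F n y z = mone F n" using U_right_inverse[OF y(1)] by blast
  have "x = mmult F n x (mmult F n y z)" using x z by simp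
  also have "\<dots> = mmult F n (mmult F n x y) z"
    using mmult_assoc[of x y z] x y(1) z(1) by simp
  also have "\<dots> = z" using y z by simp
  finally show "\<exists>y\<in>carrier U. y \<otimes>\<^bsub>U\<^esub> x = \<one>\<^bsub>U\<^esub>" using y z by auto
qed (auto simp: U_closed mone_U mmult_assoc)

sublocale U: group U
  rewrites "mult U = mmult F n" and "one U = mone F n"
  by (rule U_group) (simp_all add: fun_eq_iff)

lemma U_inv_mats [simp]: "u \<in> carrier U \<Longrightarrow> inv\<^bsub>U\<^esub> u \<in> mats F n"
  using U.inv_closed U_mats by blast

text \<open>Closure under inverses also comes from \<open>pattern_induct\<close>: for a root element
  r, the inverse of g is r times the inverse of g r. The entries of an inverse are never
  computed.\<close>

lemma pattern_subgroup:
  assumes P: "closed_pattern P" shows "subgroup (pattern P) U"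
proof (rule U.subgroupI)
  show "pattern P \<subseteq> carrier U" by (auto simp: pattern_U)
  show "pattern P \<noteq> {}" using pattern_one by blast
  show "inv\<^bsub>U\<^esub> g \<in> pattern P" if g: "g \<in> pattern P" for g
  proof (rule pattern_induct[OF P g])
    show "inv\<^bsub>U\<^esub> mone F n \<in> pattern P" using pattern_one U.inv_one by simp
    fix g k l t assume g: "g \<in> pattern P" "(k, l) \<in> P" "t \<in> carrier F"
      and inv: "inv\<^bsub>U\<^esub> mmult F n g (root k l t) \<in> pattern P"
    let ?r = "root k l t"
    have r: "?r \<in> pattern P" using pattern_root[OF P g(2,3)] .
    hence rg: "?r \<in> carrier U" "g \<in> carrier U" using g by (auto simp: pattern_U)
    have "inv\<^bsub>U\<^esub> g = mmult F n ?r (inv\<^bsub>U\<^esub> mmult F n g ?r)"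
      using rg by (simp add: U.inv_mult_group U.m_assoc[symmetric])
    thus "inv\<^bsub>U\<^esub> g \<in> pattern P" using pattern_closed[OF P r inv] by simp
  qed
  show "mmult F n g h \<in> pattern P" if "g \<in> pattern P" "h \<in> pattern P" for g h
    using pattern_closed[OF P that] .
qed

lemma pattern_bij:
  assumes "P \<subseteq> positions"
  shows "bij_betw (\<lambda>u. restrict (\<lambda>p. u $$ p) P) (pattern P) (P \<rightarrow>\<^sub>E carrier F)"
proof (rule bij_betw_byWitness[where
    f' = "\<lambda>f. mat n n (\<lambda>(i, j). if i = j then \<one> else if (i, j) \<in> P then f (i, j) else \<zero>)"])
  let ?m = "\<lambda>f. mat n n (\<lambda>(i, j). if i = j then \<one> else if (i, j) \<in> P then f (i, j) else \<zero>)"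
  have pos: "j < i \<and> i < n \<and> j < n" if "(i, j) \<in> P" for i j
    using assms that by (auto simp: positions_def)
  have mem: "?m f \<in> pattern P" if "f \<in> P \<rightarrow>\<^sub>E carrier F" for f
  proof -
    have "?m f \<in> carrier U"
      by (rule U_I, rule matsI) (use that in \<open>auto dest: pos\<close>)
    thus ?thesis by (simp add: pattern_def)
  qed
  have img: "restrict (\<lambda>p. u $$ p) P \<in> P \<rightarrow>\<^sub>E carrier F" if u: "u \<in> pattern P" for u
    using pattern_U[OF u] by (auto dest: pos)
  show "\<forall>u\<in>pattern P. ?m (restrict (\<lambda>p. u $$ p) P) = u"
  proof
    fix u assume u: "u \<in> pattern P"
    have uU: "u \<in> carrier U" using u by (rule pattern_U)
    show "?m (restrict (\<lambda>p. u $$ p) P) = u"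
    proof (rule mats_eqI)
      fix i j assume ij: "i < n" "j < n"
      have "u $$ (i, j) = \<zero>" if "i \<noteq> j" "(i, j) \<notin> P"
        using that u ij U_upper[OF uU, of i j]
        by (cases "i < j") (auto simp: pattern_def)
      thus "?m (restrict (\<lambda>p. u $$ p) P) $$ (i, j) = u $$ (i, j)"
        using ij U_diag[OF uU ij(1)] by (cases "i = j"; cases "(i, j) \<in> P") simp_all
    qed (rule U_mats[OF pattern_U[OF mem[OF img[OF u]]]], rule U_mats[OF uU])
  qed
  show "\<forall>f\<in>P \<rightarrow>\<^sub>E carrier F. restrict (\<lambda>p. ?m f $$ p) P = f"
  proof
    fix f assume f: "f \<in> P \<rightarrow>\<^sub>E carrier F"
    show "restrict (\<lambda>p. ?m f $$ p) P = f"
    proof (rule extensionalityI[of _ P])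
      fix p assume p: "p \<in> P"
      obtain i j where ij: "p = (i, j)" by (cases p)
      show "restrict (\<lambda>p. ?m f $$ p) P p = f p" using p pos[of i j] unfolding ij by simp
    qed (use f in \<open>simp_all add: PiE_def\<close>)
  qed
  show "(\<lambda>u. restrict (\<lambda>p. u $$ p) P) ` pattern P \<subseteq> P \<rightarrow>\<^sub>E carrier F" using img by blast
  show "?m ` (P \<rightarrow>\<^sub>E carrier F) \<subseteq> pattern P" using mem by blast
qed

lemma finite_positions: "finite positions"
  by (rule finite_subset[of _ "{..<n} \<times> {..<n}"]) (auto simp: positions_def)

lemma card_pattern:
  assumes "P \<subseteq> positions" shows "card (pattern P) = card (carrier F) ^ card P"
  using bij_betw_same_card[OF pattern_bij[OF assms]] finite_subset[OF assms finite_positions]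
  by (simp add: card_PiE)

lemma card_U: "card (carrier U) = card (carrier F) ^ card positions"
  using card_pattern[of positions] by (simp add: pattern_positions)

lemma finite_U: "finite (carrier F) \<Longrightarrow> finite (carrier U)"
  using bij_betw_finite[OF pattern_bij[of positions]] finite_positions
  by (simp add: pattern_positions finite_PiE)

end

section \<open>The action on strictly lower triangular matrices, its cocycle and its
  stabilizers\<close>

locale verge_action = unitriangular_group F n for F (structure) and n +
  fixes \<theta> :: "'a \<Rightarrow> complex"
  assumes finF: "finite (carrier F)" and theta: "nontrivial_additive_character F \<theta>"
begin

lemma theta_nonzero: "x \<in> carrier F \<Longrightarrow> \<theta> x \<noteq> 0"
  and theta_add: "x \<in> carrier F \<Longrightarrow> y \<in> carrier F \<Longrightarrow> \<theta> (x \<oplus> y) = \<theta> x * \<theta> y"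
  using theta by (auto simp: nontrivial_additive_character_def)

lemma theta_zero: "\<theta> \<zero> = 1"
  using theta_add[of \<zero> \<zero>] theta_nonzero[of \<zero>] by (simp only: zero_closed l_zero) auto

lemma theta_minus: "x \<in> carrier F \<Longrightarrow> \<theta> (\<ominus> x) = inverse (\<theta> x)"
  using theta_add[of x "\<ominus> x"] theta_zero r_neg[of x] by (metis a_inv_closed inverse_unique)

text \<open>If \<open>a\<close> and \<open>b\<close> differ, their difference is a unit and its
  multiples exhaust the field, so \<open>\<theta>\<close> would be trivial. Every passage from
  values of characters back to matrix entries goes through this.\<close>

lemma theta_eq_imp_eq:
  assumes ab: "a \<in> carrier F" "b \<in> carrier F"
    and eq: "\<And>t. t \<in> carrier F \<Longrightarrow> \<theta> (a \<otimes> t) = \<theta> (b \<otimes> t)"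
  shows "a = b"
proof (rule ccontr)
  assume "a \<noteq> b"
  have "a = (a \<ominus> b) \<oplus> b" using ab by algebra
  hence d: "a \<ominus> b \<in> carrier F" "a \<ominus> b \<noteq> \<zero>" using ab \<open>a \<noteq> b\<close> by auto
  obtain x where x: "x \<in> carrier F" "\<theta> x \<noteq> 1"
    using theta by (auto simp: nontrivial_additive_character_def)
  define t where "t = inv (a \<ominus> b) \<otimes> x"
  have du: "a \<ominus> b \<in> Units F" using d field_Units by blast
  have t: "t \<in> carrier F" using du x by (simp add: t_def)
  have "x = (a \<ominus> b) \<otimes> t"
    using du x d by (simp add: t_def m_assoc[symmetric] Units_r_inv)
  also have "\<dots> = a \<otimes> t \<oplus> \<ominus> (b \<otimes> t)" using ab t by (simp add: minus_eq l_distr l_minus)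
  finally have "\<theta> x = \<theta> (a \<otimes> t) * inverse (\<theta> (b \<otimes> t))"
    using ab t by (simp add: theta_add theta_minus)
  thus False using x(2) eq[OF t] theta_nonzero[of "b \<otimes> t"] ab t by simp
qed

lemma V_mats [simp]: "A \<in> V \<Longrightarrow> A \<in> mats F n"
  and V_upper [simp]: "A \<in> V \<Longrightarrow> i \<le> j \<Longrightarrow> j < n \<Longrightarrow> A $$ (i, j) = \<zero>"
  unfolding strict_lower_def by simp_all

lemma V_I:
  "A \<in> mats F n \<Longrightarrow> (\<And>i j. i \<le> j \<Longrightarrow> j < n \<Longrightarrow> A $$ (i, j) = \<zero>) \<Longrightarrow> A \<in> V"
  unfolding strict_lower_def by simp

lemma finite_V: "finite V"
proof (rule finite_subset)
  let ?m = "\<lambda>f. mat n n f"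
  show "V \<subseteq> ?m ` (({..<n} \<times> {..<n}) \<rightarrow>\<^sub>E carrier F)"
  proof
    fix A assume A: "A \<in> V"
    have "A = ?m (restrict (\<lambda>p. A $$ p) ({..<n} \<times> {..<n}))"
      using mats_dim[OF V_mats[OF A]] by (intro eq_matI) simp_all
    moreover have "restrict (\<lambda>p. A $$ p) ({..<n} \<times> {..<n}) \<in> ({..<n} \<times> {..<n}) \<rightarrow>\<^sub>E carrier F"
      using V_mats[OF A] by auto
    ultimately show "A \<in> ?m ` (({..<n} \<times> {..<n}) \<rightarrow>\<^sub>E carrier F)" by (rule image_eqI)
  qed
qed (use finF in \<open>simp add: finite_PiE\<close>)

text \<open>This is \<open>dot_act\<close> freed of the inverse, hence a left action. Its entries
  are expressed directly in those of \<open>u\<close>, and fixing a matrix means the same for both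
  actions.\<close>

definition tact :: "'a mat \<Rightarrow> 'a mat \<Rightarrow> 'a mat" where
  "tact A u = strict_lower_part F n (mmult F n A (transpose_mat u))"

lemma dot_act_tact: "dot_act F n A u = tact A (inv\<^bsub>U\<^esub> u)"
  by (simp add: dot_act_def tact_def)

lemma tact_entry:
  assumes "A \<in> mats F n" "u \<in> mats F n" "i < n" "j < n"
  shows "tact A u $$ (i, j) = (if j < i then (\<Oplus>k\<in>{..<n}. A $$ (i, k) \<otimes> u $$ (j, k)) else \<zero>)"
proof -
  have "transpose_mat u $$ (k, j) = u $$ (j, k)" if "k < n" for k
    using mats_dim[OF assms(2)] assms(4) that by simp
  hence "mmult F n A (transpose_mat u) $$ (i, j) = (\<Oplus>k\<in>{..<n}. A $$ (i, k) \<otimes> u $$ (j, k))"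
    unfolding mmult_entry[OF assms(3,4)] using assms by (intro finsum_cong') auto
  thus ?thesis using assms by (simp add: tact_def strict_lower_part_def)
qed

lemma tact_closed:
  assumes "A \<in> mats F n" "u \<in> mats F n" shows "tact A u \<in> V"
proof (rule V_I, rule matsI)
  show "tact A u $$ (i, j) \<in> carrier F" if "i < n" "j < n" for i j
    using assms that by (auto simp: tact_entry intro!: finsum_closed)
  show "tact A u $$ (i, j) = \<zero>" if "i \<le> j" "j < n" for i j
    using assms that by (simp add: tact_entry)
qed (simp_all add: tact_def strict_lower_part_def)

lemma V_eqI:
  assumes "A \<in> V" "B \<in> V" "\<And>i j. j < i \<Longrightarrow> i < n \<Longrightarrow> A $$ (i, j) = B $$ (i, j)"
  shows "A = B"
proof (rule mats_eqI)
  fix i j assume "i < n" "j < n"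
  thus "A $$ (i, j) = B $$ (i, j)" using assms by (cases "j < i") simp_all
qed (use assms in simp_all)

lemma tact_mult:
  assumes A: "A \<in> mats F n" and u: "u \<in> carrier U" and v: "v \<in> carrier U"
  shows "tact A (mmult F n u v) = tact (tact A v) u"
proof (rule V_eqI)
  have uv: "mmult F n u v \<in> mats F n" using u v by simp
  have tV: "tact A v \<in> V" using A v by (simp add: tact_closed)
  show "tact A (mmult F n u v) \<in> V" "tact (tact A v) u \<in> V"
    using A uv tV u by (simp_all add: tact_closed)
  fix i j assume ij: "j < i" "i < n"
  hence jn: "j < n" by simp
  have "tact A (mmult F n u v) $$ (i, j) = (\<Oplus>k\<in>{..<n}. A $$ (i, k) \<otimes> mmult F n u v $$ (j, k))"
    using A ij uv jn by (simp add: tact_entry)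
  also have "\<dots> = (\<Oplus>k\<in>{..<n}. \<Oplus>l\<in>{..<n}. A $$ (i, k) \<otimes> (u $$ (j, l) \<otimes> v $$ (l, k)))"
  proof (rule finsum_cong')
    fix k assume "k \<in> {..<n}"
    hence k: "k < n" by simp
    show "A $$ (i, k) \<otimes> mmult F n u v $$ (j, k) =
        (\<Oplus>l\<in>{..<n}. A $$ (i, k) \<otimes> (u $$ (j, l) \<otimes> v $$ (l, k)))"
      unfolding mmult_entry[OF jn k] by (rule finsum_rdistr) (use A u v ij jn k in auto)
  qed (use A u v ij jn in \<open>auto intro!: finsum_closed\<close>)
  also have "\<dots> = (\<Oplus>l\<in>{..<n}. \<Oplus>k\<in>{..<n}. A $$ (i, k) \<otimes> (u $$ (j, l) \<otimes> v $$ (l, k)))"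
    by (rule finsum_swap) (use A u v ij jn in auto)
  also have "\<dots> = (\<Oplus>l\<in>{..<n}. tact A v $$ (i, l) \<otimes> u $$ (j, l))"
  proof (rule finsum_cong')
    fix l assume "l \<in> {..<n}"
    hence l: "l < n" by simp
    have "(\<Oplus>k\<in>{..<n}. A $$ (i, k) \<otimes> (u $$ (j, l) \<otimes> v $$ (l, k))) =
        (\<Oplus>k\<in>{..<n}. A $$ (i, k) \<otimes> v $$ (l, k) \<otimes> u $$ (j, l))"
      by (rule finsum_cong') (use A u v ij jn l in \<open>auto simp: m_ac\<close>)
    also have "\<dots> = (\<Oplus>k\<in>{..<n}. A $$ (i, k) \<otimes> v $$ (l, k)) \<otimes> u $$ (j, l)"
      by (rule finsum_ldistr[symmetric]) (use A u v ij jn l in auto)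
    also have "\<dots> = tact A v $$ (i, l) \<otimes> u $$ (j, l)"
    \<comment> \<open>The truncation of the inner matrix does no harm: an entry (i,l) discarded
      because i is at most l would be multiplied by the entry (j,l) of \<open>u\<close>, which is
      zero since j < i.\<close>
    proof (cases "l < i")
      case True
      thus ?thesis using A v l ij by (simp add: tact_entry)
    next
      case False
      have "(\<Oplus>k\<in>{..<n}. A $$ (i, k) \<otimes> v $$ (l, k)) \<in> carrier F"
        using A v ij l by (auto intro!: finsum_closed)
      thus ?thesis using A v u l ij False by (simp add: tact_entry)
    qed
    finally show "(\<Oplus>k\<in>{..<n}. A $$ (i, k) \<otimes> (u $$ (j, l) \<otimes> v $$ (l, k))) =
        tact A v $$ (i, l) \<otimes> u $$ (j, l)" .
  qed (use V_mats[OF tV] u ij jn in auto)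
  also have "\<dots> = tact (tact A v) u $$ (i, j)"
    using V_mats[OF tV] u ij jn by (simp add: tact_entry)
  finally show "tact A (mmult F n u v) $$ (i, j) = tact (tact A v) u $$ (i, j)" .
qed

lemma tact_one: "A \<in> V \<Longrightarrow> tact A (mone F n) = A"
proof (rule V_eqI)
  fix i j assume A: "A \<in> V" and ij: "j < i" "i < n"
  have "(\<Oplus>k\<in>{..<n}. A $$ (i, k) \<otimes> mone F n $$ (j, k)) = A $$ (i, j) \<otimes> mone F n $$ (j, j)"
    by (rule finsum_single) (use A ij in \<open>auto simp: mone_entry\<close>)
  thus "tact A (mone F n) $$ (i, j) = A $$ (i, j)" using A ij by (simp add: tact_entry mone_entry)
qed (simp_all add: tact_closed)

lemma dot_act_V: "A \<in> V \<Longrightarrow> u \<in> carrier U \<Longrightarrow> dot_act F n A u \<in> V"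
  by (simp add: dot_act_tact tact_closed)

lemma dot_act_one: "A \<in> V \<Longrightarrow> dot_act F n A (mone F n) = A"
  using U.inv_one by (simp add: dot_act_tact tact_one)

lemma dot_act_mult:
  assumes "A \<in> V" "u \<in> carrier U" "v \<in> carrier U"
  shows "dot_act F n A (mmult F n u v) = dot_act F n (dot_act F n A u) v"
  using assms by (simp add: dot_act_tact U.inv_mult_group tact_mult)

lemma dot_act_inv:
  assumes "A \<in> V" "u \<in> carrier U"
  shows "dot_act F n (dot_act F n A u) (inv\<^bsub>U\<^esub> u) = A"
  using assms by (simp add: dot_act_mult[symmetric] dot_act_one)

definition bil :: "'a mat \<Rightarrow> 'a mat \<Rightarrow> 'a" where
  "bil A X = (\<Oplus>i\<in>{..<n}. \<Oplus>j\<in>{..<n}. A $$ (i, j) \<otimes> X $$ (i, j))"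

lemma chi_bil: "chi F n \<theta> A X = \<theta> (bil A X)"
  by (simp add: chi_def bil_def)

lemma bil_closed [simp]: "A \<in> mats F n \<Longrightarrow> X \<in> mats F n \<Longrightarrow> bil A X \<in> carrier F"
  unfolding bil_def by (intro finsum_closed funcsetI) (auto intro!: finsum_closed)

lemma bil_cong:
  assumes "A \<in> mats F n" "X \<in> mats F n"
    "\<And>i j. i < n \<Longrightarrow> j < n \<Longrightarrow> B $$ (i, j) \<otimes> Y $$ (i, j) = A $$ (i, j) \<otimes> X $$ (i, j)"
  shows "bil B Y = bil A X"
  unfolding bil_def
proof (rule finsum_cong')
  fix i assume "i \<in> {..<n}"
  thus "(\<Oplus>j\<in>{..<n}. B $$ (i, j) \<otimes> Y $$ (i, j)) = (\<Oplus>j\<in>{..<n}. A $$ (i, j) \<otimes> X $$ (i, j))"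
    using assms by (intro finsum_cong') auto
qed (use assms in \<open>auto intro!: finsum_closed\<close>)

lemma bil_add:
  assumes A: "A \<in> mats F n" and Y: "Y \<in> mats F n" and Z: "Z \<in> mats F n"
    and X: "\<And>i j. i < n \<Longrightarrow> j < n \<Longrightarrow> A $$ (i, j) \<otimes> X $$ (i, j) =
      A $$ (i, j) \<otimes> Y $$ (i, j) \<oplus> A $$ (i, j) \<otimes> Z $$ (i, j)"
  shows "bil A X = bil A Y \<oplus> bil A Z"
proof -
  have "bil A X = (\<Oplus>i\<in>{..<n}. (\<Oplus>j\<in>{..<n}. A $$ (i, j) \<otimes> Y $$ (i, j)) \<oplus>
      (\<Oplus>j\<in>{..<n}. A $$ (i, j) \<otimes> Z $$ (i, j)))"
    unfolding bil_def
  proof (rule finsum_cong')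
    fix i assume "i \<in> {..<n}"
    hence i: "i < n" by simp
    have "(\<Oplus>j\<in>{..<n}. A $$ (i, j) \<otimes> X $$ (i, j)) =
        (\<Oplus>j\<in>{..<n}. A $$ (i, j) \<otimes> Y $$ (i, j) \<oplus> A $$ (i, j) \<otimes> Z $$ (i, j))"
      by (rule finsum_cong') (use A Y Z X i in auto)
    also have "\<dots> = (\<Oplus>j\<in>{..<n}. A $$ (i, j) \<otimes> Y $$ (i, j)) \<oplus>
        (\<Oplus>j\<in>{..<n}. A $$ (i, j) \<otimes> Z $$ (i, j))"
      by (rule finsum_addf) (use A Y Z i in auto)
    finally show "(\<Oplus>j\<in>{..<n}. A $$ (i, j) \<otimes> X $$ (i, j)) =
        (\<Oplus>j\<in>{..<n}. A $$ (i, j) \<otimes> Y $$ (i, j)) \<oplus> (\<Oplus>j\<in>{..<n}. A $$ (i, j) \<otimes> Z $$ (i, j))" .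
  qed (use A Y Z in \<open>auto intro!: finsum_closed a_closed\<close>)
  also have "\<dots> = bil A Y \<oplus> bil A Z"
    unfolding bil_def by (rule finsum_addf) (use A Y Z in \<open>auto intro!: finsum_closed\<close>)
  finally show ?thesis .
qed

text \<open>Adjointness of multiplication by the transpose of \<open>u\<close> on one argument and
  by \<open>u\<close> on the other. The entries removed by truncation would only meet zeros, as
  \<open>X\<close> is strictly lower triangular.\<close>

lemma bil_tact:
  assumes A: "A \<in> mats F n" and X: "X \<in> V" and u: "u \<in> carrier U"
  shows "bil (tact A u) X = bil A (mmult F n X u)"
proof -
  have "bil (tact A u) X = (\<Oplus>i\<in>{..<n}. \<Oplus>k\<in>{..<n}. A $$ (i, k) \<otimes> mmult F n X u $$ (i, k))"
    unfolding bil_def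
  proof (rule finsum_cong')
    fix i assume "i \<in> {..<n}"
    hence i: "i < n" by simp
    have "(\<Oplus>j\<in>{..<n}. tact A u $$ (i, j) \<otimes> X $$ (i, j)) =
        (\<Oplus>j\<in>{..<n}. \<Oplus>k\<in>{..<n}. A $$ (i, k) \<otimes> u $$ (j, k) \<otimes> X $$ (i, j))"
    proof (rule finsum_cong')
      fix j assume "j \<in> {..<n}"
      hence j: "j < n" by simp
      have "tact A u $$ (i, j) \<otimes> X $$ (i, j) =
          (\<Oplus>k\<in>{..<n}. A $$ (i, k) \<otimes> u $$ (j, k)) \<otimes> X $$ (i, j)"
      proof (cases "j < i")
        case True
        thus ?thesis using A u i j by (simp add: tact_entry)
      next
        case False
        have "(\<Oplus>k\<in>{..<n}. A $$ (i, k) \<otimes> u $$ (j, k)) \<in> carrier F"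
          using A u i j by (auto intro!: finsum_closed)
        thus ?thesis using A False X u i j by (simp add: tact_entry)
      qed
      also have "\<dots> = (\<Oplus>k\<in>{..<n}. A $$ (i, k) \<otimes> u $$ (j, k) \<otimes> X $$ (i, j))"
        by (rule finsum_ldistr) (use A u X i j in auto)
      finally show "tact A u $$ (i, j) \<otimes> X $$ (i, j) =
        (\<Oplus>k\<in>{..<n}. A $$ (i, k) \<otimes> u $$ (j, k) \<otimes> X $$ (i, j))" .
    qed (use A u X i in \<open>auto intro!: finsum_closed\<close>)
    also have "\<dots> = (\<Oplus>k\<in>{..<n}. \<Oplus>j\<in>{..<n}. A $$ (i, k) \<otimes> u $$ (j, k) \<otimes> X $$ (i, j))"
      by (rule finsum_swap) (use A u X i in auto)
    also have "\<dots> = (\<Oplus>k\<in>{..<n}. A $$ (i, k) \<otimes> mmult F n X u $$ (i, k))"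
    proof (rule finsum_cong')
      fix k assume "k \<in> {..<n}"
      hence k: "k < n" by simp
      have "(\<Oplus>j\<in>{..<n}. A $$ (i, k) \<otimes> u $$ (j, k) \<otimes> X $$ (i, j)) =
          (\<Oplus>j\<in>{..<n}. A $$ (i, k) \<otimes> (X $$ (i, j) \<otimes> u $$ (j, k)))"
        by (rule finsum_cong') (use A u X i k in \<open>auto simp: m_ac\<close>)
      also have "\<dots> = A $$ (i, k) \<otimes> mmult F n X u $$ (i, k)"
        unfolding mmult_entry[OF i k]
        by (rule finsum_rdistr[symmetric]) (use A u X i k in auto)
      finally show "(\<Oplus>j\<in>{..<n}. A $$ (i, k) \<otimes> u $$ (j, k) \<otimes> X $$ (i, j)) =
        A $$ (i, k) \<otimes> mmult F n X u $$ (i, k)" .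
    qed (use mmult_mats[of X u] A u X i in auto)
    finally show "(\<Oplus>j\<in>{..<n}. tact A u $$ (i, j) \<otimes> X $$ (i, j)) =
      (\<Oplus>k\<in>{..<n}. A $$ (i, k) \<otimes> mmult F n X u $$ (i, k))" .
  qed (use mmult_mats[of X u] A u X in \<open>auto intro!: finsum_closed\<close>)
  thus ?thesis by (simp add: bil_def)
qed

definition cocycle :: "'a mat \<Rightarrow> 'a mat \<Rightarrow> complex" where
  "cocycle A u = chi F n \<theta> A (mminus F n (mone F n) (inv\<^bsub>U\<^esub> u))"

lemma one_minus_entry:
  "i < n \<Longrightarrow> j < n \<Longrightarrow> mminus F n (mone F n) u $$ (i, j) = mone F n $$ (i, j) \<ominus> u $$ (i, j)"
  by (simp add: mminus_def)

lemma one_minus_V: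
  assumes "u \<in> carrier U" shows "mminus F n (mone F n) u \<in> V"
proof (rule V_I, rule matsI)
  show "mminus F n (mone F n) u $$ (i, j) \<in> carrier F" if "i < n" "j < n" for i j
    using that assms by (simp add: one_minus_entry mone_entry)
  show "mminus F n (mone F n) u $$ (i, j) = \<zero>" if "i \<le> j" "j < n" for i j
    using that assms by (cases "i = j") (simp_all add: one_minus_entry mone_entry minus_eq r_neg)
qed (simp_all add: mminus_def)

lemma cocycle_nonzero: "A \<in> V \<Longrightarrow> u \<in> carrier U \<Longrightarrow> cocycle A u \<noteq> 0"
  using one_minus_V[of "inv\<^bsub>U\<^esub> u"] by (simp add: cocycle_def chi_bil theta_nonzero)

text \<open>With g and h the inverses of \<open>v\<close> and \<open>u\<close>, use 1 - g h = (1 -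
  h) + (1 - g) h. Adjointness moves the last factor h onto \<open>A\<close>, which becomes
  \<open>dot_act F n A u\<close>. On the stabilizer of \<open>A\<close> this cocycle identity says
  that \<open>cocycle A\<close> is a linear character.\<close>

lemma cocycle_mult:
  assumes A: "A \<in> V" and u: "u \<in> carrier U" and v: "v \<in> carrier U"
  shows "cocycle A (mmult F n u v) = cocycle A u * cocycle (dot_act F n A u) v"
proof -
  let ?g = "inv\<^bsub>U\<^esub> v" and ?h = "inv\<^bsub>U\<^esub> u"
  have gh: "?g \<in> carrier U" "?h \<in> carrier U" using u v by simp_all
  note m = one_minus_V[OF gh(1), THEN V_mats] one_minus_V[OF gh(2), THEN V_mats]
  have "bil A (mminus F n (mone F n) (mmult F n ?g ?h)) =
      bil A (mminus F n (mone F n) ?h) \<oplus> bil A (mmult F n (mminus F n (mone F n) ?g) ?h)"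
  proof (rule bil_add)
    show "mmult F n (mminus F n (mone F n) ?g) ?h \<in> mats F n" using m gh by simp
    fix i j assume ij: "i < n" "j < n"
    have "mmult F n (mminus F n (mone F n) ?g) ?h $$ (i, j) =
        (\<Oplus>k\<in>{..<n}. mone F n $$ (i, k) \<otimes> ?h $$ (k, j) \<oplus> (\<ominus> ?g $$ (i, k)) \<otimes> ?h $$ (k, j))"
      unfolding mmult_entry[OF ij]
      by (rule finsum_cong')
        (use gh ij mone_mats in \<open>auto simp: one_minus_entry minus_eq l_distr\<close>)
    also have "\<dots> = (\<Oplus>k\<in>{..<n}. mone F n $$ (i, k) \<otimes> ?h $$ (k, j)) \<oplus>
        (\<Oplus>k\<in>{..<n}. (\<ominus> ?g $$ (i, k)) \<otimes> ?h $$ (k, j))"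
      by (rule finsum_addf) (use gh ij mone_mats in auto)
    also have "(\<Oplus>k\<in>{..<n}. mone F n $$ (i, k) \<otimes> ?h $$ (k, j)) = ?h $$ (i, j)"
      using mmult_entry[OF ij, of "mone F n" ?h] gh by simp
    also have "(\<Oplus>k\<in>{..<n}. (\<ominus> ?g $$ (i, k)) \<otimes> ?h $$ (k, j)) =
        (\<Oplus>k\<in>{..<n}. (\<ominus> \<one>) \<otimes> (?g $$ (i, k) \<otimes> ?h $$ (k, j)))"
      by (rule finsum_cong') (use gh ij in \<open>auto simp: l_minus\<close>)
    also have "\<dots> = (\<ominus> \<one>) \<otimes> mmult F n ?g ?h $$ (i, j)"
      unfolding mmult_entry[OF ij] by (rule finsum_rdistr[symmetric]) (use gh ij in auto)
    also have "\<dots> = \<ominus> (mmult F n ?g ?h $$ (i, j))"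
      using mmult_mats[of ?g ?h] gh ij by (simp add: l_minus)
    finally have e: "mmult F n (mminus F n (mone F n) ?g) ?h $$ (i, j) =
        ?h $$ (i, j) \<oplus> \<ominus> (mmult F n ?g ?h $$ (i, j))" .
    have c: "A $$ (i, j) \<in> carrier F" "?h $$ (i, j) \<in> carrier F" "mone F n $$ (i, j) \<in> carrier F"
      "mmult F n ?g ?h $$ (i, j) \<in> carrier F"
      using A gh ij mone_mats mmult_mats[of ?g ?h] by auto
    have "mone F n $$ (i, j) \<ominus> mmult F n ?g ?h $$ (i, j) =
        (mone F n $$ (i, j) \<ominus> ?h $$ (i, j)) \<oplus> (?h $$ (i, j) \<oplus> \<ominus> (mmult F n ?g ?h $$ (i, j)))"
      using c by algebra
    thus "A $$ (i, j) \<otimes> mminus F n (mone F n) (mmult F n ?g ?h) $$ (i, j) =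
        A $$ (i, j) \<otimes> mminus F n (mone F n) ?h $$ (i, j) \<oplus>
        A $$ (i, j) \<otimes> mmult F n (mminus F n (mone F n) ?g) ?h $$ (i, j)"
      using c ij unfolding e by (simp add: one_minus_entry r_distr)
  qed (use A m in simp_all)
  also have "bil A (mmult F n (mminus F n (mone F n) ?g) ?h) =
      bil (dot_act F n A u) (mminus F n (mone F n) ?g)"
    using A gh one_minus_V[OF gh(1)] by (simp add: bil_tact dot_act_tact)
  finally show ?thesis
    using A u v m gh dot_act_V[OF A u]
    by (simp add: cocycle_def chi_bil U.inv_mult_group theta_add)
qed

lemma bil_one: "A \<in> V \<Longrightarrow> bil A (mone F n) = \<zero>"
proof -
  assume A: "A \<in> V"
  have "(\<Oplus>j\<in>{..<n}. A $$ (i, j) \<otimes> mone F n $$ (i, j)) = \<zero>" if "i < n" for i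
  proof -
    have "(\<Oplus>j\<in>{..<n}. A $$ (i, j) \<otimes> mone F n $$ (i, j)) = A $$ (i, i) \<otimes> mone F n $$ (i, i)"
      by (rule finsum_single) (use A that in \<open>auto simp: mone_entry\<close>)
    thus ?thesis using A that by (simp add: mone_entry)
  qed
  hence "bil A (mone F n) = (\<Oplus>i\<in>{..<n}. \<zero>)" unfolding bil_def by (intro finsum_cong') auto
  thus ?thesis by simp
qed

lemma cocycle_one: "A \<in> V \<Longrightarrow> cocycle A (mone F n) = 1"
  using cocycle_mult[of A "mone F n" "mone F n"] cocycle_nonzero[of A "mone F n"] mone_U
  by (simp add: dot_act_one)

definition stab :: "'a mat \<Rightarrow> 'a mat set" where
  "stab A = {u \<in> carrier U. dot_act F n A u = A}"

lemma stab_U: "u \<in> stab A \<Longrightarrow> u \<in> carrier U"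
  by (simp add: stab_def)

lemma stab_subgroup:
  assumes "A \<in> V" shows "subgroup (stab A) U"
proof (rule U.subgroupI)
  show "stab A \<noteq> {}" using assms mone_U dot_act_one by (auto simp: stab_def)
  show "inv\<^bsub>U\<^esub> u \<in> stab A" if "u \<in> stab A" for u
    using that assms dot_act_inv[of A u] by (simp add: stab_def)
qed (use assms in \<open>auto simp: stab_def dot_act_mult U_closed\<close>)

lemma stab_linear: "A \<in> V \<Longrightarrow> linear_char U (stab A) (cocycle A)"
  by (auto simp: linear_char_def stab_def cocycle_mult cocycle_nonzero)

text \<open>The usual relation between stabilizers of points in one orbit; in the cocycle identity
  for \<open>k h inv k\<close> the contributions of \<open>k\<close> and of its inverse
  cancel.\<close>

lemma stab_conj:
  assumes A: "A \<in> V" and k: "k \<in> carrier U" and h: "h \<in> stab (dot_act F n A k)"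
  shows "mmult F n (mmult F n k h) (inv\<^bsub>U\<^esub> k) \<in> stab A"
    and "cocycle A (mmult F n (mmult F n k h) (inv\<^bsub>U\<^esub> k)) = cocycle (dot_act F n A k) h"
proof -
  have hU: "h \<in> carrier U" and hs: "dot_act F n (dot_act F n A k) h = dot_act F n A k"
    using h by (auto simp: stab_def)
  have khU: "mmult F n k h \<in> carrier U" using k hU by (rule U_closed)
  have kh: "dot_act F n A (mmult F n k h) = dot_act F n A k" using A k hU hs by (simp add: dot_act_mult)
  show "mmult F n (mmult F n k h) (inv\<^bsub>U\<^esub> k) \<in> stab A"
    using A k khU kh by (simp add: stab_def U_closed dot_act_mult dot_act_inv)
  have "cocycle A (mmult F n k (inv\<^bsub>U\<^esub> k)) = 1" using A k by (simp add: cocycle_one)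
  hence "cocycle A k * cocycle (dot_act F n A k) (inv\<^bsub>U\<^esub> k) = 1"
    using A k by (simp only: cocycle_mult U.inv_closed)
  thus "cocycle A (mmult F n (mmult F n k h) (inv\<^bsub>U\<^esub> k)) = cocycle (dot_act F n A k) h"
    using A k hU khU kh by (simp add: cocycle_mult)
qed

lemma tact_fixed_stab:
  assumes "A \<in> V" "u \<in> carrier U" "tact A u = A" shows "u \<in> stab A"
proof -
  have "inv\<^bsub>U\<^esub> u \<in> stab A" using assms by (simp add: stab_def dot_act_tact)
  hence "inv\<^bsub>U\<^esub> (inv\<^bsub>U\<^esub> u) \<in> stab A" by (rule subgroup.m_inv_closed[OF stab_subgroup[OF assms(1)]])
  thus ?thesis using assms by simp
qed

lemma stab_iff_tact: "A \<in> V \<Longrightarrow> u \<in> stab A \<longleftrightarrow> u \<in> carrier U \<and> tact A u = A"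
proof
  assume A: "A \<in> V" and u: "u \<in> stab A"
  have "inv\<^bsub>U\<^esub> u \<in> stab A" by (rule subgroup.m_inv_closed[OF stab_subgroup[OF A] u])
  thus "u \<in> carrier U \<and> tact A u = A" using u by (simp add: stab_def dot_act_tact)
qed (use tact_fixed_stab in blast)

text \<open>At the inverse of \<open>u\<close> the cocycle is \<open>\<theta>\<close> of the pairing
  of \<open>A\<close> with 1 - u, that is the inverse of \<open>\<theta> (bil A u)\<close>, because
  \<open>A\<close> has zero diagonal. Multiplicativity on the stabilizer removes the inverse on both
  sides, so the character can be read off the entries of \<open>u\<close> itself.\<close>

lemma cocycle_stab:
  assumes A: "A \<in> V" and u: "u \<in> stab A" shows "cocycle A u = \<theta> (bil A u)"
proof -
  have uU: "u \<in> carrier U" and us: "inv\<^bsub>U\<^esub> u \<in> stab A"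
    using u subgroup.m_inv_closed[OF stab_subgroup[OF A] u] by (auto simp: stab_def)
  have mU: "mminus F n (mone F n) u \<in> mats F n" using one_minus_V[OF uU] by simp
  have "cocycle A (mmult F n u (inv\<^bsub>U\<^esub> u)) = cocycle A u * cocycle A (inv\<^bsub>U\<^esub> u)"
    using u uU A by (simp only: cocycle_mult U.inv_closed) (simp add: stab_def)
  hence 1: "cocycle A u * cocycle A (inv\<^bsub>U\<^esub> u) = 1" using uU A by (simp add: cocycle_one)
  have "bil A (mone F n) = bil A (mminus F n (mone F n) u) \<oplus> bil A u"
  proof (rule bil_add)
    fix i j assume ij: "i < n" "j < n"
    have c: "A $$ (i, j) \<in> carrier F" "u $$ (i, j) \<in> carrier F" "mone F n $$ (i, j) \<in> carrier F"
      using A uU ij mone_mats by auto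
    have "mone F n $$ (i, j) = (mone F n $$ (i, j) \<ominus> u $$ (i, j)) \<oplus> u $$ (i, j)"
      using c by algebra
    thus "A $$ (i, j) \<otimes> mone F n $$ (i, j) =
        A $$ (i, j) \<otimes> mminus F n (mone F n) u $$ (i, j) \<oplus> A $$ (i, j) \<otimes> u $$ (i, j)"
      using c ij by (metis one_minus_entry r_distr minus_closed)
  qed (use A uU mU in simp_all)
  hence "\<theta> (bil A (mminus F n (mone F n) u)) * \<theta> (bil A u) = 1"
    using A uU mU theta_add[of "bil A (mminus F n (mone F n) u)" "bil A u"] theta_zero
    by (simp add: bil_one)
  hence "cocycle A (inv\<^bsub>U\<^esub> u) * \<theta> (bil A u) = 1" using uU by (simp add: cocycle_def chi_bil)
  thus ?thesis using 1 by (metis mult.commute mult.left_commute mult.right_neutral)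
qed

text \<open>A root element at (k,l) acts on \<open>A\<close> by adding \<open>t\<close> times column
  l to column k, and truncation keeps only the rows below k of that change.\<close>

lemma tact_root_fixed:
  assumes A: "A \<in> V" and kl: "l < k" "k < n" and t: "t \<in> carrier F"
    and zero: "\<And>i. k < i \<Longrightarrow> i < n \<Longrightarrow> A $$ (i, l) = \<zero>"
  shows "root k l t \<in> stab A"
proof (rule tact_fixed_stab[OF A])
  show r: "root k l t \<in> carrier U" using kl t by (rule root_U)
  show "tact A (root k l t) = A"
  proof (rule V_eqI)
    show "tact A (root k l t) \<in> V" using A r by (simp add: tact_closed)
    fix i m assume im: "m < i" "i < n"
    have "(\<Oplus>p\<in>{..<n}. A $$ (i, p) \<otimes> root k l t $$ (m, p)) = A $$ (i, m) \<otimes> root k l t $$ (m, m)"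
    proof (rule finsum_single)
      fix p assume p: "p \<in> {..<n}" "p \<noteq> m"
      show "A $$ (i, p) \<otimes> root k l t $$ (m, p) = \<zero>"
        using p A im t zero[of i] by (auto simp: root_entry)
    qed (use A im r in auto)
    thus "tact A (root k l t) $$ (i, m) = A $$ (i, m)"
      using im A r by (simp add: tact_entry)
  qed (fact A)
qed

lemma bil_root:
  assumes A: "A \<in> V" and kl: "l < k" "k < n" and t: "t \<in> carrier F"
  shows "bil A (root k l t) = A $$ (k, l) \<otimes> t"
proof -
  have r: "root k l t \<in> mats F n" using root_U[OF kl t] by simp
  have row: "(\<Oplus>j\<in>{..<n}. A $$ (i, j) \<otimes> root k l t $$ (i, j)) = A $$ (i, l) \<otimes> root k l t $$ (i, l)"
    if "i < n" for i
    by (rule finsum_single) (use A kl t that in \<open>auto simp: root_entry\<close>)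
  have "bil A (root k l t) = (\<Oplus>i\<in>{..<n}. A $$ (i, l) \<otimes> root k l t $$ (i, l))"
    unfolding bil_def by (rule finsum_cong') (use row A r kl in auto)
  also have "\<dots> = A $$ (k, l) \<otimes> root k l t $$ (k, l)"
    by (rule finsum_single) (use A kl t in \<open>auto simp: root_entry\<close>)
  finally show ?thesis using kl by (simp add: root_entry)
qed

end

section \<open>The combinatorics of main conditions\<close>

text \<open>The vertical arms of the hooks, without their centers. Row i of a verge is a multiple of
  one unit vector, so a main condition (i,j) meets \<open>u\<close> only in column j; the legs are
  the entries of that column whose effect in row i is off the main condition and below the
  diagonal.\<close>

definition legs :: "(nat \<times> nat) set \<Rightarrow> (nat \<times> nat) set" where
  "legs D = {(k, j). \<exists>i. (i, j) \<in> D \<and> j < k \<and> k < i}"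

text \<open>The crossing \<open>(s, j)\<close> stands for the hook intersection \<open>(i, s)\<close>, where \<open>i\<close> is the row of the
  main condition in column \<open>j\<close>.\<close>

definition crossings :: "(nat \<times> nat) set \<Rightarrow> (nat \<times> nat) set" where
  "crossings D = {(s, j). \<exists>i r. (i, j) \<in> D \<and> (r, s) \<in> D \<and> j < s \<and> s < i \<and> i < r}"

definition rook_placement :: "nat \<Rightarrow> (nat \<times> nat) set \<Rightarrow> bool" where
  "rook_placement n D \<longleftrightarrow> D \<subseteq> {(i, j). j < i \<and> i < n} \<and>
     (\<forall>i j k. (i, j) \<in> D \<and> (i, k) \<in> D \<longrightarrow> j = k) \<and>
     (\<forall>i k j. (i, j) \<in> D \<and> (k, j) \<in> D \<longrightarrow> i = k)"

lemma rook_row: "rook_placement n D \<Longrightarrow> (i, j) \<in> D \<Longrightarrow> (i, k) \<in> D \<Longrightarrow> j = k"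
  and rook_col: "rook_placement n D \<Longrightarrow> (i, j) \<in> D \<Longrightarrow> (k, j) \<in> D \<Longrightarrow> i = k"
  and rook_less: "rook_placement n D \<Longrightarrow> (i, j) \<in> D \<Longrightarrow> j < i \<and> i < n"
  unfolding rook_placement_def by blast+

lemma finite_rook:
  assumes "rook_placement n D" shows "finite D"
proof (rule finite_subset)
  show "D \<subseteq> {..<n} \<times> {..<n}" using rook_less[OF assms] by force
qed simp

lemma crossings_legs: "crossings D \<subseteq> legs D"
  by (auto simp: crossings_def legs_def)

lemma finite_legs:
  assumes "rook_placement n D" shows "finite (legs D)"
proof (rule finite_subset)
  show "legs D \<subseteq> {..<n} \<times> {..<n}" using rook_less[OF assms] by (force simp: legs_def)
qed simp

lemma card_legs:
  assumes D: "rook_placement n D" shows "card (legs D) = (\<Sum>(i, j)\<in>D. i - j - 1)"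
proof -
  have "legs D = (\<Union>(i, j)\<in>D. {j<..<i} \<times> {j})" by (auto simp: legs_def)
  also have "card \<dots> = (\<Sum>p\<in>D. card (case p of (i, j) \<Rightarrow> {j<..<i} \<times> {j}))"
  proof (rule card_UN_disjoint)
    show "\<forall>p\<in>D. \<forall>q\<in>D. p \<noteq> q \<longrightarrow>
        (case p of (i, j) \<Rightarrow> {j<..<i} \<times> {j}) \<inter> (case q of (i, j) \<Rightarrow> {j<..<i} \<times> {j}) = {}"
      using rook_col[OF D] by (auto split: prod.splits)
  qed (auto simp: finite_rook[OF D])
  also have "\<dots> = (\<Sum>(i, j)\<in>D. i - j - 1)" by (rule sum.cong) auto
  finally show ?thesis .
qed

lemma hooks_meet:
  assumes D: "rook_placement n D" and c: "c \<in> D" and d: "d \<in> D" "c \<noteq> d"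
    and p: "p \<in> hook c" "p \<in> hook d"
  shows "\<exists>i j r s. (i, j) \<in> D \<and> (r, s) \<in> D \<and> j < s \<and> s < i \<and> i < r \<and> p = (i, s)"
proof -
  obtain i j r s where e: "c = (i, j)" "d = (r, s)" by (cases c, cases d)
  have ir: "i \<noteq> r" "j \<noteq> s" using rook_row[OF D] rook_col[OF D] c d e by blast+
  have "(j < s \<and> s < i \<and> i < r \<and> p = (i, s)) \<or> (s < j \<and> j < r \<and> r < i \<and> p = (r, j))"
    using p ir unfolding e hook_def by auto
  thus ?thesis using c d e by blast
qed

text \<open>Hook intersections and crossings are both parametrized by the pairs of main conditions
  with j < s < i < r. Row i and column s recover the pair from (i,s), columns s and j recover it
  from (s,j).\<close>

lemma card_hook_intersections:
  assumes D: "rook_placement n D"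
  shows "card {p. \<exists>c\<in>D. \<exists>d\<in>D. c \<noteq> d \<and> p \<in> hook c \<inter> hook d} = card (crossings D)"
proof -
  define Q where "Q = {((i, j), (r, s)). (i, j) \<in> D \<and> (r, s) \<in> D \<and> j < s \<and> s < i \<and> i < r}"
  have "{p. \<exists>c\<in>D. \<exists>d\<in>D. c \<noteq> d \<and> p \<in> hook c \<inter> hook d} = (\<lambda>((i, j), (r, s)). (i, s)) ` Q"
  proof
    show "{p. \<exists>c\<in>D. \<exists>d\<in>D. c \<noteq> d \<and> p \<in> hook c \<inter> hook d} \<subseteq> (\<lambda>((i, j), (r, s)). (i, s)) ` Q"
    proof
      fix p assume "p \<in> {p. \<exists>c\<in>D. \<exists>d\<in>D. c \<noteq> d \<and> p \<in> hook c \<inter> hook d}"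
      then obtain i j r s where "(i, j) \<in> D" "(r, s) \<in> D" "j < s" "s < i" "i < r" "p = (i, s)"
        using hooks_meet[OF D] by blast
      thus "p \<in> (\<lambda>((i, j), (r, s)). (i, s)) ` Q"
        by (intro image_eqI[of _ _ "((i, j), (r, s))"]) (auto simp: Q_def)
    qed
    show "(\<lambda>((i, j), (r, s)). (i, s)) ` Q \<subseteq> {p. \<exists>c\<in>D. \<exists>d\<in>D. c \<noteq> d \<and> p \<in> hook c \<inter> hook d}"
    proof
      fix p assume "p \<in> (\<lambda>((i, j), (r, s)). (i, s)) ` Q"
      then obtain i j r s where q: "(i, j) \<in> D" "(r, s) \<in> D" "j < s" "s < i" "i < r" "p = (i, s)"
        by (auto simp: Q_def)
      have "p \<in> hook (i, j)" "p \<in> hook (r, s)" "(i, j) \<noteq> (r, s)" using q by (auto simp: hook_def)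
      thus "p \<in> {p. \<exists>c\<in>D. \<exists>d\<in>D. c \<noteq> d \<and> p \<in> hook c \<inter> hook d}" using q by blast
    qed
  qed
  moreover have "inj_on (\<lambda>((i, j), (r, s)). (i, s)) Q"
    using rook_row[OF D] rook_col[OF D] by (auto simp: inj_on_def Q_def)
  ultimately have 1: "card {p. \<exists>c\<in>D. \<exists>d\<in>D. c \<noteq> d \<and> p \<in> hook c \<inter> hook d} = card Q"
    by (simp add: card_image)
  have "crossings D = (\<lambda>((i, j), (r, s)). (s, j)) ` Q"
    by (force simp: crossings_def Q_def)
  moreover have "inj_on (\<lambda>((i, j), (r, s)). (s, j)) Q"
    using rook_col[OF D] by (auto simp: inj_on_def Q_def)
  ultimately show ?thesis using 1 by (simp add: card_image)
qed

section \<open>Stabilizer and normalizer of a verge as pattern subgroups\<close>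

context verge_action
begin

definition K_pattern :: "(nat \<times> nat) set \<Rightarrow> (nat \<times> nat) set" where
  "K_pattern D = positions - (legs D - crossings D)"

lemma K_pattern_positions: "K_pattern D \<subseteq> positions"
  by (auto simp: K_pattern_def)

text \<open>A leg survives in \<open>K_pattern D\<close> only as a crossing, and since column j has
  just one main condition, the crossing is one with (i,j) itself.\<close>

lemma K_pattern_leg:
  assumes D: "rook_placement n D" and K: "(k, j) \<in> K_pattern D"
    and ij: "(i, j) \<in> D" "k < i"
  shows "\<exists>r. (r, k) \<in> D \<and> i < r"
proof -
  have "j < k" using K by (simp add: K_pattern_def positions_def)
  hence "(k, j) \<in> crossings D" using K ij by (auto simp: K_pattern_def legs_def)
  then obtain i' r where "(i', j) \<in> D" "(r, k) \<in> D" "i' < r" by (auto simp: crossings_def)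
  thus ?thesis using rook_col[OF D ij(1), of i'] by auto
qed

text \<open>Suppose the product (s,j) is a leg of (i,j). Applying \<open>K_pattern_leg\<close> to
  (k,j) gives a main condition in column k below row i; applying it to (s,k) gives one in column s
  still further down. So (s,j) is a crossing and stays in the pattern.\<close>

lemma closed_K_pattern:
  assumes D: "rook_placement n D" shows "closed_pattern (K_pattern D)"
  unfolding closed_pattern_def
proof (intro conjI allI impI)
  fix s k j assume sk: "(s, k) \<in> K_pattern D" and kj: "(k, j) \<in> K_pattern D"
  have less: "j < k" "k < s" "s < n" using sk kj by (auto simp: K_pattern_def positions_def)
  show "(s, j) \<in> K_pattern D"
  proof (cases "(s, j) \<in> legs D")
    case True
    then obtain i where i: "(i, j) \<in> D" "s < i" by (auto simp: legs_def)
    obtain r where r: "(r, k) \<in> D" "i < r"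
      using K_pattern_leg[OF D kj i(1)] i(2) less by auto
    obtain r' where "(r', s) \<in> D" "r < r'"
      using K_pattern_leg[OF D sk r(1)] i(2) r(2) by auto
    hence "(s, j) \<in> crossings D" using i r less by (fastforce simp: crossings_def)
    thus ?thesis using less by (simp add: K_pattern_def positions_def)
  next
    case False
    thus ?thesis using less by (simp add: K_pattern_def positions_def)
  qed
qed (rule K_pattern_positions)

lemma verge_V: "verge F n A \<Longrightarrow> A \<in> V"
  by (simp add: verge_def)

lemma verge_rook:
  assumes "verge F n A" shows "rook_placement n (main_conditions F n A)"
proof -
  have "main_conditions F n A \<subseteq> {(i, j). j < i \<and> i < n}"
  proof
    fix p assume "p \<in> main_conditions F n A"
    then obtain i j where p: "p = (i, j)" "i < n" "j < n" "A $$ (i, j) \<noteq> \<zero>"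
      by (auto simp: main_conditions_def)
    thus "p \<in> {(i, j). j < i \<and> i < n}" using V_upper[OF verge_V[OF assms], of i j] by fastforce
  qed
  thus ?thesis using assms unfolding verge_def rook_placement_def by blast
qed

lemma main_iff: "i < n \<Longrightarrow> j < n \<Longrightarrow> (i, j) \<in> main_conditions F n A \<longleftrightarrow> A $$ (i, j) \<noteq> \<zero>"
  by (simp add: main_conditions_def)

lemma tact_verge:
  assumes A: "verge F n A" and u: "u \<in> carrier U" and mi: "m < i" "i < n"
  shows "(i, j) \<in> main_conditions F n A \<Longrightarrow> tact A u $$ (i, m) = A $$ (i, j) \<otimes> u $$ (m, j)"
    and "(\<And>j. (i, j) \<notin> main_conditions F n A) \<Longrightarrow> tact A u $$ (i, m) = \<zero>"
proof -
  note D = verge_rook[OF A]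
  have AV: "A \<in> mats F n" using verge_V[OF A] by simp
  have mn: "m < n" using mi by simp
  have e: "tact A u $$ (i, m) = (\<Oplus>k\<in>{..<n}. A $$ (i, k) \<otimes> u $$ (m, k))"
    using AV u mi mn by (simp add: tact_entry)
  show "tact A u $$ (i, m) = A $$ (i, j) \<otimes> u $$ (m, j)" if ij: "(i, j) \<in> main_conditions F n A"
    unfolding e
  proof (rule finsum_single)
    have jn: "j < n" using rook_less[OF D ij] by simp
    show "j \<in> {..<n}" "A $$ (i, j) \<otimes> u $$ (m, j) \<in> carrier F" using jn AV u mi mn by auto
    fix k assume k: "k \<in> {..<n}" "k \<noteq> j"
    hence "A $$ (i, k) = \<zero>" using rook_row[OF D ij, of k] main_iff[of i k A] mi by auto
    thus "A $$ (i, k) \<otimes> u $$ (m, k) = \<zero>" using k u mn by simp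
  qed simp
  show "tact A u $$ (i, m) = \<zero>" if "\<And>j. (i, j) \<notin> main_conditions F n A"
  proof -
    have "(\<Oplus>k\<in>{..<n}. A $$ (i, k) \<otimes> u $$ (m, k)) = A $$ (i, m) \<otimes> u $$ (m, m)"
      by (rule finsum_single)
        (use that main_iff[of i _ A] AV u mi mn in auto)
    thus ?thesis using e that[of m] main_iff[of i m A] mi mn u by simp
  qed
qed

text \<open>Moving \<open>A\<close> by \<open>u\<close> creates the entry
  \<open>A $$ (i, j) \<otimes> u $$ (k, j)\<close> at (i,k) for each leg (k,j) of a main condition
  (i,j), a place where the verge is zero; it leaves the main conditions unchanged.\<close>

lemma stab_verge:
  assumes A: "verge F n A"
  shows "stab A = pattern (positions - legs (main_conditions F n A))"
proof -
  let ?D = "main_conditions F n A"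
  note D = verge_rook[OF A]
  have AV: "A \<in> V" using verge_V[OF A] .
  have "tact A u = A \<longleftrightarrow> u \<in> pattern (positions - legs ?D)" if u: "u \<in> carrier U" for u
  proof
    assume eq: "tact A u = A"
    show "u \<in> pattern (positions - legs ?D)"
      unfolding pattern_def
    proof (intro CollectI conjI allI impI u)
      fix k j assume kj: "j < k" "k < n" "(k, j) \<notin> positions - legs ?D"
      then obtain i where i: "(i, j) \<in> ?D" "k < i" by (auto simp: positions_def legs_def)
      have ijn: "j < i" "i < n" using rook_less[OF D i(1)] by auto
      have "A $$ (i, k) = A $$ (i, j) \<otimes> u $$ (k, j)"
        using tact_verge(1)[OF A u i(2) ijn(2) i(1)] eq by simp
      moreover have "A $$ (i, k) = \<zero>"
        using rook_row[OF D i(1), of k] kj main_iff[of i k A] ijn by auto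
      moreover have "A $$ (i, j) \<noteq> \<zero>" using i(1) by (simp add: main_conditions_def)
      ultimately show "u $$ (k, j) = \<zero>"
        using integral[of "A $$ (i, j)" "u $$ (k, j)"] AV u kj ijn by auto
    qed
  next
    assume up: "u \<in> pattern (positions - legs ?D)"
    show "tact A u = A"
    proof (rule V_eqI)
      show "tact A u \<in> V" using AV u by (simp add: tact_closed)
      fix i m assume im: "m < i" "i < n"
      show "tact A u $$ (i, m) = A $$ (i, m)"
      proof (cases "\<exists>j. (i, j) \<in> ?D")
        case False
        thus ?thesis using tact_verge(2)[OF A u im] main_iff[of i m A] im by auto
      next
        case True
        then obtain j where j: "(i, j) \<in> ?D" by blast
        have jn: "j < i" using rook_less[OF D j] by simp
        have e: "tact A u $$ (i, m) = A $$ (i, j) \<otimes> u $$ (m, j)"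
          by (rule tact_verge(1)[OF A u im j])
        have z: "A $$ (i, m) = \<zero>" if "m \<noteq> j"
          using that rook_row[OF D j, of m] main_iff[of i m A] im by auto
        consider "m < j" | "m = j" | "j < m" by linarith
        thus ?thesis
        proof cases
          case 3
          have "(m, j) \<in> legs ?D" using 3 im j by (auto simp: legs_def)
          hence "u $$ (m, j) = \<zero>" using up 3 im by (auto simp: pattern_def)
          thus ?thesis using e z 3 AV im jn by simp
        qed (use e z AV u im jn in auto)
      qed
    qed (fact AV)
  qed
  thus ?thesis using stab_iff_tact[OF AV] by (auto simp: pattern_def)
qed

definition K_group :: "'a mat \<Rightarrow> 'a mat set" where
  "K_group A = pattern (K_pattern (main_conditions F n A))"

lemma K_subgroup: "verge F n A \<Longrightarrow> subgroup (K_group A) U"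
  unfolding K_group_def by (rule pattern_subgroup[OF closed_K_pattern[OF verge_rook]])

lemma stab_subset_K: "verge F n A \<Longrightarrow> stab A \<subseteq> K_group A"
  by (auto simp: stab_verge K_group_def K_pattern_def pattern_def)

text \<open>It suffices that \<open>h\<close> fixes the moved matrix \<open>C\<close> and pairs with
  it as with \<open>A\<close>; \<open>stab_conj\<close> then transports this back. Away from the
  main conditions \<open>C\<close> can be nonzero only above a main condition of the same column,
  that is at a leg, and there \<open>h\<close> vanishes.\<close>

lemma K_invariant:
  assumes A: "verge F n A" and k: "k \<in> K_group A" and h: "h \<in> stab A"
  shows "mmult F n (mmult F n k h) (inv\<^bsub>U\<^esub> k) \<in> stab A"
    and "cocycle A (mmult F n (mmult F n k h) (inv\<^bsub>U\<^esub> k)) = cocycle A h"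
proof -
  let ?D = "main_conditions F n A"
  note D = verge_rook[OF A]
  have AV: "A \<in> V" using verge_V[OF A] .
  have kU: "k \<in> carrier U" using k by (simp add: K_group_def pattern_U)
  define k' where "k' = inv\<^bsub>U\<^esub> k"
  have k': "k' \<in> pattern (K_pattern ?D)"
    using subgroup.m_inv_closed[OF K_subgroup[OF A] k] by (simp add: k'_def K_group_def)
  have k'U: "k' \<in> carrier U" using k' by (rule pattern_U)
  define C where "C = tact A k'"
  have C: "C = dot_act F n A k" by (simp add: C_def dot_act_tact k'_def)
  have CV: "C \<in> V" using AV k'U by (simp add: C_def tact_closed)
  have C_zero: "C $$ (i, l) = \<zero>"
    if "l < i" "i < n" "(i, l) \<notin> ?D" "\<not> (\<exists>r. (r, l) \<in> ?D \<and> i < r)" for i l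
  proof (cases "\<exists>j. (i, j) \<in> ?D")
    case False
    thus ?thesis using tact_verge(2)[OF A k'U that(1,2)] by (auto simp: C_def)
  next
    case True
    then obtain j where j: "(i, j) \<in> ?D" by blast
    have jn: "j < i" "j < n" using rook_less[OF D j] that by auto
    have e: "C $$ (i, l) = A $$ (i, j) \<otimes> k' $$ (l, j)"
      unfolding C_def by (rule tact_verge(1)[OF A k'U that(1,2) j])
    have "k' $$ (l, j) = \<zero>"
    proof (cases "l < j")
      case False
      hence "j < l" using that(3) j by (metis linorder_cases)
      moreover have "(l, j) \<notin> K_pattern ?D" using K_pattern_leg[OF D _ j that(1)] that(4) by blast
      ultimately show ?thesis using k' that by (simp add: pattern_def)
    qed (use k'U jn in simp)
    thus ?thesis using e AV that jn by simp
  qed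
  have h_zero: "h $$ (m, l) = \<zero>" if "l < m" "(r, l) \<in> ?D" "m < r" for m l r
  proof -
    have "(m, l) \<in> legs ?D" using that by (auto simp: legs_def)
    thus ?thesis using that h rook_less[OF D that(2)] by (simp add: stab_verge[OF A] pattern_def)
  qed
  have hU: "h \<in> carrier U" using h by (rule stab_U)
  have "tact C h = C"
  proof (rule V_eqI)
    show "tact C h \<in> V" using CV hU by (simp add: tact_closed)
    fix i m assume im: "m < i" "i < n"
    have "(\<Oplus>l\<in>{..<n}. C $$ (i, l) \<otimes> h $$ (m, l)) = C $$ (i, m) \<otimes> h $$ (m, m)"
    proof (rule finsum_single)
      fix l assume l: "l \<in> {..<n}" "l \<noteq> m"
      show "C $$ (i, l) \<otimes> h $$ (m, l) = \<zero>"
      proof (cases "m < l")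
        case True
        thus ?thesis using CV hU l im by simp
      next
        case False
        hence lm: "l < m" using l by simp
        show ?thesis
        \<comment> \<open>In the first case (m,l) is a leg of (r,l), because m < i, and the factor
          from \<open>h\<close> is zero; in the second the factor from \<open>C\<close> is
          zero.\<close>
        proof (cases "\<exists>r. (r, l) \<in> ?D \<and> i \<le> r")
          case True
          then obtain r where r: "(r, l) \<in> ?D" "i \<le> r" by blast
          hence "h $$ (m, l) = \<zero>" using h_zero[OF lm r(1)] im by simp
          thus ?thesis using CV l im by simp
        next
          case False
          hence "C $$ (i, l) = \<zero>" using C_zero[of l i] lm im by fastforce
          thus ?thesis using hU l im by simp
        qed
      qed
    qed (use CV hU im in auto)
    thus "tact C h $$ (i, m) = C $$ (i, m)" using CV hU im by (simp add: tact_entry)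
  qed (fact CV)
  hence hC: "h \<in> stab C" by (rule tact_fixed_stab[OF CV hU])
  have "bil C h = bil A h"
  proof (rule bil_cong)
    fix i m assume im: "i < n" "m < n"
    show "C $$ (i, m) \<otimes> h $$ (i, m) = A $$ (i, m) \<otimes> h $$ (i, m)"
    proof (cases "m < i")
      case False
      thus ?thesis using CV AV im by simp
    next
      case True
      show ?thesis
      proof (cases "(i, m) \<in> ?D")
        case mD: True
        have "C $$ (i, m) = A $$ (i, m) \<otimes> k' $$ (m, m)"
          unfolding C_def by (rule tact_verge(1)[OF A k'U True im(1) mD])
        thus ?thesis using k'U AV im by simp
      next
        case mD: False
        hence "A $$ (i, m) = \<zero>" using im by (simp add: main_iff)
        moreover have "C $$ (i, m) = \<zero> \<or> h $$ (i, m) = \<zero>"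
          using C_zero[OF True im(1) mD] h_zero[OF True] by blast
        ultimately show ?thesis using CV hU im by auto
      qed
    qed
  qed (use AV hU in simp_all)
  hence "cocycle C h = cocycle A h" using cocycle_stab[OF CV hC] cocycle_stab[OF AV h] by simp
  thus "mmult F n (mmult F n k h) (inv\<^bsub>U\<^esub> k) \<in> stab A"
    and "cocycle A (mmult F n (mmult F n k h) (inv\<^bsub>U\<^esub> k)) = cocycle A h"
    using stab_conj[OF AV kU, of h] hC C by auto
qed

text \<open>Downward induction on the row \<open>k\<close>: once the rows below are known, every root element in a position
  \<open>(k, l)\<close> outside the legs lies in both stabilizers, and comparing the two characters on it
  determines row \<open>k\<close> of \<open>A\<close> and the constraints on \<open>g\<close>.\<close>

lemma compatible_imp_eq:
  assumes A: "verge F n A" and B: "verge F n B" and g: "g \<in> carrier U"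
    and comp: "\<And>h. h \<in> stab A \<Longrightarrow> mmult F n (mmult F n (inv\<^bsub>U\<^esub> g) h) g \<in> stab B \<Longrightarrow>
      cocycle A h = cocycle B (mmult F n (mmult F n (inv\<^bsub>U\<^esub> g) h) g)"
  shows "A = B" and "g \<in> K_group B"
proof -
  let ?D = "main_conditions F n B"
  note D = verge_rook[OF B]
  have AV: "A \<in> V" and BV: "B \<in> V" using verge_V A B by auto
  define C where "C = tact B g"
  have C: "C = dot_act F n B (inv\<^bsub>U\<^esub> g)" using g by (simp add: C_def dot_act_tact)
  have CV: "C \<in> V" using BV g by (simp add: C_def tact_closed)
  \<comment> \<open>Replacing \<open>B\<close> by the point \<open>C\<close> of its orbit absorbs
    the conjugation by \<open>g\<close>: what remains to be compared are two stabilizer characters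
    on the same element \<open>h\<close>.\<close>
  have comp': "cocycle A h = cocycle C h" if "h \<in> stab A" "h \<in> stab C" for h
    using comp[OF that(1)] stab_conj[OF BV U.inv_closed[OF g], of h] that(2) g C by simp
  \<comment> \<open>The second clause makes \<open>g\<close> vanish at the legs of main conditions
    in rows from \<open>k\<close> on, crossings excepted. Hence \<open>R 0\<close> contains both
    conclusions, and \<open>R n\<close> is vacuous.\<close>
  define R where "R = (\<lambda>k. (\<forall>i j. k \<le> i \<longrightarrow> i < n \<longrightarrow> j < i \<longrightarrow> A $$ (i, j) = B $$ (i, j)) \<and>
    (\<forall>i j l. k \<le> i \<longrightarrow> (i, j) \<in> ?D \<longrightarrow> j < l \<longrightarrow> l < i \<longrightarrow>
       \<not> (\<exists>r. (r, l) \<in> ?D \<and> i < r) \<longrightarrow> g $$ (l, j) = \<zero>))"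
  have step: "R k" if Rk: "R (Suc k)" and kn: "k < n" for k
  proof -
    have RA: "A $$ (i, j) = B $$ (i, j)" if "k < i" "i < n" "j < i" for i j
      using Rk that unfolding R_def by (meson Suc_leI)
    have Rg: "g $$ (l, j) = \<zero>" if "k < i" "(i, j) \<in> ?D" "j < l" "l < i"
      "\<not> (\<exists>r. (r, l) \<in> ?D \<and> i < r)" for i j l
      using Rk that unfolding R_def by (meson Suc_leI)
    have eq: "A $$ (k, l) = C $$ (k, l)"
      if l: "l < k" "\<not> (\<exists>i. (i, l) \<in> ?D \<and> k < i)" for l
    proof -
      have zA: "A $$ (i, l) = \<zero>" if i: "k < i" "i < n" for i
        using RA[OF i, of l] l i main_iff[of i l B] by auto
      have zC: "C $$ (i, l) = \<zero>" if i: "k < i" "i < n" for i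
      proof (cases "\<exists>j. (i, j) \<in> ?D")
        case False
        have "l < i" using i l by simp
        thus ?thesis using tact_verge(2)[OF B g _ i(2)] False unfolding C_def by blast
      next
        case True
        then obtain j where j: "(i, j) \<in> ?D" by blast
        have jn: "j < i" "j < n" using rook_less[OF D j] i by auto
        have li: "l < i" using i l by simp
        have e: "C $$ (i, l) = B $$ (i, j) \<otimes> g $$ (l, j)"
          unfolding C_def by (rule tact_verge(1)[OF B g li i(2) j])
        have "g $$ (l, j) = \<zero>"
        proof (cases "l < j")
          case False
          have "l \<noteq> j" using l(2) j i(1) by blast
          hence "j < l" using False by simp
          thus ?thesis using Rg[OF i(1) j _ li] l(2) i(1) by (meson less_trans)
        qed (use g jn in simp)
        thus ?thesis using e BV i jn by simp
      qed
      have "\<theta> (A $$ (k, l) \<otimes> t) = \<theta> (C $$ (k, l) \<otimes> t)" if t: "t \<in> carrier F" for t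
      proof -
        have "root k l t \<in> stab A" "root k l t \<in> stab C"
          using tact_root_fixed[OF AV l(1) kn t zA] tact_root_fixed[OF CV l(1) kn t zC] by auto
        thus ?thesis
          using comp' cocycle_stab[OF AV] cocycle_stab[OF CV] bil_root[OF AV l(1) kn t]
            bil_root[OF CV l(1) kn t] by metis
      qed
      thus ?thesis using theta_eq_imp_eq[of "A $$ (k, l)" "C $$ (k, l)"] AV CV kn l(1) by simp
    qed
    have row: "(\<forall>l<k. A $$ (k, l) = B $$ (k, l)) \<and> (\<forall>j l. (k, j) \<in> ?D \<longrightarrow> j < l \<longrightarrow> l < k \<longrightarrow>
       \<not> (\<exists>r. (r, l) \<in> ?D \<and> k < r) \<longrightarrow> g $$ (l, j) = \<zero>)"
    proof (cases "\<exists>j. (k, j) \<in> ?D")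
      case False
      have "A $$ (k, l) = \<zero>" if l: "l < k" for l
      proof (cases "\<exists>i. (i, l) \<in> ?D \<and> k < i")
        case True
        then obtain i where i: "(i, l) \<in> ?D" "k < i" by blast
        have il: "i < n" "l < i" using rook_less[OF D i(1)] by auto
        have "(i, l) \<in> main_conditions F n A"
          using RA[OF i(2) il] i(1) il by (simp add: main_iff)
        thus ?thesis using rook_col[OF verge_rook[OF A], of i l k] i(2) main_iff[of k l A] kn l by auto
      next
        case nex: False
        thus ?thesis using eq[OF l nex] tact_verge(2)[OF B g l kn] False unfolding C_def by simp
      qed
      moreover have "B $$ (k, l) = \<zero>" if "l < k" for l
        using False main_iff[of k l B] that kn by auto
      ultimately show ?thesis using False by simp
    next
      case True
      then obtain j where j: "(k, j) \<in> ?D" by blast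
      have jk: "j < k" "j < n" using rook_less[OF D j] kn by auto
      have Cl: "C $$ (k, l) = B $$ (k, j) \<otimes> g $$ (l, j)" if "l < k" for l
        unfolding C_def by (rule tact_verge(1)[OF B g that kn j])
      have "\<not> (\<exists>i. (i, j) \<in> ?D \<and> k < i)" using rook_col[OF D j] by blast
      hence Akj: "A $$ (k, j) = B $$ (k, j)" using eq[OF jk(1)] Cl[OF jk(1)] g BV jk kn by simp
      hence jA: "(k, j) \<in> main_conditions F n A" using j jk kn by (simp add: main_iff)
      have zero: "A $$ (k, l) = \<zero> \<and> B $$ (k, l) = \<zero>" if "l < k" "l \<noteq> j" for l
        using that rook_row[OF D j, of l] rook_row[OF verge_rook[OF A] jA, of l] kn
          main_iff[of k l A] main_iff[of k l B] by auto
      have "g $$ (l, j) = \<zero>" if l: "j < l" "l < k" "\<not> (\<exists>r. (r, l) \<in> ?D \<and> k < r)" for l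
      proof -
        have "B $$ (k, j) \<otimes> g $$ (l, j) = \<zero>" using eq[OF l(2,3)] Cl[OF l(2)] zero[of l] l by simp
        moreover have "B $$ (k, j) \<noteq> \<zero>" using j by (simp add: main_conditions_def)
        ultimately show ?thesis using integral[of "B $$ (k, j)" "g $$ (l, j)"] BV g l jk kn by auto
      qed
      moreover have "\<And>j'. (k, j') \<in> ?D \<Longrightarrow> j' = j" using rook_row[OF D j] by blast
      ultimately show ?thesis using Akj zero by metis
    qed
    show "R k"
      unfolding R_def
    proof (intro conjI allI impI)
      fix i j assume "k \<le> i" "i < n" "j < i"
      thus "A $$ (i, j) = B $$ (i, j)" using row RA by (cases "i = k") auto
    next
      fix i j l assume *: "k \<le> i" "(i, j) \<in> ?D" "j < l" "l < i" "\<not> (\<exists>r. (r, l) \<in> ?D \<and> i < r)"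
      show "g $$ (l, j) = \<zero>"
      proof (cases "i = k")
        case True
        thus ?thesis using row *(2-5) by blast
      next
        case False
        hence "k < i" using *(1) by simp
        thus ?thesis using *(2-5) by (rule Rg)
      qed
    qed
  qed
  have "R 0"
  proof (rule inc_induct[of 0 n])
    show "R n" unfolding R_def using rook_less[OF D] by (meson leD less_imp_le)
  qed (use step in auto)
  thus "A = B" using V_eqI[OF AV BV] by (simp add: R_def)
  show "g \<in> K_group B"
    unfolding K_group_def pattern_def
  proof (intro CollectI conjI allI impI g)
    fix l j assume lj: "j < l" "l < n" "(l, j) \<notin> K_pattern ?D"
    then obtain i where i: "(i, j) \<in> ?D" "l < i" "(l, j) \<notin> crossings ?D"
      by (auto simp: K_pattern_def positions_def legs_def)
    hence "\<not> (\<exists>r. (r, l) \<in> ?D \<and> i < r)" using lj by (auto simp: crossings_def)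
    thus "g $$ (l, j) = \<zero>" using \<open>R 0\<close> i lj unfolding R_def by blast
  qed
qed

lemma clifford_verge:
  assumes A: "verge F n A" shows "clifford_pair U (stab A) (K_group A) (cocycle A)"
proof (intro clifford_pair.intro clifford_pair_axioms.intro)
  have AV: "A \<in> V" using verge_V[OF A] .
  show "subgroup (stab A) U" "linear_char U (stab A) (cocycle A)"
    using AV by (rule stab_subgroup, rule stab_linear)
  show "finite (carrier U)" using finF by (rule finite_U)
  show "subgroup (K_group A) U" "stab A \<subseteq> K_group A"
    using A by (rule K_subgroup, rule stab_subset_K)
  show "k \<otimes>\<^bsub>U\<^esub> h \<otimes>\<^bsub>U\<^esub> inv\<^bsub>U\<^esub> k \<in> stab A \<and>
      cocycle A (k \<otimes>\<^bsub>U\<^esub> h \<otimes>\<^bsub>U\<^esub> inv\<^bsub>U\<^esub> k) = cocycle A h"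
    if "k \<in> K_group A" "h \<in> stab A" for k h
    using K_invariant[OF A that] by simp
  show "\<exists>h\<in>stab A. inv\<^bsub>U\<^esub> g \<otimes>\<^bsub>U\<^esub> h \<otimes>\<^bsub>U\<^esub> g \<in> stab A \<and>
      cocycle A h \<noteq> cocycle A (inv\<^bsub>U\<^esub> g \<otimes>\<^bsub>U\<^esub> h \<otimes>\<^bsub>U\<^esub> g)"
    if "g \<in> carrier U" "g \<notin> K_group A" for g
    using compatible_imp_eq(2)[OF A A that(1)] that(2) by auto
qed (rule U_group)

text \<open>By \<open>card_legs\<close> there are a legs and by
  \<open>card_hook_intersections\<close> b crossings; the positions missing from the pattern of K
  are the legs that are not crossings.\<close>

lemma card_K_group:
  assumes A: "verge F n A"
  shows "card (carrier U) =
    card (K_group A) * card (carrier F) ^ (verge_a F n A - verge_b F n A)"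
proof -
  let ?D = "main_conditions F n A"
  note D = verge_rook[OF A]
  let ?L = "legs ?D - crossings ?D"
  have L: "?L \<subseteq> positions" using rook_less[OF D] by (force simp: legs_def positions_def)
  have "card ?L = verge_a F n A - verge_b F n A"
    using card_legs[OF D] card_hook_intersections[OF D] crossings_legs[of ?D]
      finite_subset[OF crossings_legs finite_legs[OF D]]
    by (simp add: card_Diff_subset verge_a_def verge_b_def hook_intersections_def)
  moreover have "card positions = card (K_pattern ?D) + card ?L"
    using L finite_positions card_Diff_subset[of ?L positions] card_mono[OF finite_positions L]
      finite_subset[OF L finite_positions] by (simp add: K_pattern_def)
  ultimately show ?thesis
    using card_pattern[OF K_pattern_positions] by (simp add: card_U K_group_def power_add)
qed

end

section \<open>Extensions of the stabilizer character\<close>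

text \<open>In an obstructed placement the position of the main condition \<open>(i, j)\<close> is the product of the crossings
  \<open>(i, k)\<close> and \<open>(k, j)\<close>.\<close>

definition obstructed :: "(nat \<times> nat) set \<Rightarrow> bool" where
  "obstructed D \<longleftrightarrow>
     (\<exists>i j k m r. (i, j) \<in> D \<and> (m, k) \<in> D \<and> (r, i) \<in> D \<and> j < k \<and> k < i \<and> i < m \<and> m < r)"

text \<open>Factorizations are tested among crossings only. By
  \<open>K_pattern_indecomposable\<close> this is the same as having no factorization in the whole
  pattern of K.\<close>

definition simple_crossings :: "(nat \<times> nat) set \<Rightarrow> (nat \<times> nat) set" where
  "simple_crossings D =
     {(s, j) \<in> crossings D. \<not> (\<exists>k. (s, k) \<in> crossings D \<and> (k, j) \<in> crossings D)}"

lemma simple_crossings_subset: "simple_crossings D \<subseteq> crossings D"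
  by (auto simp: simple_crossings_def)

section \<open>Additive characters of the field and relations between root elements\<close>

context verge_action
begin

lemma additive_character_sum:
  assumes nz: "\<And>x y. x \<in> carrier F \<Longrightarrow> y \<in> carrier F \<Longrightarrow> \<phi> (x \<oplus> y) = \<phi> x * (\<phi> y :: complex)"
    and "(\<Sum>x\<in>carrier F. \<phi> x) \<noteq> 0" and y: "y \<in> carrier F"
  shows "\<phi> y = 1"
proof -
  have "(\<Sum>x\<in>carrier F. \<phi> x) = (\<Sum>x\<in>carrier F. \<phi> (x \<oplus> y))"
    by (rule sum.reindex_bij_witness[where i = "\<lambda>x. x \<oplus> y" and j = "\<lambda>x. x \<ominus> y"])
      (use y in \<open>auto simp: minus_eq a_assoc r_neg l_neg\<close>)
  also have "\<dots> = (\<Sum>x\<in>carrier F. \<phi> x) * \<phi> y" using nz y by (simp add: sum_distrib_right)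
  finally show ?thesis using assms(2) by simp
qed

text \<open>Sum \<open>\<phi> x * \<theta> (\<ominus> (c \<otimes> x))\<close> over all c and x.
  Summing over c first leaves only x = 0, so the total is nonzero and some c has a nonzero inner
  sum. By \<open>additive_character_sum\<close> the corresponding character is trivial, that is
  \<open>\<phi>\<close> is given by this c.\<close>

lemma additive_character_exists:
  assumes add: "\<And>x y. x \<in> carrier F \<Longrightarrow> y \<in> carrier F \<Longrightarrow> \<phi> (x \<oplus> y) = \<phi> x * (\<phi> y :: complex)"
    and nz: "\<And>x. x \<in> carrier F \<Longrightarrow> \<phi> x \<noteq> 0"
  shows "\<exists>c\<in>carrier F. \<forall>t\<in>carrier F. \<phi> t = \<theta> (c \<otimes> t)"
proof -
  let ?\<psi> = "\<lambda>c x. \<phi> x * \<theta> (\<ominus> (c \<otimes> x))"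
  have inner: "(\<Sum>c\<in>carrier F. \<theta> (\<ominus> (c \<otimes> x))) = (if x = \<zero> then of_nat (card (carrier F)) else 0)"
    if x: "x \<in> carrier F" for x
  proof (cases "x = \<zero>")
    case True
    have "(\<Sum>c\<in>carrier F. \<theta> (\<ominus> (c \<otimes> x))) = (\<Sum>c\<in>carrier F. 1)"
      using True theta_zero by (intro sum.cong) auto
    thus ?thesis using True by simp
  next
    case False
    have "(\<Sum>c\<in>carrier F. \<theta> (\<ominus> (c \<otimes> x))) = 0"
    proof (rule ccontr)
      assume "(\<Sum>c\<in>carrier F. \<theta> (\<ominus> (c \<otimes> x))) \<noteq> 0"
      hence one: "\<theta> (\<ominus> (c \<otimes> x)) = 1" if "c \<in> carrier F" for c
        using additive_character_sum[of "\<lambda>c. \<theta> (\<ominus> (c \<otimes> x))" c] that x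
        by (simp add: l_distr minus_add theta_add)
      have "\<theta> (x \<otimes> t) = \<theta> (\<zero> \<otimes> t)" if "t \<in> carrier F" for t
      proof -
        have "x \<otimes> t = \<ominus> ((\<ominus> t) \<otimes> x)" using x that by algebra
        thus ?thesis using one[of "\<ominus> t"] that theta_zero by simp
      qed
      hence "x = \<zero>" using theta_eq_imp_eq[of x \<zero>] x by simp
      thus False using False by simp
    qed
    thus ?thesis using False by simp
  qed
  have "(\<Sum>c\<in>carrier F. \<Sum>x\<in>carrier F. ?\<psi> c x) = (\<Sum>x\<in>carrier F. \<phi> x * (\<Sum>c\<in>carrier F. \<theta> (\<ominus> (c \<otimes> x))))"
    by (subst sum.swap) (simp add: sum_distrib_left)
  also have "\<dots> = (\<Sum>x\<in>carrier F. if x = \<zero> then \<phi> x * of_nat (card (carrier F)) else 0)"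
    by (rule sum.cong) (simp_all add: inner)
  also have "\<dots> = \<phi> \<zero> * of_nat (card (carrier F))" using finF by simp
  also have "\<dots> \<noteq> 0" using nz finF zero_closed by auto
  finally obtain c where c: "c \<in> carrier F" "(\<Sum>x\<in>carrier F. ?\<psi> c x) \<noteq> 0" by (meson sum.neutral)
  have "\<phi> t = \<theta> (c \<otimes> t)" if t: "t \<in> carrier F" for t
  proof -
    have "?\<psi> c t = 1"
      by (rule additive_character_sum[OF _ c(2) t])
        (use c in \<open>simp add: add r_distr minus_add theta_add\<close>)
    thus ?thesis using t c theta_minus[of "c \<otimes> t"] theta_nonzero[of "c \<otimes> t"] by (simp add: field_simps)
  qed
  thus ?thesis using c(1) by blast
qed

lemma root_add:
  assumes "l < k" "k < n" "s \<in> carrier F" "t \<in> carrier F"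
  shows "mmult F n (root k l s) (root k l t) = root k l (s \<oplus> t)"
proof (rule mats_eqI)
  have r: "root k l s \<in> mats F n" using root_U assms by simp
  fix i j assume "i < n" "j < n"
  thus "mmult F n (root k l s) (root k l t) $$ (i, j) = root k l (s \<oplus> t) $$ (i, j)"
    using mmult_root_entry[OF r assms(1,2,4)] assms by (auto simp: root_entry)
qed (use root_U assms in \<open>simp_all add: mmult_mats\<close>)

lemma root_commutator:
  assumes "l < m" "m < k" "k < n" "t \<in> carrier F"
  shows "mmult F n (root k m t) (root m l \<one>) =
    mmult F n (mmult F n (root m l \<one>) (root k m t)) (root k l t)"
proof (rule mats_eqI)
  have m: "m < n" "l < k" using assms by auto
  have r: "root k m t \<in> mats F n" "root m l \<one> \<in> mats F n" "root k l t \<in> mats F n"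
    using root_U assms m by simp_all
  have p: "mmult F n (root m l \<one>) (root k m t) \<in> mats F n" using r by simp
  show "mmult F n (root k m t) (root m l \<one>) \<in> mats F n"
    "mmult F n (mmult F n (root m l \<one>) (root k m t)) (root k l t) \<in> mats F n"
    using r p by simp_all
  fix i j assume ij: "i < n" "j < n"
  show "mmult F n (root k m t) (root m l \<one>) $$ (i, j) =
    mmult F n (mmult F n (root m l \<one>) (root k m t)) (root k l t) $$ (i, j)"
    using mmult_root_entry[OF r(1) assms(1) m(1) one_closed ij]
      mmult_root_entry[OF p m(2) assms(3,4) ij]
      mmult_root_entry[OF r(2) assms(2,3,4), of i]
      assms m ij by (auto simp: root_entry)
qed

text \<open>By \<open>root_commutator\<close> the root element at a decomposable position is a
  commutator of two root elements of the pattern group, and the values of \<open>\<psi>\<close>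
  commute and are nonzero.\<close>

lemma linear_char_commutator:
  assumes P: "closed_pattern P" and lin: "linear_char U (pattern P) \<psi>"
    and km: "(k, m) \<in> P" "(m, l) \<in> P" and t: "t \<in> carrier F"
  shows "\<psi> (root k l t) = 1"
proof -
  have kl: "(k, l) \<in> P" and less: "l < m" "m < k" "k < n"
    using P km by (auto simp: closed_pattern_def positions_def)
  note r = pattern_root[OF P km(1) t] pattern_root[OF P km(2) one_closed] pattern_root[OF P kl t]
  have mult: "\<psi> (mmult F n g h) = \<psi> g * \<psi> h" if "g \<in> pattern P" "h \<in> pattern P" for g h
    using lin that by (simp add: linear_char_def)
  have nz: "\<psi> (root k m t) \<noteq> 0" "\<psi> (root m l \<one>) \<noteq> 0" using lin r by (auto simp: linear_char_def)
  have "\<psi> (root k m t) * \<psi> (root m l \<one>) = \<psi> (root m l \<one>) * \<psi> (root k m t) * \<psi> (root k l t)"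
    using root_commutator[OF less t] r pattern_closed[OF P r(2,1)] by (metis mult)
  thus ?thesis using nz by simp
qed

text \<open>Root elements generate a pattern group; \<open>pattern_induct\<close> supplies this in
  the form of cancelling one root element at a time.\<close>

lemma linear_char_eqI:
  assumes P: "closed_pattern P" and lin: "linear_char U (pattern P) \<psi>" "linear_char U (pattern P) \<phi>"
    and eq: "\<And>k l t. (k, l) \<in> P \<Longrightarrow> t \<in> carrier F \<Longrightarrow> \<psi> (root k l t) = \<phi> (root k l t)"
    and g: "g \<in> pattern P"
  shows "\<psi> g = \<phi> g"
proof (rule pattern_induct[OF P g])
  show "\<psi> (mone F n) = \<phi> (mone F n)"
    using U.linear_char_one[OF pattern_subgroup[OF P] lin(1)]
      U.linear_char_one[OF pattern_subgroup[OF P] lin(2)] by simp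
  fix g k l t assume g: "g \<in> pattern P" "(k, l) \<in> P" "t \<in> carrier F"
    and IH: "\<psi> (mmult F n g (root k l t)) = \<phi> (mmult F n g (root k l t))"
  have r: "root k l t \<in> pattern P" using pattern_root[OF P g(2,3)] .
  have "\<psi> g * \<psi> (root k l t) = \<phi> g * \<phi> (root k l t)"
    using IH lin g(1) r by (simp add: linear_char_def)
  moreover have "\<phi> (root k l t) \<noteq> 0" using lin(2) r by (simp add: linear_char_def)
  ultimately show "\<psi> g = \<phi> g" using eq[OF g(2,3)] by simp
qed

section \<open>Extensions for obstructed and unobstructed placements\<close>

abbreviation stab_extensions :: "'a mat \<Rightarrow> ('a mat \<Rightarrow> complex) set" where
  "stab_extensions A \<equiv> clifford_pair.extensions U (stab A) (K_group A) (cocycle A)"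

lemma stab_extensions_iff:
  assumes A: "verge F n A"
  shows "\<psi> \<in> stab_extensions A \<longleftrightarrow> \<psi> \<in> extensional (K_group A) \<and> linear_char U (K_group A) \<psi> \<and>
    (\<forall>h\<in>stab A. \<psi> h = cocycle A h)"
  by (simp add: clifford_pair.extensions_def[OF clifford_verge[OF A]])

lemma crossings_K_pattern:
  assumes D: "rook_placement n D" shows "crossings D \<subseteq> K_pattern D"
proof
  fix p assume p: "p \<in> crossings D"
  then obtain s j i where "p = (s, j)" "(i, j) \<in> D" "j < s" "s < i" by (auto simp: crossings_def)
  thus "p \<in> K_pattern D" using p rook_less[OF D, of i j] by (auto simp: K_pattern_def positions_def)
qed

lemma main_notin_legs:
  assumes D: "rook_placement n D" "(i, j) \<in> D" shows "(i, j) \<notin> legs D"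
  using rook_col[OF D(1) D(2)] by (auto simp: legs_def)

lemma main_K_pattern:
  assumes D: "rook_placement n D" "(i, j) \<in> D" shows "(i, j) \<in> K_pattern D"
  using main_notin_legs[OF D] rook_less[OF D] by (auto simp: K_pattern_def positions_def)

lemma root_stab:
  assumes A: "verge F n A" and p: "(k, l) \<in> K_pattern (main_conditions F n A)"
    "(k, l) \<notin> crossings (main_conditions F n A)" and t: "t \<in> carrier F"
  shows "root k l t \<in> stab A" and "cocycle A (root k l t) = \<theta> (A $$ (k, l) \<otimes> t)"
proof -
  have kl: "l < k" "k < n" "(k, l) \<notin> legs (main_conditions F n A)"
    using p by (auto simp: K_pattern_def positions_def)
  show s: "root k l t \<in> stab A"
    using kl root_U[OF kl(1,2) t]
    by (auto simp: stab_verge[OF A] pattern_def root_entry positions_def)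
  show "cocycle A (root k l t) = \<theta> (A $$ (k, l) \<otimes> t)"
    using cocycle_stab[OF verge_V[OF A] s] bil_root[OF verge_V[OF A] kl(1,2) t] by simp
qed

text \<open>The obstruction makes (i,k) and (k,j) crossings, hence positions of K. An extension is
  therefore trivial on the root elements at (i,j), where it should equal
  \<open>\<theta> (A $$ (i, j) \<otimes> t)\<close> with a nonzero coefficient.\<close>

lemma obstructed_extensions:
  assumes A: "verge F n A" and obs: "obstructed (main_conditions F n A)"
  shows "stab_extensions A = {}"
proof (rule ccontr)
  let ?D = "main_conditions F n A"
  note D = verge_rook[OF A]
  assume "stab_extensions A \<noteq> {}"
  then obtain \<psi> where lin: "linear_char U (K_group A) \<psi>" and ext: "\<And>h. h \<in> stab A \<Longrightarrow> \<psi> h = cocycle A h"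
    using stab_extensions_iff[OF A] by blast
  obtain i j k m r where d: "(i, j) \<in> ?D" "(m, k) \<in> ?D" "(r, i) \<in> ?D" "j < k" "k < i" "i < m" "m < r"
    using obs unfolding obstructed_def by blast
  have T: "(i, k) \<in> K_pattern ?D" "(k, j) \<in> K_pattern ?D"
    using d crossings_K_pattern[OF D] by (auto simp: crossings_def)
  have ijn: "i < n" "j < n" using rook_less[OF D d(1)] by auto
  have notT: "(i, j) \<notin> crossings ?D" using main_notin_legs[OF D d(1)] crossings_legs by blast
  have "\<theta> (A $$ (i, j) \<otimes> t) = \<theta> (\<zero> \<otimes> t)" if t: "t \<in> carrier F" for t
    using linear_char_commutator[OF closed_K_pattern[OF D] lin[unfolded K_group_def] T t]
      root_stab[OF A main_K_pattern[OF D d(1)] notT t] ext theta_zero t by simp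
  hence "A $$ (i, j) = \<zero>" using theta_eq_imp_eq[of "A $$ (i, j)" \<zero>] verge_V[OF A] ijn by simp
  thus False using d(1) by (simp add: main_conditions_def)
qed

text \<open>If (s,j) is a leg or a main condition, then (k,j) is a leg of the main condition of
  column j, and two applications of \<open>K_pattern_leg\<close> show that both factors are
  crossings. For a simple crossing this contradicts simplicity; for a main condition the main
  conditions found on the way form an obstruction.\<close>

lemma K_pattern_indecomposable:
  assumes D: "rook_placement n D" and sk: "(s, k) \<in> K_pattern D" and kj: "(k, j) \<in> K_pattern D"
  shows "(s, j) \<notin> simple_crossings D" and "\<not> obstructed D \<Longrightarrow> (s, j) \<notin> D"
proof -
  have less: "j < k" "k < s" "s < n" using sk kj by (auto simp: K_pattern_def positions_def)
  show "(s, j) \<notin> simple_crossings D"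
  proof
    assume simple: "(s, j) \<in> simple_crossings D"
    then obtain i where i: "(i, j) \<in> D" "s < i" by (auto simp: simple_crossings_def crossings_def)
    obtain r where r: "(r, k) \<in> D" "i < r" using K_pattern_leg[OF D kj i(1)] i(2) less by auto
    obtain r' where r': "(r', s) \<in> D" "r < r'" using K_pattern_leg[OF D sk r(1)] i(2) r(2) by auto
    have "s < r" using i(2) r(2) by simp
    hence "(s, k) \<in> crossings D" using r r' less by (auto simp: crossings_def)
    moreover have "(k, j) \<in> crossings D" using i r less by (fastforce simp: crossings_def)
    ultimately show False using simple by (auto simp: simple_crossings_def)
  qed
  show "(s, j) \<notin> D" if "\<not> obstructed D"
  proof
    assume sj: "(s, j) \<in> D"
    obtain m where m: "(m, k) \<in> D" "s < m" using K_pattern_leg[OF D kj sj] less by auto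
    obtain r where "(r, s) \<in> D" "m < r" using K_pattern_leg[OF D sk m(1)] m(2) by auto
    thus False using that m sj less unfolding obstructed_def by blast
  qed
qed

text \<open>An extension is determined by its values on root elements. At a decomposable crossing it
  is trivial, off the crossings it is prescribed by the stabilizer, and at each simple crossing it
  is an additive character of the field, hence one parameter. All choices of parameters are
  realized.\<close>

lemma card_unobstructed_extensions:
  assumes A: "verge F n A" and unobs: "\<not> obstructed (main_conditions F n A)"
  shows "card (stab_extensions A) =
      card (carrier F) ^ card (simple_crossings (main_conditions F n A))"
    and "finite (stab_extensions A)"
proof -
  let ?D = "main_conditions F n A"
  let ?S = "simple_crossings ?D"
  let ?P = "K_pattern ?D"
  note D = verge_rook[OF A]
  note P = closed_K_pattern[OF D]
  have AV: "A \<in> V" using verge_V[OF A] .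
  have SP: "?S \<subseteq> ?P" using simple_crossings_subset crossings_K_pattern[OF D] by blast
  have Sless: "j < s \<and> s < n" if "(s, j) \<in> ?S" for s j
    using that SP K_pattern_positions by (fastforce simp: positions_def)
  have SD: "(s, j) \<notin> ?D" if "(s, j) \<in> ?S" for s j
    using that main_notin_legs[OF D] simple_crossings_subset crossings_legs by blast
  \<comment> \<open>\<open>M c\<close> is \<open>A\<close> with the free parameters placed at the
    simple crossings. Its nonzero entries sit at simple crossings and main conditions, which do not
    decompose in the pattern of K; so pairing with \<open>M c\<close> is additive on
    \<open>K_group A\<close>.\<close>
  define M where "M = (\<lambda>c. mat n n (\<lambda>p. if p \<in> ?S then c p else A $$ p))"
  have M_entry: "M c $$ (i, j) = (if (i, j) \<in> ?S then c (i, j) else A $$ (i, j))"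
    if "i < n" "j < n" for c i j
    using that by (simp add: M_def)
  have MV: "M c \<in> V" if c: "c \<in> ?S \<rightarrow>\<^sub>E carrier F" for c
  proof (rule V_I, rule matsI)
    show "M c $$ (i, j) \<in> carrier F" if "i < n" "j < n" for i j
      using that c AV by (auto simp: M_entry)
    show "M c $$ (i, j) = \<zero>" if "i \<le> j" "j < n" for i j
      using that AV Sless[of i j] by (auto simp: M_entry)
  qed (simp_all add: M_def)
  define ext where "ext = (\<lambda>c. \<lambda>g\<in>K_group A. \<theta> (bil (M c) g))"
  have KU: "g \<in> carrier U" if "g \<in> K_group A" for g using that by (simp add: K_group_def pattern_U)
  have bil_mult: "bil (M c) (mmult F n g h) = bil (M c) g \<oplus> bil (M c) h"
    if c: "c \<in> ?S \<rightarrow>\<^sub>E carrier F" and g: "g \<in> K_group A" and h: "h \<in> K_group A" for c g h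
  proof (rule bil_add)
    fix i j assume ij: "i < n" "j < n"
    have cl: "M c $$ (i, j) \<in> carrier F" "g $$ (i, j) \<in> carrier F" "h $$ (i, j) \<in> carrier F"
      using V_mats[OF MV[OF c]] KU[OF g] KU[OF h] ij by auto
    have ghc: "mmult F n g h $$ (i, j) \<in> carrier F"
      using mmult_mats[of g h] KU[OF g] KU[OF h] ij by auto
    show "M c $$ (i, j) \<otimes> mmult F n g h $$ (i, j) =
      M c $$ (i, j) \<otimes> g $$ (i, j) \<oplus> M c $$ (i, j) \<otimes> h $$ (i, j)"
    \<comment> \<open>Only here is the absence of an obstruction used: it makes the main conditions
      indecomposable. Elsewhere the coefficient in \<open>M c\<close> is zero.\<close>
    proof (cases "(i, j) \<in> ?S \<or> (i, j) \<in> ?D")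
      case True
      have ji: "j < i" using True Sless rook_less[OF D] by blast
      have "mmult F n g h $$ (i, j) = g $$ (i, j) \<oplus> h $$ (i, j)"
      proof (rule pattern_mult_entry[OF P g[unfolded K_group_def] h[unfolded K_group_def] ji ij(1)])
        fix k assume "(i, k) \<in> ?P" "(k, j) \<in> ?P"
        thus False using K_pattern_indecomposable[OF D, of i k j] unobs True by blast
      qed
      thus ?thesis using cl by (simp add: r_distr)
    next
      case False
      hence "M c $$ (i, j) = \<zero>" using ij by (simp add: M_entry main_iff)
      thus ?thesis using cl ghc by simp
    qed
  qed (use V_mats[OF MV[OF c]] KU[OF g] KU[OF h] in simp_all)
  have ext_lin: "linear_char U (K_group A) (ext c)" if c: "c \<in> ?S \<rightarrow>\<^sub>E carrier F" for c
  proof -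
    have "mmult F n g h \<in> K_group A" if "g \<in> K_group A" "h \<in> K_group A" for g h
      using pattern_closed[OF P] that by (simp add: K_group_def)
    thus ?thesis
      using bil_mult[OF c] V_mats[OF MV[OF c]] KU
      by (simp add: linear_char_def ext_def theta_nonzero theta_add)
  qed
  have bil_stab: "bil (M c) h = bil A h" if c: "c \<in> ?S \<rightarrow>\<^sub>E carrier F" and h: "h \<in> stab A" for c h
  proof (rule bil_cong)
    fix i j assume ij: "i < n" "j < n"
    have hz: "h $$ (i, j) = \<zero>" if "(i, j) \<in> ?S"
    proof -
      have "(i, j) \<in> legs ?D" using that simple_crossings_subset crossings_legs by blast
      thus ?thesis using h Sless[OF that] by (simp add: stab_verge[OF A] pattern_def)
    qed
    show "M c $$ (i, j) \<otimes> h $$ (i, j) = A $$ (i, j) \<otimes> h $$ (i, j)"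
    proof (cases "(i, j) \<in> ?S")
      case True
      thus ?thesis using hz V_mats[OF MV[OF c]] AV ij by simp
    qed (use ij in \<open>simp add: M_entry\<close>)
  qed (use AV stab_U[OF h] in simp_all)
  have ext_mem: "ext c \<in> stab_extensions A" if c: "c \<in> ?S \<rightarrow>\<^sub>E carrier F" for c
    unfolding stab_extensions_iff[OF A]
  proof (intro conjI ballI)
    fix h assume h: "h \<in> stab A"
    thus "ext c h = cocycle A h"
      using stab_subset_K[OF A] bil_stab[OF c h] cocycle_stab[OF AV h] by (auto simp: ext_def)
  qed (use ext_lin[OF c] in \<open>simp_all add: ext_def\<close>)
  have root_K: "root s j t \<in> K_group A" if "(s, j) \<in> ?P" "t \<in> carrier F" for s j t
    using pattern_root[OF P that] by (simp add: K_group_def)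
  have ext_root: "ext c (root s j t) = \<theta> (c (s, j) \<otimes> t)"
    if c: "c \<in> ?S \<rightarrow>\<^sub>E carrier F" and sj: "(s, j) \<in> ?S" and t: "t \<in> carrier F" for c s j t
    using bil_root[OF MV[OF c] _ _ t, of j s] Sless[OF sj] sj SP root_K[of s j t] t
    by (auto simp: ext_def M_entry)
  have inj: "inj_on ext (?S \<rightarrow>\<^sub>E carrier F)"
  proof
    fix c c' assume c: "c \<in> ?S \<rightarrow>\<^sub>E carrier F" "c' \<in> ?S \<rightarrow>\<^sub>E carrier F" and eq: "ext c = ext c'"
    show "c = c'"
    proof (rule PiE_ext[OF c])
      fix p assume p: "p \<in> ?S"
      obtain s j where sj: "p = (s, j)" by (cases p)
      have "\<theta> (c p \<otimes> t) = \<theta> (c' p \<otimes> t)" if "t \<in> carrier F" for t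
        using ext_root[OF c(1) _ that, of s j] ext_root[OF c(2) _ that, of s j] eq p sj by simp
      thus "c p = c' p" using theta_eq_imp_eq[of "c p" "c' p"] c p by auto
    qed
  qed
  have surj: "\<psi> \<in> ext ` (?S \<rightarrow>\<^sub>E carrier F)" if psi: "\<psi> \<in> stab_extensions A" for \<psi>
  proof -
    have lin: "linear_char U (K_group A) \<psi>" and psi_ext: "\<psi> \<in> extensional (K_group A)"
      and psi_stab: "\<And>h. h \<in> stab A \<Longrightarrow> \<psi> h = cocycle A h"
      using psi stab_extensions_iff[OF A] by auto
    have "\<exists>c\<in>carrier F. \<forall>t\<in>carrier F. \<psi> (root s j t) = \<theta> (c \<otimes> t)" if sj: "(s, j) \<in> ?S" for s j
    proof (rule additive_character_exists)
      have r: "root s j t \<in> K_group A" if "t \<in> carrier F" for t using root_K[of s j t] sj SP that by blast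
      show "\<psi> (root s j (x \<oplus> y)) = \<psi> (root s j x) * \<psi> (root s j y)"
        if "x \<in> carrier F" "y \<in> carrier F" for x y
        using root_add[of j s x y] Sless[OF sj] that r[OF that(1)] r[OF that(2)] lin
        unfolding linear_char_def U_mult by metis
      show "\<psi> (root s j t) \<noteq> 0" if "t \<in> carrier F" for t
        using lin r[OF that] by (simp add: linear_char_def)
    qed
    hence "\<forall>p\<in>?S. \<exists>c\<in>carrier F. \<forall>t\<in>carrier F. \<psi> (root (fst p) (snd p) t) = \<theta> (c \<otimes> t)" by auto
    then obtain c' where c': "\<And>p. p \<in> ?S \<Longrightarrow> c' p \<in> carrier F \<and>
        (\<forall>t\<in>carrier F. \<psi> (root (fst p) (snd p) t) = \<theta> (c' p \<otimes> t))" by metis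
    define c where "c = restrict c' ?S"
    have c: "c \<in> ?S \<rightarrow>\<^sub>E carrier F" using c' by (auto simp: c_def)
    have croot: "\<psi> (root s j t) = \<theta> (c (s, j) \<otimes> t)" if "(s, j) \<in> ?S" "t \<in> carrier F" for s j t
      using c'[OF that(1)] that by (simp add: c_def)
    have "\<psi> g = ext c g" if g: "g \<in> K_group A" for g
    proof (rule linear_char_eqI[OF P lin[unfolded K_group_def] ext_lin[OF c, unfolded K_group_def]])
      show "g \<in> pattern ?P" using g by (simp add: K_group_def)
      fix k l t assume kl: "(k, l) \<in> ?P" and t: "t \<in> carrier F"
      \<comment> \<open>Free parameter, commutator, and element of the stabilizer: in each case the
        value at the root element is forced to agree with that of \<open>ext c\<close>.\<close>
      consider "(k, l) \<in> ?S" | "(k, l) \<in> crossings ?D" "(k, l) \<notin> ?S" | "(k, l) \<notin> crossings ?D" by blast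
      thus "\<psi> (root k l t) = ext c (root k l t)"
      proof cases
        case 1
        thus ?thesis using croot[OF 1 t] ext_root[OF c 1 t] by simp
      next
        case 2
        then obtain m where "(k, m) \<in> ?P" "(m, l) \<in> ?P"
          using crossings_K_pattern[OF D] unfolding simple_crossings_def by blast
        thus ?thesis
          using linear_char_commutator[OF P lin[unfolded K_group_def] _ _ t]
            linear_char_commutator[OF P ext_lin[OF c, unfolded K_group_def] _ _ t] by metis
      next
        case 3
        note s = root_stab(1)[OF A kl 3 t]
        have "ext c (root k l t) = cocycle A (root k l t)"
          using ext_mem[OF c] s stab_extensions_iff[OF A] by blast
        thus ?thesis using psi_stab[OF s] by simp
      qed
    qed
    hence "\<psi> = ext c" using psi_ext by (intro extensionalityI[of _ "K_group A"]) (auto simp: ext_def)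
    thus ?thesis using c by blast
  qed
  have bij: "bij_betw ext (?S \<rightarrow>\<^sub>E carrier F) (stab_extensions A)"
    unfolding bij_betw_def using inj surj ext_mem by blast
  have "finite ?S"
    using finite_subset[OF SP finite_subset[OF K_pattern_positions finite_positions]] .
  thus "card (stab_extensions A) = card (carrier F) ^ card ?S"
    using bij_betw_same_card[OF bij] by (simp add: card_PiE)
  show "finite (stab_extensions A)"
    using bij_betw_finite[OF bij] \<open>finite ?S\<close> finF by (simp add: finite_PiE)
qed

end

section \<open>Counting characters of minimal degree\<close>

context verge_action
begin

lemma right_orbit_V: "A \<in> V \<Longrightarrow> right_orbit F n A \<subseteq> V"
  by (auto simp: right_orbit_def dot_act_V)

text \<open>On the orbit module \<open>u\<close> is a monomial operator, a sum of rank one operators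
  sending the coordinate at B, times the cocycle, to the basis vector of the moved point. Only the
  points fixed by \<open>u\<close> contribute to the trace.\<close>

lemma orbit_character_eq:
  assumes A: "A \<in> V" and u: "u \<in> carrier U"
  shows "orbit_character F n \<theta> A u = (\<Sum>B\<in>{B \<in> right_orbit F n A. u \<in> stab B}. cocycle B u)"
proof -
  let ?O = "right_orbit F n A"
  let ?I = "\<lambda>B :: 'a mat. indicator {B} :: 'a mat \<Rightarrow> complex"
  have O: "?O \<subseteq> V" "finite ?O" using right_orbit_V[OF A] finite_V finite_subset by blast+
  have stable: "dot_act F n B u \<in> ?O" if B: "B \<in> ?O" for B
  proof -
    obtain g where g: "g \<in> carrier U" "B = dot_act F n A g" using B by (auto simp: right_orbit_def)
    hence "dot_act F n B u = dot_act F n A (mmult F n g u)" using A u by (simp add: dot_act_mult)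
    thus ?thesis using g(1) u U_closed by (auto simp: right_orbit_def)
  qed
  \<comment> \<open>\<open>monomial_act\<close> sums over all strictly lower matrices; vectors of
    the orbit module vanish off the orbit, which cuts the sum down to it.\<close>
  have supp: "f B = 0" if "f \<in> orbit_module F n A" "B \<notin> ?O" for f B
    using that(1) unfolding orbit_module_def
  proof (rule cfun.span_induct[where P = "\<lambda>f. f B = 0"])
    show "cfun.subspace {f. f B = 0}" by (simp add: cfun.subspace_def cscale_def)
    show "f B = 0" if "f \<in> ?I ` ?O" for f using that \<open>B \<notin> ?O\<close> by (auto simp: indicator_def)
  qed
  have "orbit_character F n \<theta> A u = trace_on (orbit_module F n A) (\<lambda>v. monomial_act F n \<theta> v u)"
    using u by (simp add: orbit_character_def module_character_def)
  also have "\<dots> = (\<Sum>B\<in>?O. ?I (dot_act F n B u) B * cocycle B u)"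
  proof (rule trace_on_finite_rank[where l = "\<lambda>B f. f B * cocycle B u" and
        z = "\<lambda>B. ?I (dot_act F n B u)"])
    show "finite (?I ` ?O)" using O by simp
    show "cfun.span (?I ` ?O) = orbit_module F n A" by (simp add: orbit_module_def)
    show "linear_functional_on (orbit_module F n A) (\<lambda>f. f B * cocycle B u)" for B
      by (simp add: linear_functional_on_def cscale_def algebra_simps)
    show "?I (dot_act F n B u) \<in> orbit_module F n A" if "B \<in> ?O" for B
      unfolding orbit_module_def using stable[OF that] by (intro cfun.span_base) blast
    fix f assume f: "f \<in> orbit_module F n A"
    have "monomial_act F n \<theta> f u = (\<Sum>B\<in>V. cscale (f B * cocycle B u) (?I (dot_act F n B u)))"
      by (simp add: monomial_act_def cocycle_def)
    also have "\<dots> = (\<Sum>B\<in>?O. cscale (f B * cocycle B u) (?I (dot_act F n B u)))"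
      by (rule sum.mono_neutral_right[OF finite_V O(1)]) (use supp[OF f] in simp)
    finally show "monomial_act F n \<theta> f u =
      (\<Sum>B\<in>?O. cscale (f B * cocycle B u) (?I (dot_act F n B u)))" .
  qed (fact O(2))
  also have "\<dots> = (\<Sum>B\<in>?O. if u \<in> stab B then cocycle B u else 0)"
    by (rule sum.cong) (use u in \<open>auto simp: stab_def indicator_def\<close>)
  also have "\<dots> = (\<Sum>B\<in>{B \<in> ?O. u \<in> stab B}. cocycle B u)"
    by (rule sum.inter_filter[symmetric, OF O(2)])
  finally show ?thesis .
qed

text \<open>Translating the product of all values of \<open>\<theta>\<close> by \<open>x\<close>
  shows that \<open>\<theta> x\<close> is a root of unity. This bridges \<open>char_inner\<close>,
  which conjugates, and \<open>character_pairing\<close>, which inverts.\<close>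

lemma cnj_theta: "x \<in> carrier F \<Longrightarrow> cnj (\<theta> x) = inverse (\<theta> x)"
proof -
  assume x: "x \<in> carrier F"
  have "(\<Prod>y\<in>carrier F. \<theta> y) = (\<Prod>y\<in>carrier F. \<theta> (x \<oplus> y))"
    by (rule prod.reindex_bij_witness[where i = "\<lambda>y. x \<oplus> y" and j = "\<lambda>y. \<ominus> x \<oplus> y"])
      (use x in \<open>auto simp: a_assoc[symmetric] r_neg l_neg\<close>)
  also have "\<dots> = \<theta> x ^ card (carrier F) * (\<Prod>y\<in>carrier F. \<theta> y)"
    using x by (simp add: theta_add prod.distrib)
  finally have "\<theta> x ^ card (carrier F) = 1"
    using theta_nonzero finF by simp
  moreover have "card (carrier F) \<noteq> 0" using finF x by auto
  ultimately have "norm (\<theta> x) = 1" using power_eq_1_iff[of "\<theta> x" "card (carrier F)"] by simp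
  hence "\<theta> x * cnj (\<theta> x) = 1" by (simp add: complex_norm_square[symmetric])
  thus ?thesis by (rule inverse_unique[symmetric])
qed

text \<open>Frobenius reciprocity for the orbit module, which is induced from the stabilizer. After
  exchanging the sums over group elements and fixed points, conjugation carries the contribution of
  any point of the orbit to that of \<open>A\<close>; so up to positive factors the inner product is
  the conjugate of the pairing.\<close>

lemma orbit_constituent_iff:
  assumes A: "A \<in> V" and chi: "\<chi> \<in> irreducible_characters U"
  shows "char_inner U (orbit_character F n \<theta> A) \<chi> \<noteq> 0 \<longleftrightarrow>
    U.character_pairing (stab A) (cocycle A) \<chi> \<noteq> 0"
proof -
  let ?O = "right_orbit F n A"
  obtain W :: "(nat \<Rightarrow> complex) set" and act where irr: "irreducible_module U W act"
    and chi_eq: "\<chi> = module_character U W act" using chi unfolding irreducible_characters_def by blast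
  interpret W: finite_module U W act
    by (intro finite_module.intro finite_module_axioms.intro U_group finite_U[OF finF])
      (use irr in \<open>simp add: irreducible_module_def\<close>)
  have O: "?O \<subseteq> V" "finite ?O" using right_orbit_V[OF A] finite_V finite_subset by blast+
  have "A \<in> ?O" using mone_U dot_act_one[OF A] unfolding right_orbit_def by force
  hence card_O: "card ?O \<noteq> 0" using O(2) by auto
  have finU: "finite (carrier U)" using finite_U[OF finF] .
  let ?s = "\<Sum>h\<in>stab A. cocycle A h * cnj (\<chi> h)"
  have same: "(\<Sum>u\<in>stab B. cocycle B u * cnj (\<chi> u)) = ?s" if B: "B \<in> ?O" for B
  proof -
    obtain g where g: "g \<in> carrier U" "B = dot_act F n A g" using B by (auto simp: right_orbit_def)
    have BV: "B \<in> V" using B O by blast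
    have gi: "inv\<^bsub>U\<^esub> g \<in> carrier U" "dot_act F n B (inv\<^bsub>U\<^esub> g) = A"
      using g A dot_act_inv by auto
    show ?thesis
    proof (rule sum.reindex_bij_witness[where
          j = "\<lambda>u. mmult F n (mmult F n g u) (inv\<^bsub>U\<^esub> g)" and
          i = "\<lambda>h. mmult F n (mmult F n (inv\<^bsub>U\<^esub> g) h) g"])
      fix u assume u: "u \<in> stab B"
      have uU: "u \<in> carrier U" using u by (rule stab_U)
      show "mmult F n (mmult F n g u) (inv\<^bsub>U\<^esub> g) \<in> stab A"
        using stab_conj(1)[OF A g(1)] u g(2) by simp
      have "mmult F n (mmult F n (inv\<^bsub>U\<^esub> g) (mmult F n (mmult F n g u) (inv\<^bsub>U\<^esub> g))) g =
          mmult F n (mmult F n (inv\<^bsub>U\<^esub> g) g) (mmult F n u (mmult F n (inv\<^bsub>U\<^esub> g) g))"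
        using uU g(1) gi(1) by (simp only: U.m_assoc U_closed)
      thus "mmult F n (mmult F n (inv\<^bsub>U\<^esub> g) (mmult F n (mmult F n g u) (inv\<^bsub>U\<^esub> g))) g = u"
        using uU g(1) by simp
      have "\<chi> (mmult F n (mmult F n g u) (inv\<^bsub>U\<^esub> g)) = \<chi> u"
        using W.character_conj[OF uU gi(1)] g(1) by (simp add: chi_eq)
      thus "cocycle A (mmult F n (mmult F n g u) (inv\<^bsub>U\<^esub> g)) *
          cnj (\<chi> (mmult F n (mmult F n g u) (inv\<^bsub>U\<^esub> g))) = cocycle B u * cnj (\<chi> u)"
        using stab_conj(2)[OF A g(1)] u g(2) by simp
    next
      fix h assume h: "h \<in> stab A"
      have hU: "h \<in> carrier U" using h by (rule stab_U)
      show "mmult F n (mmult F n (inv\<^bsub>U\<^esub> g) h) g \<in> stab B"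
        using stab_conj(1)[OF BV gi(1)] h gi(2) g(1) by simp
      have "mmult F n (mmult F n g (mmult F n (mmult F n (inv\<^bsub>U\<^esub> g) h) g)) (inv\<^bsub>U\<^esub> g) =
          mmult F n (mmult F n g (inv\<^bsub>U\<^esub> g)) (mmult F n h (mmult F n g (inv\<^bsub>U\<^esub> g)))"
        using hU g(1) gi(1) by (simp only: U.m_assoc U_closed)
      thus "mmult F n (mmult F n g (mmult F n (mmult F n (inv\<^bsub>U\<^esub> g) h) g)) (inv\<^bsub>U\<^esub> g) = h"
        using hU g(1) by simp
    qed
  qed
  have "(\<Sum>u\<in>carrier U. orbit_character F n \<theta> A u * cnj (\<chi> u)) =
      (\<Sum>u\<in>carrier U. \<Sum>B\<in>{B \<in> ?O. u \<in> stab B}. cocycle B u * cnj (\<chi> u))"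
    by (rule sum.cong) (simp_all add: orbit_character_eq[OF A] sum_distrib_right)
  also have "\<dots> = (\<Sum>B\<in>?O. \<Sum>u\<in>{u \<in> carrier U. u \<in> stab B}. cocycle B u * cnj (\<chi> u))"
    by (rule sum.swap_restrict[OF finU O(2)])
  also have "\<dots> = (\<Sum>B\<in>?O. ?s)"
  proof (rule sum.cong[OF refl])
    fix B assume B: "B \<in> ?O"
    have "{u \<in> carrier U. u \<in> stab B} = stab B" by (auto simp: stab_def)
    thus "(\<Sum>u\<in>{u \<in> carrier U. u \<in> stab B}. cocycle B u * cnj (\<chi> u)) = ?s" using same[OF B] by simp
  qed
  finally have inner: "(\<Sum>u\<in>carrier U. orbit_character F n \<theta> A u * cnj (\<chi> u)) = of_nat (card ?O) * ?s"
    by simp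
  have "cocycle A h * cnj (\<chi> h) = cnj (inverse (cocycle A h) * \<chi> h)" if h: "h \<in> stab A" for h
    using cocycle_stab[OF A h] cnj_theta[of "bil A h"] A stab_U[OF h] by simp
  hence "?s = cnj (U.character_pairing (stab A) (cocycle A) \<chi>)"
    unfolding U.character_pairing_def cnj_sum by (rule sum.cong[OF refl])
  moreover have "card (carrier U) \<noteq> 0" using finU mone_U by auto
  ultimately show ?thesis
    using inner card_O by (simp add: char_inner_def)
qed

abbreviation stab_induced :: "'a mat \<Rightarrow> ('a mat \<Rightarrow> complex) \<Rightarrow> 'a mat \<Rightarrow> complex" where
  "stab_induced A \<equiv> clifford_pair.induced U (K_group A)"

text \<open>By \<open>card_K_group\<close> the prescribed degree is the index of
  \<open>K_group A\<close>, so for each verge the conditions on \<open>\<chi>\<close> become the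
  left side of \<open>clifford_pair.minimal_degree_iff\<close>.\<close>

lemma minimal_degree_characters_eq:
  "minimal_degree_characters F n \<theta> = (\<Union>A\<in>{A. verge F n A}. stab_induced A ` stab_extensions A)"
proof -
  have "irreducible_constituent U \<chi> (orbit_character F n \<theta> A) \<and>
      \<chi> \<one>\<^bsub>U\<^esub> = of_nat (card (carrier F) ^ (verge_a F n A - verge_b F n A)) \<longleftrightarrow>
      \<chi> \<in> stab_induced A ` stab_extensions A" if A: "verge F n A" for A \<chi>
  proof -
    have "card (carrier U) \<noteq> 0" using finite_U[OF finF] mone_U by auto
    hence K0: "card (K_group A) \<noteq> 0" using card_K_group[OF A] by auto
    have "\<chi> \<one>\<^bsub>U\<^esub> = of_nat (card (carrier F) ^ (verge_a F n A - verge_b F n A)) \<longleftrightarrow>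
        of_nat (card (K_group A)) * \<chi> \<one>\<^bsub>U\<^esub> = (of_nat (card (carrier U)) :: complex)"
      using K0 by (simp add: card_K_group[OF A])
    thus ?thesis
      using clifford_pair.minimal_degree_iff[OF clifford_verge[OF A], of \<chi>]
        orbit_constituent_iff[OF verge_V[OF A], of \<chi>]
      unfolding irreducible_constituent_def by blast
  qed
  thus ?thesis unfolding minimal_degree_characters_def by blast
qed

lemma stab_induced_disjoint:
  assumes A: "verge F n A" and B: "verge F n B" and "A \<noteq> B"
  shows "stab_induced A ` stab_extensions A \<inter> stab_induced B ` stab_extensions B = {}"
proof (rule ccontr)
  assume "stab_induced A ` stab_extensions A \<inter> stab_induced B ` stab_extensions B \<noteq> {}"
  then obtain \<psi> \<phi> where "\<psi> \<in> stab_extensions A" "\<phi> \<in> stab_extensions B"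
    "stab_induced A \<psi> = stab_induced B \<phi>" by blast
  then obtain g where "g \<in> carrier U" "\<And>h. h \<in> stab A \<Longrightarrow> mmult F n (mmult F n (inv\<^bsub>U\<^esub> g) h) g \<in> stab B \<Longrightarrow>
      cocycle A h = cocycle B (mmult F n (mmult F n (inv\<^bsub>U\<^esub> g) h) g)"
    using U.induced_eq_imp_compatible[OF clifford_verge[OF A] clifford_verge[OF B]] by metis
  thus False using compatible_imp_eq(1)[OF A B] \<open>A \<noteq> B\<close> by blast
qed

lemma card_verges:
  assumes D: "rook_placement n D"
  shows "card {A. verge F n A \<and> main_conditions F n A = D} = (card (carrier F) - 1) ^ card D"
proof -
  let ?m = "\<lambda>f. mat n n (\<lambda>p. if p \<in> D then f p else \<zero>)"
  have pos: "j < i \<and> i < n" if "(i, j) \<in> D" for i j using rook_less[OF D that] .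
  have "bij_betw (\<lambda>A. restrict (\<lambda>p. A $$ p) D) {A. verge F n A \<and> main_conditions F n A = D}
      (D \<rightarrow>\<^sub>E (carrier F - {\<zero>}))"
  proof (rule bij_betw_byWitness[where f' = ?m])
    show "\<forall>A\<in>{A. verge F n A \<and> main_conditions F n A = D}. ?m (restrict (\<lambda>p. A $$ p) D) = A"
    proof
      fix A assume A: "A \<in> {A. verge F n A \<and> main_conditions F n A = D}"
      have AV: "A \<in> mats F n" using A verge_V by auto
      show "?m (restrict (\<lambda>p. A $$ p) D) = A"
      proof (rule eq_matI)
        fix i j assume "i < dim_row A" "j < dim_col A"
        hence ij: "i < n" "j < n" using mats_dim[OF AV] by auto
        show "?m (restrict (\<lambda>p. A $$ p) D) $$ (i, j) = A $$ (i, j)"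
          using A main_iff[OF ij, of A] ij by (cases "(i, j) \<in> D") auto
      qed (use mats_dim[OF AV] in auto)
    qed
    show "\<forall>f\<in>D \<rightarrow>\<^sub>E (carrier F - {\<zero>}). restrict (\<lambda>p. ?m f $$ p) D = f"
    proof
      fix f assume f: "f \<in> D \<rightarrow>\<^sub>E (carrier F - {\<zero>})"
      show "restrict (\<lambda>p. ?m f $$ p) D = f"
      proof (rule extensionalityI[of _ D])
        fix p assume p: "p \<in> D"
        obtain i j where ij: "p = (i, j)" by (cases p)
        show "restrict (\<lambda>p. ?m f $$ p) D p = f p" using p pos[of i j] unfolding ij by simp
      qed (use f in \<open>simp_all add: PiE_def\<close>)
    qed
    show "(\<lambda>A. restrict (\<lambda>p. A $$ p) D) ` {A. verge F n A \<and> main_conditions F n A = D}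
        \<subseteq> D \<rightarrow>\<^sub>E (carrier F - {\<zero>})"
    proof
      fix f assume "f \<in> (\<lambda>A. restrict (\<lambda>p. A $$ p) D) ` {A. verge F n A \<and> main_conditions F n A = D}"
      then obtain A where A: "verge F n A" "main_conditions F n A = D" "f = restrict (\<lambda>p. A $$ p) D"
        by blast
      have "A $$ (i, j) \<in> carrier F - {\<zero>}" if ij: "(i, j) \<in> D" for i j
        using pos[OF ij] A(2) ij main_iff[of i j A] V_mats[OF verge_V[OF A(1)]] by auto
      thus "f \<in> D \<rightarrow>\<^sub>E (carrier F - {\<zero>})" unfolding A(3) by auto
    qed
    show "?m ` (D \<rightarrow>\<^sub>E (carrier F - {\<zero>})) \<subseteq> {A. verge F n A \<and> main_conditions F n A = D}"
    proof
      fix A assume "A \<in> ?m ` (D \<rightarrow>\<^sub>E (carrier F - {\<zero>}))"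
      then obtain f where f: "f \<in> D \<rightarrow>\<^sub>E (carrier F - {\<zero>})" and A: "A = ?m f" by blast
      have entry: "A $$ (i, j) = (if (i, j) \<in> D then f (i, j) else \<zero>)" if "i < n" "j < n" for i j
        using that by (simp add: A)
      have AV: "A \<in> V"
      proof (rule V_I, rule matsI)
        show "A $$ (i, j) \<in> carrier F" if "i < n" "j < n" for i j
          using f that by (auto simp: entry)
        show "A $$ (i, j) = \<zero>" if "i \<le> j" "j < n" for i j
          using that pos[of i j] by (auto simp: entry)
      qed (simp_all add: A)
      have "(i, j) \<in> main_conditions F n A \<longleftrightarrow> (i, j) \<in> D" for i j
        using f pos[of i j] by (auto simp: main_conditions_def entry)
      hence "main_conditions F n A = D" by auto
      thus "A \<in> {A. verge F n A \<and> main_conditions F n A = D}"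
        using AV D unfolding verge_def rook_placement_def by blast
    qed
  qed
  hence "card {A. verge F n A \<and> main_conditions F n A = D} = card (D \<rightarrow>\<^sub>E (carrier F - {\<zero>}))"
    by (rule bij_betw_same_card)
  thus ?thesis using finite_rook[OF D] finF by (simp add: card_PiE card_Diff_singleton)
qed

lemma card_stab_extensions:
  assumes "verge F n A"
  shows "card (stab_extensions A) = (if obstructed (main_conditions F n A) then 0
    else card (carrier F) ^ card (simple_crossings (main_conditions F n A)))"
    and "finite (stab_extensions A)"
  using card_unobstructed_extensions[OF assms] obstructed_extensions[OF assms]
  by (cases "obstructed (main_conditions F n A)"; simp)+

lemma finite_rook_placements: "finite {D. rook_placement n D}"
proof (rule finite_subset)
  show "{D. rook_placement n D} \<subseteq> Pow ({..<n} \<times> {..<n})" using rook_less by fastforce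
qed simp

lemma card_minimal_degree_characters:
  "card (minimal_degree_characters F n \<theta>) =
    (\<Sum>D\<in>{D. rook_placement n D}. (card (carrier F) - 1) ^ card D *
       (if obstructed D then 0 else card (carrier F) ^ card (simple_crossings D)))"
proof -
  let ?V = "{A. verge F n A}"
  let ?e = "\<lambda>D. if obstructed D then 0 else card (carrier F) ^ card (simple_crossings D)"
  have finV: "finite ?V" by (rule finite_subset[OF _ finite_V]) (auto simp: verge_V)
  have "card (minimal_degree_characters F n \<theta>) =
      (\<Sum>A\<in>?V. card (stab_induced A ` stab_extensions A))"
    unfolding minimal_degree_characters_eq
    by (rule card_UN_disjoint[OF finV])
      (use card_stab_extensions(2) stab_induced_disjoint in auto)
  also have "\<dots> = (\<Sum>A\<in>?V. ?e (main_conditions F n A))"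
  proof (rule sum.cong[OF refl])
    fix A assume "A \<in> ?V"
    hence A: "verge F n A" by simp
    show "card (stab_induced A ` stab_extensions A) = ?e (main_conditions F n A)"
      using card_image[OF clifford_pair.inj_on_induced[OF clifford_verge[OF A]]]
        card_stab_extensions(1)[OF A] by simp
  qed
  also have "\<dots> = (\<Sum>D\<in>{D. rook_placement n D}. \<Sum>A\<in>{A \<in> ?V. main_conditions F n A = D}.
      ?e (main_conditions F n A))"
    by (rule sum.group[symmetric, OF finV finite_rook_placements]) (use verge_rook in auto)
  also have "\<dots> = (\<Sum>D\<in>{D. rook_placement n D}. (card (carrier F) - 1) ^ card D * ?e D)"
  proof (rule sum.cong[OF refl])
    fix D assume "D \<in> {D. rook_placement n D}"
    hence "card {A \<in> ?V. main_conditions F n A = D} = (card (carrier F) - 1) ^ card D"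
      using card_verges by simp
    moreover have "(\<Sum>A\<in>{A \<in> ?V. main_conditions F n A = D}. ?e (main_conditions F n A)) =
        (\<Sum>A\<in>{A \<in> ?V. main_conditions F n A = D}. ?e D)" by (rule sum.cong) auto
    ultimately show "(\<Sum>A\<in>{A \<in> ?V. main_conditions F n A = D}. ?e (main_conditions F n A)) =
        (card (carrier F) - 1) ^ card D * ?e D" by simp
  qed
  finally show ?thesis .
qed

end

section \<open>The counting polynomial and its coefficients\<close>

lemma coeff_nonneg_mult:
  fixes p q :: "int poly"
  assumes "\<And>k. coeff p k \<ge> 0" "\<And>k. coeff q k \<ge> 0" shows "coeff (p * q) k \<ge> 0"
  unfolding coeff_mult by (intro sum_nonneg mult_nonneg_nonneg assms)

lemma coeff_nonneg_power:
  fixes p :: "int poly"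
  assumes "\<And>k. coeff p k \<ge> 0" shows "coeff (p ^ m) k \<ge> 0"
  by (induction m arbitrary: k) (use assms in \<open>auto intro: coeff_nonneg_mult\<close>)

text \<open>The linear factor \<open>[:1, 1:]\<close> takes the value q at q - 1; using it instead
  of a monomial in q keeps the coefficients nonnegative.\<close>

definition minimal_degree_poly :: "nat \<Rightarrow> int poly" where
  "minimal_degree_poly n = (\<Sum>D\<in>{D. rook_placement n D}.
     if obstructed D then 0 else monom 1 (card D) * [:1, 1:] ^ card (simple_crossings D))"

lemma coeff_minimal_degree_poly: "coeff (minimal_degree_poly n) k \<ge> 0"
proof -
  have "coeff [:1, 1 :: int:] k \<ge> 0" for k by (auto simp: coeff_pCons split: nat.splits)
  thus ?thesis
    unfolding minimal_degree_poly_def coeff_sum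
    by (intro sum_nonneg) (auto intro!: coeff_nonneg_mult coeff_nonneg_power)
qed

theorem theorem5p8:
  fixes n :: nat
  shows "\<exists>d :: int poly. (\<forall>k. coeff d k \<ge> 0) \<and>
    (\<forall>q. primepow q \<longrightarrow>
      (\<forall>(F :: nat ring) \<theta>.
         field F \<and> finite (carrier F) \<and> card (carrier F) = q \<and> nontrivial_additive_character F \<theta> \<longrightarrow>
         poly d (int q - 1) = int (card (minimal_degree_characters F n \<theta>))))"
proof (intro exI[of _ "minimal_degree_poly n"] conjI allI impI)
  fix q :: nat and F :: "nat ring" and \<theta>
  assume "primepow q" and F: "field F \<and> finite (carrier F) \<and> card (carrier F) = q \<and>
    nontrivial_additive_character F \<theta>"
  interpret verge_action F n \<theta>
    by (intro verge_action.intro unitriangular_group.intro verge_action_axioms.intro) (use F in auto)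
  \<comment> \<open>The count contains the subtraction \<open>card (carrier F) - 1\<close> of
    natural numbers; it agrees with \<open>int q - 1\<close> because the field is nonempty.\<close>
  have "carrier F \<noteq> {}" using zero_closed by blast
  hence "card (carrier F) > 0" using F card_gt_0_iff by blast
  hence q: "int (card (carrier F) - 1) = int q - 1" "card (carrier F) = q" using F by linarith+
  have "int (card (minimal_degree_characters F n \<theta>)) =
    (\<Sum>D\<in>{D. rook_placement n D}. int (card (carrier F) - 1) ^ card D *
       (if obstructed D then 0 else int q ^ card (simple_crossings D)))"
    unfolding card_minimal_degree_characters q(2) by simp (rule sum.cong, auto)
  also have "\<dots> = poly (minimal_degree_poly n) (int q - 1)"
    unfolding q(1) minimal_degree_poly_def poly_sum
    by (rule sum.cong) (auto simp: poly_monom)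
  finally show "poly (minimal_degree_poly n) (int q - 1) =
    int (card (minimal_degree_characters F n \<theta>))" by simp
qed (rule coeff_minimal_degree_poly)

end
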